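(* Let $K$ be a field, possibly equipped with additional structure in some first-order language expanding the language of rings, such that the theory of this structure is NIP and $K$ is t-henselian. Then $K$ admits at most one definable V-topology.
   Context: A V-topology on a field $K$ is a field topology induced by a non-trivial (Krull) valuation or by a non-trivial absolute value on $K$. A V-topological field $(K,\tau)$ is t-henselian if for every $n\geq 1$ there is a $\tau$-open neighbourhood $U$ of $0$ such that every polynomial $X^{n+1}+X^n+a_{n-1}X^{n-1}+\dots+a_0$ with all $a_i\in U$ has a root in $K$; a field is t-henselian if it admits a t-henselian V-topology. A V-topology $\tau$ on $K$ is definable (in the given structure) if there is a formula $\varphi(x,\bar y)$ and a set $B$ of parameter tuples from $K$ such that $\{\varphi(K,\bar b):\bar b\in B\}$ is a base of $\tau$-neighbourhoods of $0$. A theory is NIP if no formula $\varphi(\bar x,\bar y)$ has the independence property, i.e. for every $\varphi$ there is $k$ such that in no model are there tuples $(\bar a_i)_{i<k}$, $(\bar b_J)_{J\subseteq\{0,\dots,k-1\}}$ with $\varphi(\bar a_i,\bar b_J)\iff i\in J$. *)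

theory Defs
  imports
    "HOL-Analysis.Abstract_Topology"
    "HOL-Analysis.Product_Topology"
    "HOL-Algebra.Group"
    "HOL-Computational_Algebra.Polynomial"
    "HOL-Library.Nat_Bijection"
begin

section \<open>First-order logic with equality\<close>

record ('f, 'r) language =
  fun_syms :: "'f set"
  fun_arity :: "'f \<Rightarrow> nat"
  rel_syms :: "'r set"
  rel_arity :: "'r \<Rightarrow> nat"

datatype 'f tm = Var nat | App 'f "'f tm list"

text \<open>Variables are de Bruijn indices: the quantifier binds index 0 of its body.\<close>

datatype ('f, 'r) fm =
    Eq "'f tm" "'f tm"
  | Rel 'r "'f tm list"
  | Neg "('f, 'r) fm"
  | Conj "('f, 'r) fm" "('f, 'r) fm"
  | Exists "('f, 'r) fm"

primrec wf_tm :: "('f, 'r) language \<Rightarrow> 'f tm \<Rightarrow> bool" where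
  "wf_tm L (Var i) \<longleftrightarrow> True"
| "wf_tm L (App f ts) \<longleftrightarrow>
     f \<in> fun_syms L \<and> length ts = fun_arity L f \<and> list_all (wf_tm L) ts"

primrec wf_fm :: "('f, 'r) language \<Rightarrow> ('f, 'r) fm \<Rightarrow> bool" where
  "wf_fm L (Eq s t) \<longleftrightarrow> wf_tm L s \<and> wf_tm L t"
| "wf_fm L (Rel R ts) \<longleftrightarrow>
     R \<in> rel_syms L \<and> length ts = rel_arity L R \<and> list_all (wf_tm L) ts"
| "wf_fm L (Neg \<phi>) \<longleftrightarrow> wf_fm L \<phi>"
| "wf_fm L (Conj \<phi> \<psi>) \<longleftrightarrow> wf_fm L \<phi> \<and> wf_fm L \<psi>"
| "wf_fm L (Exists \<phi>) \<longleftrightarrow> wf_fm L \<phi>"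

primrec fv_tm :: "'f tm \<Rightarrow> nat set" where
  "fv_tm (Var i) = {i}"
| "fv_tm (App f ts) = \<Union> (set (map fv_tm ts))"

primrec fv :: "('f, 'r) fm \<Rightarrow> nat set" where
  "fv (Eq s t) = fv_tm s \<union> fv_tm t"
| "fv (Rel R ts) = \<Union> (set (map fv_tm ts))"
| "fv (Neg \<phi>) = fv \<phi>"
| "fv (Conj \<phi> \<psi>) = fv \<phi> \<union> fv \<psi>"
| "fv (Exists \<phi>) = {i. Suc i \<in> fv \<phi>}"

text \<open>
  The universe of a structure is the whole type \<open>'m\<close>. Values of the interpretations at symbols
  outside the language, or at lists of the wrong length, are never used by well-formed formulas.
\<close>

record ('f, 'r, 'm) struc =
  fun_interp :: "'f \<Rightarrow> 'm list \<Rightarrow> 'm"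
  rel_interp :: "'r \<Rightarrow> 'm list \<Rightarrow> bool"

primrec eval_tm :: "('f, 'r, 'm) struc \<Rightarrow> (nat \<Rightarrow> 'm) \<Rightarrow> 'f tm \<Rightarrow> 'm" where
  "eval_tm M e (Var i) = e i"
| "eval_tm M e (App f ts) = fun_interp M f (map (eval_tm M e) ts)"

primrec sat :: "('f, 'r, 'm) struc \<Rightarrow> (nat \<Rightarrow> 'm) \<Rightarrow> ('f, 'r) fm \<Rightarrow> bool" where
  "sat M e (Eq s t) \<longleftrightarrow> eval_tm M e s = eval_tm M e t"
| "sat M e (Rel R ts) \<longleftrightarrow> rel_interp M R (map (eval_tm M e) ts)"
| "sat M e (Neg \<phi>) \<longleftrightarrow> \<not> sat M e \<phi>"
| "sat M e (Conj \<phi> \<psi>) \<longleftrightarrow> sat M e \<phi> \<and> sat M e \<psi>"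
| "sat M e (Exists \<phi>) \<longleftrightarrow> (\<exists>a. sat M (case_nat a e) \<phi>)"

text \<open>
  \<open>sat_tuple M \<phi> cs\<close> assigns the entries of the list \<open>cs\<close> to the variables \<open>0, 1, \<dots>\<close>; it is only
  used when all free variables of \<open>\<phi>\<close> are below \<open>length cs\<close>.
\<close>

definition sat_tuple :: "('f, 'r, 'm) struc \<Rightarrow> ('f, 'r) fm \<Rightarrow> 'm list \<Rightarrow> bool" where
  "sat_tuple M \<phi> cs \<longleftrightarrow> sat M ((!) cs) \<phi>"

definition sentences :: "('f, 'r) language \<Rightarrow> ('f, 'r) fm set" where
  "sentences L = {\<phi>. wf_fm L \<phi> \<and> fv \<phi> = {}}"

definition theory_of :: "('f, 'r) language \<Rightarrow> ('f, 'r, 'm) struc \<Rightarrow> ('f, 'r) fm set" where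
  "theory_of L M = {\<phi> \<in> sentences L. \<forall>e. sat M e \<phi>}"

definition is_model :: "('f, 'r, 'm) struc \<Rightarrow> ('f, 'r) fm set \<Rightarrow> bool" where
  "is_model M T \<longleftrightarrow> (\<forall>\<phi>\<in>T. \<forall>e. sat M e \<phi>)"


section \<open>NIP\<close>

text \<open>
  In \<open>\<phi>(x, y)\<close> the tuple \<open>x\<close> consists of the variables \<open>0, \<dots>, p - 1\<close> and \<open>y\<close> of the variables
  \<open>p, \<dots>, p + q - 1\<close>.
\<close>

definition shatters ::
    "('f, 'r, 'm) struc \<Rightarrow> ('f, 'r) fm \<Rightarrow> nat \<Rightarrow> nat \<Rightarrow> nat \<Rightarrow> bool" where
  "shatters M \<phi> p q k \<longleftrightarrow>
     (\<exists>(a :: nat \<Rightarrow> 'm list) (b :: nat set \<Rightarrow> 'm list).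
        (\<forall>i<k. length (a i) = p) \<and>
        (\<forall>J. J \<subseteq> {..<k} \<longrightarrow> length (b J) = q) \<and>
        (\<forall>i<k. \<forall>J. J \<subseteq> {..<k} \<longrightarrow> (sat_tuple M \<phi> (a i @ b J) \<longleftrightarrow> i \<in> J)))"

text \<open>
  HOL cannot quantify over all types inside a formula, so the universe \<open>'m\<close> of the models in
  question is a parameter. For the theory of a structure with universe \<open>'k\<close>, NIP for models
  with universe \<open>'k\<close> implies NIP for models with any universe: see \<open>NIP_all_universes\<close> below.
\<close>

definition NIP :: "'m itself \<Rightarrow> ('f, 'r) language \<Rightarrow> ('f, 'r) fm set \<Rightarrow> bool" where
  "NIP (_ :: 'm itself) L T \<longleftrightarrow>
     (\<forall>\<phi> p q. wf_fm L \<phi> \<and> fv \<phi> \<subseteq> {..<p + q} \<longrightarrow>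
        (\<exists>k. \<forall>M :: ('f, 'r, 'm) struc. is_model M T \<longrightarrow> \<not> shatters M \<phi> p q k))"

subsection \<open>Independence of the universe type\<close>

primrec rename_tm :: "(nat \<Rightarrow> nat) \<Rightarrow> 'f tm \<Rightarrow> 'f tm" where
  "rename_tm r (Var i) = Var (r i)"
| "rename_tm r (App f ts) = App f (map (rename_tm r) ts)"

primrec rename :: "(nat \<Rightarrow> nat) \<Rightarrow> ('f, 'r) fm \<Rightarrow> ('f, 'r) fm" where
  "rename r (Eq s t) = Eq (rename_tm r s) (rename_tm r t)"
| "rename r (Rel R ts) = Rel R (map (rename_tm r) ts)"
| "rename r (Neg \<phi>) = Neg (rename r \<phi>)"
| "rename r (Conj \<phi> \<psi>) = Conj (rename r \<phi>) (rename r \<psi>)"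
| "rename r (Exists \<phi>) = Exists (rename (case_nat 0 (\<lambda>i. Suc (r i))) \<phi>)"

lemma eval_rename_tm: "eval_tm M e (rename_tm r t) = eval_tm M (\<lambda>i. e (r i)) t"
  by (induction t) (auto cong: map_cong simp: comp_def)

lemma sat_rename: "sat M e (rename r \<phi>) \<longleftrightarrow> sat M (\<lambda>i. e (r i)) \<phi>"
proof (induction \<phi> arbitrary: e r)
  case (Exists \<phi>)
  have "(\<lambda>i. case_nat a e (case_nat 0 (\<lambda>i. Suc (r i)) i)) = case_nat a (\<lambda>i. e (r i))" for a
    by (rule ext) (simp split: nat.split)
  then show ?case by (simp add: Exists)
qed (auto simp: eval_rename_tm comp_def)

lemma wf_rename_tm: "wf_tm L (rename_tm r t) = wf_tm L t"
  by (induction t) (auto simp: list_all_iff)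

lemma wf_rename: "wf_fm L (rename r \<phi>) = wf_fm L \<phi>"
  by (induction \<phi> arbitrary: r) (auto simp: list_all_iff wf_rename_tm)

lemma eval_tm_cong: "(\<And>i. i \<in> fv_tm t \<Longrightarrow> e i = e' i) \<Longrightarrow> eval_tm M e t = eval_tm M e' t"
proof (induction t)
  case (App f ts)
  then have "map (eval_tm M e) ts = map (eval_tm M e') ts" by (intro map_cong) auto
  then show ?case by (simp only: eval_tm.simps)
qed auto

lemma sat_cong: "(\<And>i. i \<in> fv \<phi> \<Longrightarrow> e i = e' i) \<Longrightarrow> sat M e \<phi> = sat M e' \<phi>"
proof (induction \<phi> arbitrary: e e')
  case (Eq s t)
  then have "eval_tm M e s = eval_tm M e' s" "eval_tm M e t = eval_tm M e' t"
    by (intro eval_tm_cong; simp)+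
  then show ?case by simp
next
  case (Rel R ts)
  then have "map (eval_tm M e) ts = map (eval_tm M e') ts"
    by (intro map_cong eval_tm_cong) auto
  then show ?case by (simp only: sat.simps)
next
  case (Neg \<phi>)
  have "sat M e \<phi> = sat M e' \<phi>"
    by (rule Neg.IH) (use Neg.prems in simp)
  then show ?case by simp
next
  case (Conj \<phi> \<psi>)
  have "sat M e \<phi> = sat M e' \<phi>"
    by (rule Conj.IH(1)) (use Conj.prems in simp)
  moreover have "sat M e \<psi> = sat M e' \<psi>"
    by (rule Conj.IH(2)) (use Conj.prems in simp)
  ultimately show ?case by simp
next
  case (Exists \<phi>)
  have "sat M (case_nat a e) \<phi> = sat M (case_nat a e') \<phi>" for a
    by (rule Exists.IH) (use Exists.prems in \<open>auto split: nat.split\<close>)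
  then show ?case by simp
qed

lemma finite_fv_tm: "finite (fv_tm t)"
  by (induction t) auto

lemma finite_fv: "finite (fv \<phi>)"
proof (induction \<phi>)
  case (Exists \<phi>)
  have "fv (Exists \<phi>) = Suc -` fv \<phi>" by auto
  then show ?case using Exists by (simp add: finite_vimageI)
qed (auto simp: finite_fv_tm)

primrec close :: "nat \<Rightarrow> ('f, 'r) fm \<Rightarrow> ('f, 'r) fm" where
  "close 0 \<phi> = \<phi>"
| "close (Suc n) \<phi> = close n (Exists \<phi>)"

lemma wf_close: "wf_fm L (close n \<phi>) = wf_fm L \<phi>"
  by (induction n arbitrary: \<phi>) auto

lemma fv_close: "fv \<phi> \<subseteq> {..<n} \<Longrightarrow> fv (close n \<phi>) = {}"
proof (induction n arbitrary: \<phi>)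
  case (Suc n)
  have "fv (Exists \<phi>) \<subseteq> {..<n}" using Suc.prems by (auto simp: subset_iff)
  then have "fv (close n (Exists \<phi>)) = {}" by (rule Suc.IH)
  then show ?case by simp
qed simp

lemma sat_close: "fv \<phi> \<subseteq> {..<n} \<Longrightarrow> sat M e (close n \<phi>) \<longleftrightarrow> (\<exists>e'. sat M e' \<phi>)"
proof (induction n arbitrary: \<phi>)
  case 0
  then have "sat M e \<phi> = sat M e' \<phi>" for e' by (intro sat_cong) auto
  then show ?case unfolding close.simps by blast
next
  case (Suc n)
  have "(\<exists>e'. sat M e' (Exists \<phi>)) \<longleftrightarrow> (\<exists>e'. sat M e' \<phi>)"
  proof
    assume "\<exists>e'. sat M e' (Exists \<phi>)"
    then show "\<exists>e'. sat M e' \<phi>" by auto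
  next
    assume "\<exists>e'. sat M e' \<phi>"
    then obtain e' where e': "sat M e' \<phi>" by blast
    have "case_nat (e' 0) (\<lambda>i. e' (Suc i)) = e'"
      by (rule ext) (simp split: nat.split)
    then have "sat M (\<lambda>i. e' (Suc i)) (Exists \<phi>)"
      using e' by (auto intro: exI[of _ "e' 0"])
    then show "\<exists>e'. sat M e' (Exists \<phi>)" by blast
  qed
  moreover have "fv (Exists \<phi>) \<subseteq> {..<n}" using Suc.prems by (auto simp: subset_iff)
  ultimately show ?case using Suc.IH by simp
qed

primrec conj_list :: "('f, 'r) fm list \<Rightarrow> ('f, 'r) fm" where
  "conj_list [] = Exists (Eq (Var 0) (Var 0))"
| "conj_list (\<phi> # \<phi>s) = Conj \<phi> (conj_list \<phi>s)"

lemma sat_conj_list: "sat M e (conj_list \<phi>s) \<longleftrightarrow> (\<forall>\<phi>\<in>set \<phi>s. sat M e \<phi>)"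
  by (induction \<phi>s) auto

lemma wf_conj_list: "wf_fm L (conj_list \<phi>s) \<longleftrightarrow> (\<forall>\<phi>\<in>set \<phi>s. wf_fm L \<phi>)"
  by (induction \<phi>s) auto

definition shatter_var :: "nat \<Rightarrow> nat \<Rightarrow> nat set \<Rightarrow> nat \<Rightarrow> nat" where
  "shatter_var p i J l =
     (if l < p then 2 * prod_encode (i, l) else 2 * prod_encode (set_encode J, l - p) + 1)"

definition shatter_fm :: "('f, 'r) fm \<Rightarrow> nat \<Rightarrow> nat \<Rightarrow> ('f, 'r) fm" where
  "shatter_fm \<phi> p k =
     (let ps = (SOME ps. set ps = {..<k} \<times> Pow {..<k});
          \<psi> = conj_list (map (\<lambda>(i, J). if i \<in> J then rename (shatter_var p i J) \<phi>
                                   else Neg (rename (shatter_var p i J) \<phi>)) ps)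
      in close (Suc (Max (insert 0 (fv \<psi>)))) \<psi>)"

lemma shatter_fm_sentence:
  assumes "wf_fm L \<phi>" shows "shatter_fm \<phi> p k \<in> sentences L"
proof -
  have "fv (close (Suc (Max (insert 0 (fv \<psi>)))) \<psi>) = {}" for \<psi> :: "('a, 'b) fm"
    by (rule fv_close) (auto simp: finite_fv less_Suc_eq_le)
  then have "fv (shatter_fm \<phi> p k) = {}"
    unfolding shatter_fm_def Let_def .
  moreover have "wf_fm L (shatter_fm \<phi> p k)"
    using assms unfolding shatter_fm_def Let_def wf_close wf_conj_list
    by (auto simp: wf_rename)
  ultimately show ?thesis by (simp add: sentences_def)
qed

lemma sat_shatter_fm:
  fixes M :: "('f, 'r, 'm) struc"
  assumes fv: "fv \<phi> \<subseteq> {..<p + q}"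
  shows "sat M e (shatter_fm \<phi> p k) \<longleftrightarrow> shatters M \<phi> p q k"
proof -
  define ps where "ps = (SOME ps. set ps = {..<k} \<times> Pow {..<k})"
  have ps: "set ps = {..<k} \<times> Pow {..<k}"
    unfolding ps_def by (rule someI_ex, rule finite_list) auto
  define \<psi> where "\<psi> = conj_list (map (\<lambda>(i, J). if i \<in> J then rename (shatter_var p i J) \<phi>
                                   else Neg (rename (shatter_var p i J) \<phi>)) ps)"
  have "fv \<psi> \<subseteq> {..<Suc (Max (insert 0 (fv \<psi>)))}"
    by (auto simp: finite_fv less_Suc_eq_le)
  then have "sat M e (shatter_fm \<phi> p k) \<longleftrightarrow> (\<exists>e'. sat M e' \<psi>)"
    unfolding shatter_fm_def Let_def ps_def[symmetric] \<psi>_def[symmetric] by (rule sat_close)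
  also have "\<dots> \<longleftrightarrow> (\<exists>e'. \<forall>i<k. \<forall>J. J \<subseteq> {..<k} \<longrightarrow>
      (sat M (\<lambda>l. e' (shatter_var p i J l)) \<phi> \<longleftrightarrow> i \<in> J))" (is "_ \<longleftrightarrow> (\<exists>e'. ?P e')")
  proof -
    have "sat M e' \<psi> \<longleftrightarrow> ?P e'" for e' :: "nat \<Rightarrow> 'm"
    proof -
      define F where "F = (\<lambda>(i, J). if i \<in> J then rename (shatter_var p i J) \<phi>
                                   else Neg (rename (shatter_var p i J) \<phi>))"
      have "sat M e' \<psi> \<longleftrightarrow> (\<forall>x\<in>{..<k} \<times> Pow {..<k}. sat M e' (F x))"
        unfolding \<psi>_def F_def[symmetric] sat_conj_list set_map ps ball_simps ..
      also have "\<dots> \<longleftrightarrow> (\<forall>i<k. \<forall>J. J \<subseteq> {..<k} \<longrightarrow> sat M e' (F (i, J)))"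
        by auto
      also have "\<dots> \<longleftrightarrow> ?P e'"
      proof -
        have "sat M e' (F (i, J)) \<longleftrightarrow> (sat M (\<lambda>l. e' (shatter_var p i J l)) \<phi> \<longleftrightarrow> i \<in> J)" for i J
          by (simp add: F_def sat_rename)
        then show ?thesis by presburger
      qed
      finally show ?thesis .
    qed
    then show ?thesis by simp
  qed
  also have "\<dots> \<longleftrightarrow> shatters M \<phi> p q k"
  proof
    assume "\<exists>e'. ?P e'"
    then obtain e' where e': "?P e'" by blast
    define a where "a i = map (\<lambda>l. e' (2 * prod_encode (i, l))) [0..<p]" for i :: nat
    define b where "b J = map (\<lambda>l. e' (2 * prod_encode (set_encode J, l) + 1)) [0..<q]" for J
    have "sat_tuple M \<phi> (a i @ b J) \<longleftrightarrow> sat M (\<lambda>l. e' (shatter_var p i J l)) \<phi>" for i J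
      unfolding sat_tuple_def
    proof (rule sat_cong)
      fix l assume "l \<in> fv \<phi>"
      then have "l < p + q" using fv by auto
      then show "(a i @ b J) ! l = e' (shatter_var p i J l)"
        by (cases "l < p") (auto simp: a_def b_def nth_append shatter_var_def)
    qed
    then show "shatters M \<phi> p q k"
      unfolding shatters_def using e'
      by (intro exI[of _ a] exI[of _ b]) (auto simp: a_def b_def)
  next
    assume "shatters M \<phi> p q k"
    then obtain a :: "nat \<Rightarrow> 'm list" and b :: "nat set \<Rightarrow> 'm list" where
      a: "\<forall>i<k. length (a i) = p" and
      ab: "\<forall>i<k. \<forall>J. J \<subseteq> {..<k} \<longrightarrow> (sat_tuple M \<phi> (a i @ b J) \<longleftrightarrow> i \<in> J)"
      unfolding shatters_def by (elim exE conjE)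
    define e' where "e' v = (let (c, l) = prod_decode (v div 2) in
       if even v then a c ! l else b (set_decode c) ! l)" for v
    have "sat M (\<lambda>l. e' (shatter_var p i J l)) \<phi> \<longleftrightarrow> i \<in> J" if "i < k" "J \<subseteq> {..<k}" for i J
    proof -
      have "finite J" using that finite_subset by blast
      then have "sat M (\<lambda>l. e' (shatter_var p i J l)) \<phi> \<longleftrightarrow> sat_tuple M \<phi> (a i @ b J)"
        unfolding sat_tuple_def using a that(1)
        by (intro sat_cong) (auto simp: e'_def shatter_var_def nth_append)
      then show ?thesis using ab that by simp
    qed
    then show "\<exists>e'. ?P e'" by blast
  qed
  finally show ?thesis .
qed

lemma NIP_all_universes:
  fixes K :: "('f, 'r, 'k) struc"
  assumes "NIP TYPE('k) L (theory_of L K)"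
  shows "NIP TYPE('m) L (theory_of L K)"
  unfolding NIP_def
proof (intro allI impI, elim conjE)
  fix \<phi> :: "('f, 'r) fm" and p q
  assume wf: "wf_fm L \<phi>" and fv: "fv \<phi> \<subseteq> {..<p + q}"
  have "is_model K (theory_of L K)"
    by (simp add: is_model_def theory_of_def)
  then obtain k where k: "\<not> shatters K \<phi> p q k"
    using assms wf fv unfolding NIP_def by blast
  have "Neg (shatter_fm \<phi> p k) \<in> sentences L"
    using shatter_fm_sentence[OF wf, of p k] by (simp add: sentences_def)
  moreover have "sat K e (Neg (shatter_fm \<phi> p k))" for e
    using k by (simp add: sat_shatter_fm[OF fv])
  ultimately have *: "Neg (shatter_fm \<phi> p k) \<in> theory_of L K"
    by (simp add: theory_of_def)
  have "\<not> shatters M \<phi> p q k" if "is_model M (theory_of L K)" for M :: "('f, 'r, 'm) struc"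
  proof -
    have "sat M undefined (Neg (shatter_fm \<phi> p k))"
      using that * unfolding is_model_def by blast
    then show ?thesis by (simp add: sat_shatter_fm[OF fv])
  qed
  then show "\<exists>k. \<forall>M :: ('f, 'r, 'm) struc.
      is_model M (theory_of L K) \<longrightarrow> \<not> shatters M \<phi> p q k" by blast
qed


section \<open>Expansions of fields\<close>

datatype ring_sym = Sym_Zero | Sym_One | Sym_Plus | Sym_Minus | Sym_Times

primrec ring_arity :: "ring_sym \<Rightarrow> nat" where
  "ring_arity Sym_Zero = 0"
| "ring_arity Sym_One = 0"
| "ring_arity Sym_Plus = 2"
| "ring_arity Sym_Minus = 1"
| "ring_arity Sym_Times = 2"

definition expands_ring_language :: "(ring_sym + 'f, 'r) language \<Rightarrow> bool" where
  "expands_ring_language L \<longleftrightarrow>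
     (\<forall>s. Inl s \<in> fun_syms L \<and> fun_arity L (Inl s) = ring_arity s)"

definition expands_field :: "(ring_sym + 'f, 'r, 'k::field) struc \<Rightarrow> bool" where
  "expands_field K \<longleftrightarrow>
     fun_interp K (Inl Sym_Zero) [] = 0 \<and>
     fun_interp K (Inl Sym_One) [] = 1 \<and>
     (\<forall>x y. fun_interp K (Inl Sym_Plus) [x, y] = x + y) \<and>
     (\<forall>x. fun_interp K (Inl Sym_Minus) [x] = - x) \<and>
     (\<forall>x y. fun_interp K (Inl Sym_Times) [x, y] = x * y)"


section \<open>V-topologies\<close>

definition field_topology :: "'k::field topology \<Rightarrow> bool" where
  "field_topology \<tau> \<longleftrightarrow>
     topspace \<tau> = UNIV \<and>
     continuous_map (prod_topology \<tau> \<tau>) \<tau> (\<lambda>(x, y). x + y) \<and>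
     continuous_map \<tau> \<tau> uminus \<and>
     continuous_map (prod_topology \<tau> \<tau>) \<tau> (\<lambda>(x, y). x * y) \<and>
     continuous_map (subtopology \<tau> (- {0})) \<tau> inverse"

definition absolute_value :: "('k::field \<Rightarrow> real) \<Rightarrow> bool" where
  "absolute_value f \<longleftrightarrow>
     (\<forall>x. 0 \<le> f x) \<and> (\<forall>x. f x = 0 \<longleftrightarrow> x = 0) \<and>
     (\<forall>x y. f (x * y) = f x * f y) \<and> (\<forall>x y. f (x + y) \<le> f x + f y)"

definition absolute_value_topology :: "('k::field \<Rightarrow> real) \<Rightarrow> 'k topology" where
  "absolute_value_topology f =
     topology (\<lambda>U. \<forall>x\<in>U. \<exists>\<epsilon>>0. {y. f (y - x) < \<epsilon>} \<subseteq> U)"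

lemma openin_absolute_value_topology:
  "openin (absolute_value_topology f) U \<longleftrightarrow> (\<forall>x\<in>U. \<exists>\<epsilon>>0. {y. f (y - x) < \<epsilon>} \<subseteq> U)"
proof -
  have "istopology (\<lambda>U. \<forall>x\<in>U. \<exists>\<epsilon>>0. {y. f (y - x) < \<epsilon>} \<subseteq> U)"
    unfolding istopology_def
  proof (intro conjI allI impI ballI)
    fix S T x
    assume "\<forall>x\<in>S. \<exists>\<epsilon>>0. {y. f (y - x) < \<epsilon>} \<subseteq> S" "\<forall>x\<in>T. \<exists>\<epsilon>>0. {y. f (y - x) < \<epsilon>} \<subseteq> T" "x \<in> S \<inter> T"
    then obtain d e where "d > 0" "e > 0" "{y. f (y - x) < d} \<subseteq> S" "{y. f (y - x) < e} \<subseteq> T"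
      by (metis IntD1 IntD2)
    then show "\<exists>\<epsilon>>0. {y. f (y - x) < \<epsilon>} \<subseteq> S \<inter> T"
      by (intro exI[of _ "min d e"]) auto
  next
    fix \<K> :: "'a set set" and x
    assume *: "\<forall>U\<in>\<K>. \<forall>x\<in>U. \<exists>\<epsilon>>0. {y. f (y - x) < \<epsilon>} \<subseteq> U" and "x \<in> \<Union>\<K>"
    then obtain U where "U \<in> \<K>" "x \<in> U" by blast
    with * obtain e where "e > 0" "{y. f (y - x) < e} \<subseteq> U" by blast
    with \<open>U \<in> \<K>\<close> show "\<exists>\<epsilon>>0. {y. f (y - x) < \<epsilon>} \<subseteq> \<Union>\<K>" by blast
  qed
  then show ?thesis by (simp add: absolute_value_topology_def)
qed

definition ordered_abelian_group :: "('g, 'x) monoid_scheme \<Rightarrow> 'g rel \<Rightarrow> bool" where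
  "ordered_abelian_group G r \<longleftrightarrow>
     comm_group G \<and> linear_order_on (carrier G) r \<and>
     (\<forall>a b. (a, b) \<in> r \<longrightarrow> (\<forall>c\<in>carrier G. (a \<otimes>\<^bsub>G\<^esub> c, b \<otimes>\<^bsub>G\<^esub> c) \<in> r))"

text \<open>
  A Krull valuation is given by its restriction to the nonzero elements, with \<open>v 0 = \<infinity>\<close> left
  implicit; the ordered group \<open>(G, r)\<close>, written multiplicatively, is required to be exactly the
  value group. (Over a larger group the balls below could induce the discrete topology.)
\<close>

definition krull_valuation ::
    "('g, 'x) monoid_scheme \<Rightarrow> 'g rel \<Rightarrow> ('k::field \<Rightarrow> 'g) \<Rightarrow> bool" where
  "krull_valuation G r v \<longleftrightarrow>
     ordered_abelian_group G r \<and>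
     v ` (- {0}) = carrier G \<and>
     (\<forall>x y. x \<noteq> 0 \<longrightarrow> y \<noteq> 0 \<longrightarrow> v (x * y) = v x \<otimes>\<^bsub>G\<^esub> v y) \<and>
     (\<forall>x y. x \<noteq> 0 \<longrightarrow> y \<noteq> 0 \<longrightarrow> x + y \<noteq> 0 \<longrightarrow> (v x, v (x + y)) \<in> r \<or> (v y, v (x + y)) \<in> r)"

definition valuation_ball :: "'g rel \<Rightarrow> ('k::field \<Rightarrow> 'g) \<Rightarrow> 'k \<Rightarrow> 'g \<Rightarrow> 'k set" where
  "valuation_ball r v x \<gamma> = {y. y \<noteq> x \<longrightarrow> (\<gamma>, v (y - x)) \<in> r \<and> v (y - x) \<noteq> \<gamma>}"

definition valuation_topology ::
    "('g, 'x) monoid_scheme \<Rightarrow> 'g rel \<Rightarrow> ('k::field \<Rightarrow> 'g) \<Rightarrow> 'k topology" where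
  "valuation_topology G r v =
     topology (\<lambda>U. \<forall>x\<in>U. \<exists>\<gamma>\<in>carrier G. valuation_ball r v x \<gamma> \<subseteq> U)"

lemma openin_valuation_topology:
  assumes "krull_valuation G r v"
  shows "openin (valuation_topology G r v) U \<longleftrightarrow>
    (\<forall>x\<in>U. \<exists>\<gamma>\<in>carrier G. valuation_ball r v x \<gamma> \<subseteq> U)"
proof -
  have lin: "linear_order_on (carrier G) r"
    using assms by (simp add: krull_valuation_def ordered_abelian_group_def)
  have mono: "valuation_ball r v x b \<subseteq> valuation_ball r v x a" if "(a, b) \<in> r" for x a b
  proof -
    have tr: "trans r" and as: "antisym r"
      using lin unfolding linear_order_on_def partial_order_on_def preorder_on_def by blast+
    have "(a, c) \<in> r \<and> c \<noteq> a" if "(b, c) \<in> r" "c \<noteq> b" for c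
      using transD[OF tr \<open>(a, b) \<in> r\<close> that(1)] antisymD[OF as \<open>(a, b) \<in> r\<close>] that by metis
    then show ?thesis unfolding valuation_ball_def by blast
  qed
  have inter: "\<exists>c\<in>carrier G. valuation_ball r v x c \<subseteq> valuation_ball r v x a \<inter> valuation_ball r v x b"
    if "a \<in> carrier G" "b \<in> carrier G" for x a b
    using lin that mono[of a b x] mono[of b a x]
    unfolding linear_order_on_def total_on_def by (metis Int_greatest order_refl)
  have "istopology (\<lambda>U. \<forall>x\<in>U. \<exists>\<gamma>\<in>carrier G. valuation_ball r v x \<gamma> \<subseteq> U)"
    unfolding istopology_def
  proof (intro conjI allI impI ballI)
    fix S T x
    assume "\<forall>x\<in>S. \<exists>\<gamma>\<in>carrier G. valuation_ball r v x \<gamma> \<subseteq> S"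
      "\<forall>x\<in>T. \<exists>\<gamma>\<in>carrier G. valuation_ball r v x \<gamma> \<subseteq> T" "x \<in> S \<inter> T"
    then obtain a b where "a \<in> carrier G" "b \<in> carrier G"
      "valuation_ball r v x a \<subseteq> S" "valuation_ball r v x b \<subseteq> T"
      by (metis IntD1 IntD2)
    then show "\<exists>\<gamma>\<in>carrier G. valuation_ball r v x \<gamma> \<subseteq> S \<inter> T"
      using inter[of a b x] by blast
  next
    fix \<K> :: "'c set set" and x
    assume *: "\<forall>U\<in>\<K>. \<forall>x\<in>U. \<exists>\<gamma>\<in>carrier G. valuation_ball r v x \<gamma> \<subseteq> U" and "x \<in> \<Union>\<K>"
    then obtain U where "U \<in> \<K>" "x \<in> U" by blast
    with * obtain a where "a \<in> carrier G" "valuation_ball r v x a \<subseteq> U" by blast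
    with \<open>U \<in> \<K>\<close> show "\<exists>\<gamma>\<in>carrier G. valuation_ball r v x \<gamma> \<subseteq> \<Union>\<K>" by blast
  qed
  then show ?thesis by (simp add: valuation_topology_def)
qed

text \<open>
  HOL cannot quantify existentially over the type of the value group. Taking its elements from
  the type \<open>'k\<close> of the field loses nothing, as a value group can be carried by a set of
  representatives for the values: see \<open>krull_valuation_transfer\<close> below.
\<close>

definition V_topology :: "'k::field topology \<Rightarrow> bool" where
  "V_topology \<tau> \<longleftrightarrow>
     field_topology \<tau> \<and>
     ((\<exists>(G :: 'k monoid) r v. krull_valuation G r v \<and> (\<exists>x. x \<noteq> 0 \<and> v x \<noteq> \<one>\<^bsub>G\<^esub>) \<and>
         \<tau> = valuation_topology G r v) \<or>
      (\<exists>f. absolute_value f \<and> (\<exists>x. x \<noteq> 0 \<and> f x \<noteq> 1) \<and> \<tau> = absolute_value_topology f))"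

lemma krull_valuation_transfer:
  fixes G :: "'g monoid" and v :: "'k::field \<Rightarrow> 'g"
  assumes val: "krull_valuation G r v"
  shows "\<exists>(H :: 'k monoid) s w. krull_valuation H s w \<and>
    (\<forall>x. x \<noteq> 0 \<longrightarrow> (w x = \<one>\<^bsub>H\<^esub> \<longleftrightarrow> v x = \<one>\<^bsub>G\<^esub>)) \<and>
    valuation_topology H s w = valuation_topology G r v"
proof -
  have G: "comm_group G" and lin: "linear_order_on (carrier G) r"
    and mono: "\<And>a b c. (a, b) \<in> r \<Longrightarrow> c \<in> carrier G \<Longrightarrow> (a \<otimes>\<^bsub>G\<^esub> c, b \<otimes>\<^bsub>G\<^esub> c) \<in> r"
    and im: "v ` (- {0}) = carrier G"
    and mult: "\<And>x y. x \<noteq> 0 \<Longrightarrow> y \<noteq> 0 \<Longrightarrow> v (x * y) = v x \<otimes>\<^bsub>G\<^esub> v y"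
    and ultra: "\<And>x y. x \<noteq> 0 \<Longrightarrow> y \<noteq> 0 \<Longrightarrow> x + y \<noteq> 0 \<Longrightarrow>
      (v x, v (x + y)) \<in> r \<or> (v y, v (x + y)) \<in> r"
    using val unfolding krull_valuation_def ordered_abelian_group_def by blast+
  interpret comm_group G by (rule G)
  have rsub: "r \<subseteq> carrier G \<times> carrier G" and refl: "refl_on (carrier G) r"
    and trans: "trans r" and antisym: "antisym r" and total: "total_on (carrier G) r"
    using lin unfolding linear_order_on_def partial_order_on_def preorder_on_def by blast+
  have rrefl: "(a, a) \<in> r" if "a \<in> carrier G" for a
    using refl that by (rule refl_onD)
  have rtotal: "(a, b) \<in> r \<or> (b, a) \<in> r" if "a \<in> carrier G" "b \<in> carrier G" for a b
    using total rrefl that unfolding total_on_def by metis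
  note rtrans = transD[OF trans] and rantisym = antisymD[OF antisym]
  define h where "h g = (SOME x. x \<noteq> 0 \<and> v x = g)" for g
  have h: "v (h g) = g" if "g \<in> carrier G" for g
  proof -
    have "g \<in> v ` (- {0})" using that im by simp
    then have "\<exists>x. x \<noteq> 0 \<and> v x = g" by auto
    then show ?thesis unfolding h_def by (rule someI2_ex) auto
  qed
  have h_eq: "h a = h b \<longleftrightarrow> a = b" if "a \<in> carrier G" "b \<in> carrier G" for a b
    using h that by metis
  have vc: "v x \<in> carrier G" if "x \<noteq> 0" for x using im that by auto
  define H :: "'k monoid" where
    "H = \<lparr>carrier = h ` carrier G, monoid.mult = (\<lambda>x y. h (v x \<otimes>\<^bsub>G\<^esub> v y)), one = h \<one>\<^bsub>G\<^esub>\<rparr>"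
  define s where "s = {(h a, h b) | a b. (a, b) \<in> r}"
  define w where "w x = h (v x)" for x
  have s_iff: "(h a, h b) \<in> s \<longleftrightarrow> (a, b) \<in> r" if "a \<in> carrier G" "b \<in> carrier G" for a b
    using that h_eq rsub unfolding s_def by (auto 0 4)
  have H: "comm_group H"
  proof (rule comm_groupI)
    fix x assume "x \<in> carrier H"
    then obtain a where a: "a \<in> carrier G" "x = h a" by (auto simp: H_def)
    then show "\<exists>y\<in>carrier H. y \<otimes>\<^bsub>H\<^esub> x = \<one>\<^bsub>H\<^esub>"
      by (intro bexI[of _ "h (inv\<^bsub>G\<^esub> a)"]) (auto simp: H_def h)
  qed (auto simp: H_def h m_ac)
  have lH: "linear_order_on (carrier H) s"
    unfolding linear_order_on_def partial_order_on_def preorder_on_def refl_on_def total_on_def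
  proof (intro conjI)
    show "s \<subseteq> carrier H \<times> carrier H" using rsub by (auto simp: s_def H_def)
    show "\<forall>x\<in>carrier H. (x, x) \<in> s" by (auto simp: H_def s_iff rrefl)
    show "trans s"
    proof (rule transI)
      fix x y z assume "(x, y) \<in> s" "(y, z) \<in> s"
      then obtain a b b' c where "x = h a" "y = h b" "y = h b'" "z = h c" "(a, b) \<in> r" "(b', c) \<in> r"
        by (auto simp: s_def)
      moreover from this have "b = b'" using h_eq[of b b'] rsub by auto
      ultimately show "(x, z) \<in> s" using rtrans unfolding s_def by blast
    qed
    show "antisym s"
    proof (rule antisymI)
      fix x y assume xy: "(x, y) \<in> s" "(y, x) \<in> s"
      then obtain a b where ab: "x = h a" "y = h b" "(a, b) \<in> r"
        by (auto simp: s_def)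
      then have "a \<in> carrier G" "b \<in> carrier G" using rsub by auto
      then show "x = y" using xy ab s_iff rantisym by auto
    qed
    show "\<forall>x\<in>carrier H. \<forall>y\<in>carrier H. x \<noteq> y \<longrightarrow> (x, y) \<in> s \<or> (y, x) \<in> s"
      using rtotal by (auto simp: H_def s_iff)
  qed
  have mH: "(x \<otimes>\<^bsub>H\<^esub> z, y \<otimes>\<^bsub>H\<^esub> z) \<in> s" if "(x, y) \<in> s" "z \<in> carrier H" for x y z
  proof -
    obtain a b c where "x = h a" "y = h b" "(a, b) \<in> r" "z = h c" "c \<in> carrier G"
      using \<open>(x, y) \<in> s\<close> \<open>z \<in> carrier H\<close> by (auto simp: s_def H_def)
    moreover from this have "a \<in> carrier G" "b \<in> carrier G" using rsub by auto
    ultimately show ?thesis using mono by (simp add: H_def h s_iff)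
  qed
  have "w ` (- {0}) = carrier H"
    using im by (simp add: w_def H_def image_image[of h v, symmetric])
  then have kH: "krull_valuation H s w"
    unfolding krull_valuation_def ordered_abelian_group_def
    using H lH mH ultra by (auto simp: w_def s_iff vc H_def h mult)
  have "valuation_ball s w x (h \<gamma>) = valuation_ball r v x \<gamma>" if "\<gamma> \<in> carrier G" for x \<gamma>
    using that by (auto simp: valuation_ball_def w_def s_iff vc h_eq)
  then have "valuation_topology H s w = valuation_topology G r v"
    unfolding topology_eq openin_valuation_topology[OF kH] openin_valuation_topology[OF val]
    by (simp add: H_def)
  moreover have "\<forall>x. x \<noteq> 0 \<longrightarrow> (w x = \<one>\<^bsub>H\<^esub> \<longleftrightarrow> v x = \<one>\<^bsub>G\<^esub>)"
    by (auto simp: w_def H_def h_eq vc)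
  ultimately show ?thesis using kH by blast
qed


section \<open>t-henselianity and definable topologies\<close>

definition t_henselian_topology :: "'k::field topology \<Rightarrow> bool" where
  "t_henselian_topology \<tau> \<longleftrightarrow>
     V_topology \<tau> \<and>
     (\<forall>n\<ge>1. \<exists>U. openin \<tau> U \<and> 0 \<in> U \<and>
        (\<forall>a :: nat \<Rightarrow> 'k. (\<forall>i<n. a i \<in> U) \<longrightarrow>
           (\<exists>x. poly (monom 1 (n + 1) + monom 1 n + (\<Sum>i<n. monom (a i) i)) x = 0)))"

definition t_henselian_field :: "'k::field itself \<Rightarrow> bool" where
  "t_henselian_field (_ :: 'k itself) \<longleftrightarrow> (\<exists>\<tau> :: 'k topology. t_henselian_topology \<tau>)"

definition neighbourhood_basis :: "'a topology \<Rightarrow> 'a \<Rightarrow> 'a set set \<Rightarrow> bool" where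
  "neighbourhood_basis \<tau> x \<B> \<longleftrightarrow>
     (\<forall>N\<in>\<B>. \<exists>U. openin \<tau> U \<and> x \<in> U \<and> U \<subseteq> N) \<and>
     (\<forall>U. openin \<tau> U \<and> x \<in> U \<longrightarrow> (\<exists>N\<in>\<B>. N \<subseteq> U))"

text \<open>Variable 0 is the object variable \<open>x\<close>, variables \<open>1, \<dots>, q\<close> form the parameter tuple \<open>y\<close>.\<close>

definition definable_topology ::
    "('f, 'r) language \<Rightarrow> ('f, 'r, 'k::field) struc \<Rightarrow> 'k topology \<Rightarrow> bool" where
  "definable_topology L K \<tau> \<longleftrightarrow>
     (\<exists>\<phi> q B. wf_fm L \<phi> \<and> fv \<phi> \<subseteq> {..<1 + q} \<and> (\<forall>b\<in>B. length b = q) \<and>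
        neighbourhood_basis \<tau> 0 ((\<lambda>b. {x. sat_tuple K \<phi> (x # b)}) ` B))"

end

theory Submission
  imports Defs
begin

text \<open>
  Suppose that \<open>\<tau>\<^sub>0\<close> and \<open>\<tau>\<close> are distinct definable V-topologies and that \<open>\<tau>\<^sub>0\<close> is t-henselian. For
  \<open>w\<close> close to \<open>0\<close> the equation \<open>x\<^sup>2 + x = w\<close> then has one root in \<open>K\<close> that is \<open>\<tau>\<^sub>0\<close>-close to \<open>0\<close> and
  one that is \<open>\<tau>\<^sub>0\<close>-close to \<open>-1\<close>, in every characteristic. The formula saying that the
  \<open>\<tau>\<^sub>0\<close>-small root of \<open>x\<^sup>2 + x = 1 / (u - a)\<close> is also \<open>\<tau>\<close>-small has the independence property: for
  suitable \<open>a\<^sub>0, \<dots>, a\<^sub>n\<^sub>-\<^sub>1\<close>, every pattern of roots at \<open>\<tau>\<close> is realised by some \<open>u\<close>.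

  The roots for \<open>a\<^sub>0, \<dots>, a\<^sub>n\<^sub>-\<^sub>1\<close> define a curve with \<open>2\<^sup>n\<close> points over \<open>u = \<infinity>\<close>, one for each
  pattern. By linear algebra there is a nonzero function \<open>f\<close> on it that is regular at all finite
  points and vanishes at all points at infinity but a prescribed one. At a suitable point
  either \<open>f\<close> or \<open>u f\<close> has a nonzero derivative; call it \<open>g\<close>. Hensel's lemma for \<open>\<tau>\<^sub>0\<close> solves \<open>g = T\<close>
  for all \<open>T\<close> in some \<open>\<tau>\<^sub>0\<close>-open set. Choosing \<open>T\<close> also \<open>\<tau>\<close>-large forces the solution to be \<open>\<tau>\<close>-close
  to the prescribed point, because \<open>g\<close> is bounded elsewhere.

  If \<open>K\<close> is separably closed, every V-topology is t-henselian. Otherwise there is a separable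
  polynomial \<open>f\<close> without a root, and the sets of all \<open>c (1 / f(y) - 1 / f(y'))\<close> with \<open>c \<noteq> 0\<close> form a
  base of neighbourhoods of \<open>0\<close> of the t-henselian topology, which is therefore definable.
\<close>

section \<open>Balls of V-topologies\<close>

text \<open>The obstacle is that only one of the two topologies is henselian: lifting produces
  points of the curve whose position is known for it, but says nothing about their position for the
  other one. The only link between the two is approximation in the field itself: no neighbourhood of
  0 for one is bounded for the other, so a single element \<open>T\<close> can be close to a
  prescribed value for the first and as large as desired for the second. A function with just one
  pole turns such a condition on \<open>T\<close> into a condition on a point. For Hensel's lemma
  the norm of \<open>g - T\<close> must have a simple root that belongs to the right conjugate, so
  \<open>g\<close> has to separate the conjugates of the base point; this rests on irreducibility of
  the curve. No function field, algebraic closure or completion is formed: functions on the curve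
  are honest functions, tested only at rational points, and local parameters are replaced by
  expansions with error terms along filters. Exceptional \<open>u\<close> are avoided because
  infinitely many \<open>u\<close> carry rational points while each nonzero function vanishes over
  only finitely many.\<close>

text \<open>
  If \<open>B\<close> is the unit ball of a valuation or an absolute value, \<open>vle B x y\<close> means \<open>\<bar>x\<bar> \<le> \<bar>y\<bar>\<close>. Apart from
  the weak triangle inequality with the factor \<open>e\<close> below, both cases behave in the same way.
\<close>

definition vle :: "'k::field set \<Rightarrow> 'k \<Rightarrow> 'k \<Rightarrow> bool" where
  "vle B x y \<longleftrightarrow> (\<exists>z\<in>B. x = y * z)"

definition vbig_o :: "'k::field set \<Rightarrow> 'i filter \<Rightarrow> ('i \<Rightarrow> 'k) \<Rightarrow> ('i \<Rightarrow> 'k) \<Rightarrow> bool" where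
  "vbig_o B F f g \<longleftrightarrow> (\<exists>c. \<forall>\<^sub>F i in F. vle B (f i) (c * g i))"

definition vbdd :: "'k::field set \<Rightarrow> 'i filter \<Rightarrow> ('i \<Rightarrow> 'k) \<Rightarrow> bool" where
  "vbdd B F f \<longleftrightarrow> (\<exists>c. \<forall>\<^sub>F i in F. vle B (f i) c)"

definition vnull :: "'k::field set \<Rightarrow> 'i filter \<Rightarrow> ('i \<Rightarrow> 'k) \<Rightarrow> bool" where
  "vnull B F f \<longleftrightarrow> (\<forall>c. c \<noteq> 0 \<longrightarrow> (\<forall>\<^sub>F i in F. vle B (f i) c))"

definition vlarge :: "'k::field set \<Rightarrow> 'i filter \<Rightarrow> ('i \<Rightarrow> 'k) \<Rightarrow> bool" where
  "vlarge B F f \<longleftrightarrow> (\<forall>c. \<forall>\<^sub>F i in F. \<not> vle B (f i) c)"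

text \<open>For a valuation ring \<open>e = 1\<close>; for an absolute value \<open>e\<close> is an
  element of absolute value above 2. Keeping \<open>e\<close> in the field allows every estimate to
  be written with \<open>vle\<close> alone, without a value group or real numbers.\<close>

locale V_ball =
  fixes B :: "'k::field set" and e :: 'k
  assumes one_mem: "1 \<in> B"
    and mult_mem: "x \<in> B \<Longrightarrow> y \<in> B \<Longrightarrow> x * y \<in> B"
    and uminus_mem: "x \<in> B \<Longrightarrow> - x \<in> B"
    and inverse_mem: "x \<notin> B \<Longrightarrow> inverse x \<in> B"
    and e_nz: "e \<noteq> 0"
    and add_mem: "x \<in> B \<Longrightarrow> y \<in> B \<Longrightarrow> (x + y) / e \<in> B"
    and nontrivial: "\<exists>x. x \<notin> B"
begin

abbreviation le (infix \<open>\<preceq>\<close> 50) where "x \<preceq> y \<equiv> vle B x y"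
abbreviation "big_o \<equiv> vbig_o B"
abbreviation "bdd \<equiv> vbdd B"
abbreviation "null \<equiv> vnull B"
abbreviation "large \<equiv> vlarge B"

lemma zero_mem: "0 \<in> B"
  using inverse_mem[of 0] by auto

lemma le_refl [simp]: "x \<preceq> x"
  unfolding vle_def using one_mem by force

lemma zero_le [simp]: "0 \<preceq> x"
  unfolding vle_def using zero_mem by force

lemma le_zero_iff [simp]: "x \<preceq> 0 \<longleftrightarrow> x = 0"
  by (auto simp: vle_def intro: zero_mem)

lemma le_trans: "x \<preceq> y \<Longrightarrow> y \<preceq> z \<Longrightarrow> x \<preceq> z"
  unfolding vle_def by (metis mult.assoc mult_mem)

lemma le_total: "x \<preceq> y \<or> y \<preceq> x"
proof (cases "x = 0 \<or> y = 0")
  case False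
  then show ?thesis
    using inverse_mem[of "x / y"] unfolding vle_def by (force simp: field_simps)
qed auto

lemma le_mult: "a \<preceq> b \<Longrightarrow> c \<preceq> d \<Longrightarrow> a * c \<preceq> b * d"
  unfolding vle_def using mult_mem by (force simp: ac_simps)

lemma le_mult_left: "a \<preceq> b \<Longrightarrow> c * a \<preceq> c * b"
  by (rule le_mult) auto

lemma le_mult_cancel: "c \<noteq> 0 \<Longrightarrow> c * a \<preceq> c * b \<longleftrightarrow> a \<preceq> b"
  by (auto simp: vle_def)

lemma le_divide_iff: "c \<noteq> 0 \<Longrightarrow> a \<preceq> b / c \<longleftrightarrow> c * a \<preceq> b"
  using le_mult_cancel[of c a "b / c"] by simp

lemma divide_le_iff: "c \<noteq> 0 \<Longrightarrow> a / c \<preceq> b \<longleftrightarrow> a \<preceq> c * b"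
  using le_mult_cancel[of c "a / c" b] by simp

lemma le_uminus_iff [simp]: "- x \<preceq> y \<longleftrightarrow> x \<preceq> y"
  unfolding vle_def using uminus_mem by (metis minus_minus mult_minus_right)



lemma le_uminus_right_iff [simp]: "x \<preceq> - y \<longleftrightarrow> x \<preceq> y"
  unfolding vle_def using uminus_mem by (metis minus_minus mult_minus_left mult_minus_right)

lemma le_power: "x \<preceq> y \<Longrightarrow> x ^ n \<preceq> y ^ n"
  by (induction n) (auto intro: le_mult)

text \<open>Otherwise \<open>y = x * z\<close> with \<open>z\<close> in the ball; cancelling powers
  of \<open>x\<close> exhibits the inverse of \<open>z\<close> as an element of the ball, which
  gives \<open>x \<preceq> y\<close> after all.\<close>

lemma le_power_cancel:
  assumes "x ^ Suc n \<preceq> y ^ Suc n" shows "x \<preceq> y"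
proof (cases "x = 0 \<or> x \<preceq> y")
  case False
  with le_total obtain z where z: "z \<in> B" "y = x * z" unfolding vle_def by blast
  from assms obtain w where w: "w \<in> B" "x ^ Suc n = y ^ Suc n * w" unfolding vle_def by blast
  have "z ^ n \<in> B" by (induction n) (auto intro: one_mem mult_mem z)
  have "x ^ Suc n * 1 = x ^ Suc n * (z * (z ^ n * w))"
    using w(2) unfolding z(2) power_mult_distrib by (simp add: ac_simps)
  then have "z * (z ^ n * w) = 1" using False by (metis mult_left_cancel power_not_zero)
  then have "x = y * (z ^ n * w)" using z(2) by (simp add: mult.assoc)
  then show ?thesis unfolding vle_def using mult_mem[OF \<open>z ^ n \<in> B\<close> w(1)] by blast
qed auto

lemma le_add: "x \<preceq> c \<Longrightarrow> y \<preceq> c \<Longrightarrow> x + y \<preceq> e * c"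
  unfolding vle_def
proof (elim bexE)
  fix z w assume "z \<in> B" "x = c * z" "w \<in> B" "y = c * w"
  then show "\<exists>z\<in>B. x + y = e * c * z"
    using add_mem[of z w] e_nz by (intro bexI[of _ "(z + w) / e"]) (auto simp: field_simps)
qed

lemma le_inverse: "x \<noteq> 0 \<Longrightarrow> x \<preceq> y \<Longrightarrow> inverse y \<preceq> inverse x"
  unfolding vle_def by (elim bexE, rule bexI) (auto simp: field_simps)

text \<open>Source of all "sufficiently small" constants: a scale \<open>\<eta>\<close> so fine that
  even after the loss of a factor \<open>c'\<close> it stays strictly below
  \<open>c\<close>.\<close>

lemma not_le_one_mult:
  obtains \<eta> where "\<eta> \<noteq> 0" "\<not> c \<preceq> c' * \<eta> \<or> c = 0"
proof (cases "c = 0 \<or> c' = 0")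
  case False
  obtain p where p: "p \<notin> B" using nontrivial by blast
  then have "p \<noteq> 0" using zero_mem by auto
  have "\<not> c \<preceq> c' * (c / (c' * p))"
  proof
    assume "c \<preceq> c' * (c / (c' * p))"
    then obtain z where "z \<in> B" "c = c / p * z" using False unfolding vle_def by auto
    then have "z = p" using False \<open>p \<noteq> 0\<close> by (simp add: field_simps)
    then show False using p \<open>z \<in> B\<close> by simp
  qed
  then show ?thesis using that[of "c / (c' * p)"] False \<open>p \<noteq> 0\<close> by auto
next
  case True
  then show ?thesis using that[of 1] by (cases "c = 0") simp_all
qed

lemma ex_not_le: "\<exists>x. \<not> x \<preceq> c"
proof (cases "c = 0")
  case False
  obtain p where p: "p \<notin> B" using nontrivial by blast
  then have "\<not> c * p \<preceq> c" using False by (auto simp: vle_def)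
  then show ?thesis by blast
qed (auto intro: exI[of _ 1])

lemma ex_upper: "\<exists>d. d \<noteq> 0 \<and> c \<preceq> d \<and> c' \<preceq> d"
  using le_total[of c c'] le_trans zero_le by (metis le_refl le_zero_iff zero_neq_one)

lemma ex_lower: "c \<noteq> 0 \<Longrightarrow> c' \<noteq> 0 \<Longrightarrow> \<exists>d. d \<noteq> 0 \<and> d \<preceq> c \<and> d \<preceq> c'"
  using le_total[of c c'] by auto

section \<open>Growth along a filter: bounded, null and large functions\<close>

lemma bdd_iff_big_o: "bdd F f \<longleftrightarrow> big_o F f (\<lambda>_. 1)"
  by (simp add: vbdd_def vbig_o_def)

lemma big_o_add:
  assumes "big_o F f h" "big_o F g h" shows "big_o F (\<lambda>i. f i + g i) h"
proof -
  obtain c c' where c: "\<forall>\<^sub>F i in F. f i \<preceq> c * h i" "\<forall>\<^sub>F i in F. g i \<preceq> c' * h i"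
    using assms unfolding vbig_o_def by blast
  obtain d where d: "c \<preceq> d" "c' \<preceq> d" using ex_upper by blast
  from c have "\<forall>\<^sub>F i in F. f i + g i \<preceq> (e * d) * h i"
  proof eventually_elim
    case (elim i)
    have "f i \<preceq> d * h i" "g i \<preceq> d * h i"
      using elim d le_trans[OF _ le_mult[OF _ le_refl]] by blast+
    then show ?case using le_add by (simp add: mult.assoc)
  qed
  then show ?thesis unfolding vbig_o_def by blast
qed

lemma big_o_uminus: "big_o F f h \<Longrightarrow> big_o F (\<lambda>i. - f i) h"
  by (simp add: vbig_o_def)

lemma big_o_diff: "big_o F f h \<Longrightarrow> big_o F g h \<Longrightarrow> big_o F (\<lambda>i. f i - g i) h"
  unfolding diff_conv_add_uminus by (intro big_o_add big_o_uminus)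

lemma big_o_mult:
  assumes "big_o F f h" "big_o F g k" shows "big_o F (\<lambda>i. f i * g i) (\<lambda>i. h i * k i)"
proof -
  obtain c c' where c: "\<forall>\<^sub>F i in F. f i \<preceq> c * h i" "\<forall>\<^sub>F i in F. g i \<preceq> c' * k i"
    using assms unfolding vbig_o_def by blast
  then have "\<forall>\<^sub>F i in F. f i * g i \<preceq> (c * c') * (h i * k i)"
  proof eventually_elim
    case (elim i) then show ?case using le_mult by (metis mult.assoc mult.left_commute)
  qed
  then show ?thesis unfolding vbig_o_def by blast
qed

lemma big_o_refl: "big_o F f f"
  unfolding vbig_o_def by (intro exI[of _ 1]) simp

lemma big_o_zero: "big_o F (\<lambda>_. 0) f"
  unfolding vbig_o_def by simp

lemma big_o_mult_bdd: "bdd F f \<Longrightarrow> big_o F g h \<Longrightarrow> big_o F (\<lambda>i. f i * g i) h"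
  unfolding bdd_iff_big_o by (drule (1) big_o_mult) simp

lemma big_o_cong: "\<forall>\<^sub>F i in F. f i = f' i \<Longrightarrow> big_o F f h \<Longrightarrow> big_o F f' h"
  unfolding vbig_o_def by (elim exE, rule exI) (rule eventually_elim2, assumption+, simp)

lemma big_o_const: "big_o F (\<lambda>_. c) (\<lambda>_. 1)"
  unfolding vbig_o_def by (intro exI[of _ c]) simp

lemma bdd_const [simp]: "bdd F (\<lambda>_. c)"
  by (simp add: bdd_iff_big_o big_o_const)

lemma bdd_add: "bdd F f \<Longrightarrow> bdd F g \<Longrightarrow> bdd F (\<lambda>i. f i + g i)"
  by (simp add: bdd_iff_big_o big_o_add)



lemma bdd_diff: "bdd F f \<Longrightarrow> bdd F g \<Longrightarrow> bdd F (\<lambda>i. f i - g i)"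
  by (simp add: bdd_iff_big_o big_o_diff)

lemma bdd_mult: "bdd F f \<Longrightarrow> bdd F g \<Longrightarrow> bdd F (\<lambda>i. f i * g i)"
  using big_o_mult_bdd by (simp add: bdd_iff_big_o)

lemma bdd_power: "bdd F f \<Longrightarrow> bdd F (\<lambda>i. f i ^ n)"
  by (induction n) (auto intro: bdd_mult)



lemma bdd_poly: "bdd F f \<Longrightarrow> bdd F (\<lambda>i. poly p (f i))"
  by (induction p) (auto intro: bdd_add bdd_mult)

lemma bdd_cong: "\<forall>\<^sub>F i in F. f i = f' i \<Longrightarrow> bdd F f \<Longrightarrow> bdd F f'"
  unfolding vbdd_def by (elim exE, rule exI) (rule eventually_elim2, assumption+, simp)

lemma bdd_mono: "F' \<le> F \<Longrightarrow> bdd F f \<Longrightarrow> bdd F' f"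
  unfolding vbdd_def using filter_leD by blast

lemma null_mono: "F' \<le> F \<Longrightarrow> null F f \<Longrightarrow> null F' f"
  unfolding vnull_def using filter_leD by blast

lemma large_mono: "F' \<le> F \<Longrightarrow> large F f \<Longrightarrow> large F' f"
  unfolding vlarge_def using filter_leD by blast

lemma null_cong: "\<forall>\<^sub>F i in F. f i = f' i \<Longrightarrow> null F f \<Longrightarrow> null F f'"
  unfolding vnull_def
proof (intro allI impI)
  fix c :: 'k
  assume "\<forall>\<^sub>F i in F. f i = f' i" "\<forall>c. c \<noteq> 0 \<longrightarrow> (\<forall>\<^sub>F i in F. f i \<preceq> c)" "c \<noteq> 0"
  then have "\<forall>\<^sub>F i in F. f i = f' i" "\<forall>\<^sub>F i in F. f i \<preceq> c" by blast+
  then show "\<forall>\<^sub>F i in F. f' i \<preceq> c" by eventually_elim auto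
qed

lemma null_imp_bdd: "null F f \<Longrightarrow> bdd F f"
  unfolding vbdd_def vnull_def by (metis zero_neq_one)

lemma null_zero [simp]: "null F (\<lambda>_. 0)"
  by (simp add: vnull_def)

lemma null_uminus: "null F f \<Longrightarrow> null F (\<lambda>i. - f i)"
  by (simp add: vnull_def)

lemma null_add:
  assumes "null F f" "null F g" shows "null F (\<lambda>i. f i + g i)"
  unfolding vnull_def
proof (intro allI impI)
  fix c :: 'k assume "c \<noteq> 0"
  then have "\<forall>\<^sub>F i in F. f i \<preceq> c / e" "\<forall>\<^sub>F i in F. g i \<preceq> c / e"
    using assms e_nz unfolding vnull_def by auto
  then show "\<forall>\<^sub>F i in F. f i + g i \<preceq> c"
    by eventually_elim (use le_add[of _ "c / e"] e_nz in force)
qed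

lemma null_diff: "null F f \<Longrightarrow> null F g \<Longrightarrow> null F (\<lambda>i. f i - g i)"
  unfolding diff_conv_add_uminus by (intro null_add null_uminus)

lemma null_big_o:
  assumes "null F f" "big_o F g f" shows "null F g"
  unfolding vnull_def
proof (intro allI impI)
  fix c :: 'k assume "c \<noteq> 0"
  obtain d where d: "\<forall>\<^sub>F i in F. g i \<preceq> d * f i" using assms(2) unfolding vbig_o_def by blast
  have "\<forall>\<^sub>F i in F. f i \<preceq> (if d = 0 then 1 else c / d)"
    using assms(1) \<open>c \<noteq> 0\<close> unfolding vnull_def by auto
  with d show "\<forall>\<^sub>F i in F. g i \<preceq> c"
  proof eventually_elim
    case (elim i)
    then show ?case using le_trans[of "g i" "d * f i" c] by (cases "d = 0") (auto simp: le_divide_iff)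
  qed
qed

lemma null_mult_bdd: "null F f \<Longrightarrow> bdd F g \<Longrightarrow> null F (\<lambda>i. f i * g i)"
  using null_big_o[OF _ big_o_mult_bdd[OF _ big_o_refl]] by (simp add: mult.commute)

lemma null_mult_bdd': "bdd F g \<Longrightarrow> null F f \<Longrightarrow> null F (\<lambda>i. g i * f i)"
  using null_mult_bdd by (simp add: mult.commute)

lemma null_sum: "(\<And>j. j \<in> A \<Longrightarrow> null F (f j)) \<Longrightarrow> null F (\<lambda>i. \<Sum>j\<in>A. f j i)"
  by (induction A rule: infinite_finite_induct) (simp_all add: null_add)

lemma null_power_cancel:
  assumes "null F (\<lambda>i. f i ^ Suc n)" shows "null F f"
  unfolding vnull_def
proof (intro allI impI)
  fix c :: 'k assume "c \<noteq> 0"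
  then have "\<forall>\<^sub>F i in F. f i ^ Suc n \<preceq> c ^ Suc n"
    using assms unfolding vnull_def by (metis power_not_zero)
  then show "\<forall>\<^sub>F i in F. f i \<preceq> c" by eventually_elim (rule le_power_cancel)
qed

lemma null_bound: "null F g \<Longrightarrow> \<forall>\<^sub>F i in F. f i \<preceq> g i \<Longrightarrow> null F f"
  by (rule null_big_o[of F g]) (auto simp: vbig_o_def intro!: exI[of _ 1])

lemma bdd_inverse:
  assumes "null F (\<lambda>i. f i - c)" "c \<noteq> 0"
  shows "\<forall>\<^sub>F i in F. f i \<noteq> 0" "bdd F (\<lambda>i. inverse (f i))"
proof -
  \<comment> \<open>If both \<open>f i\<close> and \<open>f i - c\<close> were
    \<open>\<preceq> \<eta>\<close>, then \<open>c \<preceq> e * \<eta>\<close>; so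
    \<open>f i\<close> is bounded below by \<open>\<eta>\<close> as soon as it is that close to
    \<open>c\<close>.\<close>
  obtain \<eta> where \<eta>: "\<eta> \<noteq> 0" "\<not> c \<preceq> e * \<eta>"
    using not_le_one_mult[of c e] assms(2) by metis
  have "\<forall>\<^sub>F i in F. f i - c \<preceq> \<eta>"
    using assms \<eta>(1) unfolding vnull_def by auto
  then have ev: "\<forall>\<^sub>F i in F. \<not> f i \<preceq> \<eta>"
  proof eventually_elim
    case (elim i)
    show ?case
    proof
      assume "f i \<preceq> \<eta>"
      moreover have "- (f i - c) \<preceq> \<eta>" using elim le_uminus_iff by blast
      ultimately show False using le_add[of "f i" \<eta> "- (f i - c)"] \<eta>(2) by simp
    qed
  qed
  then show "\<forall>\<^sub>F i in F. f i \<noteq> 0" by eventually_elim auto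
  from ev have "\<forall>\<^sub>F i in F. inverse (f i) \<preceq> inverse \<eta>"
    by eventually_elim (use le_total le_inverse \<eta>(1) in blast)
  then show "bdd F (\<lambda>i. inverse (f i))" unfolding vbdd_def by blast
qed

lemma null_const_iff: "F \<noteq> bot \<Longrightarrow> null F (\<lambda>_. c) \<longleftrightarrow> c = 0"
proof (intro iffI, rule ccontr)
  assume "F \<noteq> bot" "null F (\<lambda>_. c)" "c \<noteq> 0"
  \<comment> \<open>The zero function would tend to the nonzero limit \<open>c\<close> and hence be
    eventually nonzero.\<close>
  then show False using bdd_inverse(1)[of F "\<lambda>_. 0" c] null_uminus[of F "\<lambda>_. c"] by simp
qed simp

lemma null_poly_diff:
  assumes "null F (\<lambda>i. f i - c)" shows "null F (\<lambda>i. poly p (f i) - poly p c)"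
proof -
  have b: "bdd F f" using bdd_add[OF null_imp_bdd[OF assms] bdd_const[of F c]] by simp
  show ?thesis
  proof (induction p)
    case (pCons a p)
    have "null F (\<lambda>i. (f i - c) * poly p (f i) + c * (poly p (f i) - poly p c))"
      by (intro null_add null_mult_bdd null_mult_bdd' assms pCons bdd_poly b bdd_const)
    then show ?case by (simp add: algebra_simps)
  qed simp
qed

lemma large_iff_null_inverse:
  "large F f \<longleftrightarrow> null F (\<lambda>i. inverse (f i)) \<and> (\<forall>\<^sub>F i in F. f i \<noteq> 0)"
proof (intro iffI conjI)
  assume l: "large F f"
  then have "\<forall>\<^sub>F i in F. \<not> f i \<preceq> 0" unfolding vlarge_def by blast
  then show nz: "\<forall>\<^sub>F i in F. f i \<noteq> 0" by simp
  show "null F (\<lambda>i. inverse (f i))"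
    unfolding vnull_def
  proof (intro allI impI)
    fix c :: 'k assume c: "c \<noteq> 0"
    have "\<forall>\<^sub>F i in F. \<not> f i \<preceq> inverse c" using l unfolding vlarge_def by blast
    then show "\<forall>\<^sub>F i in F. inverse (f i) \<preceq> c"
    proof eventually_elim
      case (elim i)
      then have "inverse c \<preceq> f i" using le_total by blast
      then show ?case using le_inverse[of "inverse c" "f i"] c by simp
    qed
  qed
next
  assume n: "null F (\<lambda>i. inverse (f i)) \<and> (\<forall>\<^sub>F i in F. f i \<noteq> 0)"
  show "large F f"
    unfolding vlarge_def
  proof
    fix c :: 'k
    obtain d where d: "\<not> d \<preceq> c" using ex_not_le by blast
    then have "d \<noteq> 0" by auto
    then have "\<forall>\<^sub>F i in F. inverse (f i) \<preceq> inverse d" using n unfolding vnull_def by auto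
    moreover have "\<forall>\<^sub>F i in F. f i \<noteq> 0" using n by blast
    ultimately show "\<forall>\<^sub>F i in F. \<not> f i \<preceq> c"
    proof eventually_elim
      case (elim i)
      then have "d \<preceq> f i" using le_inverse[of "inverse (f i)" "inverse d"] by simp
      then show ?case using d le_trans by blast
    qed
  qed
qed

lemma large_not_bdd: "F \<noteq> bot \<Longrightarrow> large F f \<Longrightarrow> \<not> bdd F f"
  unfolding vlarge_def vbdd_def
proof
  assume "F \<noteq> bot" "\<forall>c. \<forall>\<^sub>F i in F. \<not> f i \<preceq> c" "\<exists>c. \<forall>\<^sub>F i in F. f i \<preceq> c"
  then obtain c where c: "\<forall>\<^sub>F i in F. \<not> f i \<preceq> c" "\<forall>\<^sub>F i in F. f i \<preceq> c" by blast
  then have "\<forall>\<^sub>F i in F. False" by eventually_elim blast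
  then show False using \<open>F \<noteq> bot\<close> by simp
qed

lemma large_add_bdd:
  assumes "large F f" "bdd F g" shows "large F (\<lambda>i. f i + g i)"
  unfolding vlarge_def
proof
  fix c :: 'k
  obtain d where d: "\<forall>\<^sub>F i in F. g i \<preceq> d" using assms(2) unfolding vbdd_def by blast
  obtain m where m: "c \<preceq> m" "d \<preceq> m" using ex_upper by blast
  have "\<forall>\<^sub>F i in F. \<not> f i \<preceq> e * m" using assms(1) unfolding vlarge_def by blast
  with d show "\<forall>\<^sub>F i in F. \<not> f i + g i \<preceq> c"
  proof eventually_elim
    case (elim i)
    show ?case
    proof
      assume "f i + g i \<preceq> c"
      then have "f i + g i + (- g i) \<preceq> e * m"
        using elim m le_trans by (intro le_add) (auto simp del: add_uminus_conv_diff)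
      then show False using elim by simp
    qed
  qed
qed





text \<open>A truncated power series of \<open>h\<close> in the parameter \<open>t\<close>, with
  error of order \<open>t ^ r\<close>. It is used with \<open>t = 1 / u\<close> at infinity and with
  \<open>t = h\<close> near a finite point.\<close>

definition expands :: "'i filter \<Rightarrow> ('i \<Rightarrow> 'k) \<Rightarrow> nat \<Rightarrow> ('i \<Rightarrow> 'k) \<Rightarrow> bool" where
  "expands F t r h \<longleftrightarrow> (\<exists>S. big_o F (\<lambda>i. h i - poly S (t i)) (\<lambda>i. t i ^ r))"

lemma expands_bdd: "bdd F t \<Longrightarrow> expands F t r h \<Longrightarrow> bdd F h"
proof -
  assume t: "bdd F t" and "expands F t r h"
  then obtain S where S: "big_o F (\<lambda>i. h i - poly S (t i)) (\<lambda>i. t i ^ r)"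
    unfolding expands_def by blast
  from t have "big_o F (\<lambda>i. t i ^ r) (\<lambda>_. 1)" using bdd_power by (simp add: bdd_iff_big_o)
  then obtain c where c: "\<forall>\<^sub>F i in F. t i ^ r \<preceq> c" unfolding vbig_o_def by auto
  from S obtain d where "\<forall>\<^sub>F i in F. h i - poly S (t i) \<preceq> d * t i ^ r" unfolding vbig_o_def by auto
  with c have "\<forall>\<^sub>F i in F. h i - poly S (t i) \<preceq> d * c"
    by eventually_elim (meson le_mult_left le_trans)
  then have "bdd F (\<lambda>i. h i - poly S (t i))" unfolding vbdd_def by blast
  from bdd_add[OF this bdd_poly[OF t, of S]] show "bdd F h" by simp
qed

lemma expands_poly: "expands F t r (\<lambda>i. poly S (t i))"
  unfolding expands_def by (intro exI[of _ S]) (simp add: big_o_zero)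

lemma expands_const: "expands F t r (\<lambda>i. c)"
  using expands_poly[of F t r "[:c:]"] by simp

lemma expands_id: "expands F t r t"
  using expands_poly[of F t r "[:0, 1:]"] by simp

lemma expands_add: "expands F t r f \<Longrightarrow> expands F t r g \<Longrightarrow> expands F t r (\<lambda>i. f i + g i)"
  unfolding expands_def
proof (elim exE)
  fix S S'
  assume "big_o F (\<lambda>i. f i - poly S (t i)) (\<lambda>i. t i ^ r)" "big_o F (\<lambda>i. g i - poly S' (t i)) (\<lambda>i. t i ^ r)"
  from big_o_add[OF this] show "\<exists>S. big_o F (\<lambda>i. f i + g i - poly S (t i)) (\<lambda>i. t i ^ r)"
    by (intro exI[of _ "S + S'"]) (simp add: add_diff_add)
qed

lemma expands_mult:
  assumes t: "bdd F t" and f: "expands F t r f" and g: "expands F t r g"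
  shows "expands F t r (\<lambda>i. f i * g i)"
proof -
  obtain S S' where S: "big_o F (\<lambda>i. f i - poly S (t i)) (\<lambda>i. t i ^ r)"
      "big_o F (\<lambda>i. g i - poly S' (t i)) (\<lambda>i. t i ^ r)"
    using f g unfolding expands_def by blast
  have "big_o F (\<lambda>i. f i * (g i - poly S' (t i)) + poly S' (t i) * (f i - poly S (t i))) (\<lambda>i. t i ^ r)"
    by (intro big_o_add big_o_mult_bdd S expands_bdd[OF t f] bdd_poly t)
  then show ?thesis unfolding expands_def by (intro exI[of _ "S * S'"]) (simp add: algebra_simps)
qed

lemma expands_uminus: "expands F t r f \<Longrightarrow> expands F t r (\<lambda>i. - f i)"
  unfolding expands_def
proof (elim exE)
  fix S assume "big_o F (\<lambda>i. f i - poly S (t i)) (\<lambda>i. t i ^ r)"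
  from big_o_uminus[OF this] show "\<exists>S. big_o F (\<lambda>i. - f i - poly S (t i)) (\<lambda>i. t i ^ r)"
    by (intro exI[of _ "- S"]) (simp add: algebra_simps)
qed

lemma expands_diff: "expands F t r f \<Longrightarrow> expands F t r g \<Longrightarrow> expands F t r (\<lambda>i. f i - g i)"
  unfolding diff_conv_add_uminus by (intro expands_add expands_uminus)

lemma expands_cong: "\<forall>\<^sub>F i in F. f i = g i \<Longrightarrow> expands F t r f \<Longrightarrow> expands F t r g"
  unfolding expands_def
proof (elim exE)
  fix S assume *: "\<forall>\<^sub>F i in F. f i = g i" and S: "big_o F (\<lambda>i. f i - poly S (t i)) (\<lambda>i. t i ^ r)"
  from * have "\<forall>\<^sub>F i in F. f i - poly S (t i) = g i - poly S (t i)" by eventually_elim simp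
  from big_o_cong[OF this S] show "\<exists>S. big_o F (\<lambda>i. g i - poly S (t i)) (\<lambda>i. t i ^ r)" by blast
qed

text \<open>A factor \<open>t\<close> gains one order. An identity of the form
  \<open>f = c + t * E(f)\<close> therefore yields expansions of \<open>f\<close> to every order by
  induction on \<open>r\<close>.\<close>

lemma expands_Suc: "expands F t r f \<Longrightarrow> expands F t (Suc r) (\<lambda>i. t i * f i)"
  unfolding expands_def
proof (elim exE)
  fix S assume "big_o F (\<lambda>i. f i - poly S (t i)) (\<lambda>i. t i ^ r)"
  from big_o_mult[OF big_o_refl[of F t] this]
  show "\<exists>S. big_o F (\<lambda>i. t i * f i - poly S (t i)) (\<lambda>i. t i ^ Suc r)"
    by (intro exI[of _ "pCons 0 S"]) (simp add: right_diff_distrib)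
qed

lemma expands_big_o: "big_o F h (\<lambda>i. t i ^ r) \<Longrightarrow> expands F t r h"
  unfolding expands_def by (intro exI[of _ 0]) simp

end


section \<open>Functions on a tower of quadratic extensions\<close>

text \<open>
  The coordinate \<open>z i\<close> stands for \<open>(u - a i) x\<close> with \<open>x\<^sup>2 + x = 1 / (u - a i)\<close>; it is integral over the
  polynomials in \<open>u\<close>.
\<close>

definition on_curve :: "(nat \<Rightarrow> 'k::field) \<Rightarrow> nat \<Rightarrow> 'k \<Rightarrow> (nat \<Rightarrow> 'k) \<Rightarrow> bool" where
  "on_curve a n u z \<longleftrightarrow> (\<forall>i<n. (z i)\<^sup>2 = (u - a i) * (1 - z i))"

text \<open>Conjugation in the coordinates in \<open>S\<close>: \<open>- (u - a i) - z i\<close> is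
  the second root of the quadratic equation for \<open>z i\<close>. In terms of
  \<open>x = z i / (u - a i)\<close> it is the exchange of \<open>x\<close> and
  \<open>-1 - x\<close>.\<close>

definition flip :: "(nat \<Rightarrow> 'k::field) \<Rightarrow> nat set \<Rightarrow> 'k \<Rightarrow> (nat \<Rightarrow> 'k) \<Rightarrow> nat \<Rightarrow> 'k" where
  "flip a S u z = (\<lambda>i. if i \<in> S then - (u - a i) - z i else z i)"

text \<open>
  The functions \<open>\<Sum>I. q\<^sub>I (\<Prod>i\<in>I. z i)\<close> with \<open>I \<subseteq> {..<n}\<close> and coefficients in \<open>Q\<close>. They are closed under
  multiplication only up to equality on the curve.
\<close>

primrec ext :: "('p \<Rightarrow> 'k::field) set \<Rightarrow> nat \<Rightarrow> ('p \<Rightarrow> (nat \<Rightarrow> 'k) \<Rightarrow> 'k) set" where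
  "ext Q 0 = {(\<lambda>p z. q p) | q. q \<in> Q}"
| "ext Q (Suc n) = {(\<lambda>p z. f p z + g p z * z n) | f g. f \<in> ext Q n \<and> g \<in> ext Q n}"

text \<open>The base consists of functions on an arbitrary type \<open>'p\<close> so that it can be
  the polynomials in \<open>u\<close>, but also, after the substitution of \<open>u0 + h\<close> for
  \<open>u\<close>, the polynomials in a pair \<open>(T, h)\<close>.\<close>

definition fun_ring :: "('p \<Rightarrow> 'k::field) set \<Rightarrow> bool" where
  "fun_ring Q \<longleftrightarrow> (\<lambda>_. 0) \<in> Q \<and> (\<forall>f\<in>Q. (\<lambda>p. - f p) \<in> Q) \<and>
     (\<forall>f\<in>Q. \<forall>g\<in>Q. (\<lambda>p. f p + g p) \<in> Q \<and> (\<lambda>p. f p * g p) \<in> Q)"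

text \<open>The bound on the degree is strict, so \<open>polys 0\<close> contains only 0; this is
  where the descent on \<open>d\<close> ends.\<close>

definition polys :: "nat \<Rightarrow> ('k::field \<Rightarrow> 'k) set" where
  "polys d = {poly p | p. \<forall>i\<ge>d. coeff p i = 0}"

lemma on_curve_flip: "on_curve a n u z \<Longrightarrow> on_curve a n u (flip a S u z)"
  unfolding on_curve_def flip_def
proof (intro allI impI)
  fix i assume "\<forall>i<n. (z i)\<^sup>2 = (u - a i) * (1 - z i)" "i < n"
  then have "(z i)\<^sup>2 = (u - a i) * (1 - z i)" by blast
  then show "(if i \<in> S then - (u - a i) - z i else z i)\<^sup>2 =
      (u - a i) * (1 - (if i \<in> S then - (u - a i) - z i else z i))"
    by (auto simp: power2_eq_square algebra_simps)
qed

lemma on_curve_le: "on_curve a n u z \<Longrightarrow> m \<le> n \<Longrightarrow> on_curve a m u z"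
  by (auto simp: on_curve_def)



lemma flip_flip: "flip a S u (flip a T u z) = flip a (sym_diff S T) u z"
  by (auto simp: flip_def fun_eq_iff)

lemma flip_empty [simp]: "flip a {} u z = z"
  by (simp add: flip_def)

lemma ext_cong: "f \<in> ext Q n \<Longrightarrow> (\<And>i. i < n \<Longrightarrow> z i = z' i) \<Longrightarrow> f p z = f p z'"
proof (induction n arbitrary: f)
  case (Suc n)
  then obtain g h where "f = (\<lambda>p z. g p z + h p z * z n)" "g \<in> ext Q n" "h \<in> ext Q n" by auto
  then show ?case using Suc.IH[of g] Suc.IH[of h] Suc.prems(2) by simp
qed auto

lemma ext_cong_flip:
  "f \<in> ext Q n \<Longrightarrow> S \<inter> {..<n} = T \<inter> {..<n} \<Longrightarrow> f p (flip a S u z) = f p (flip a T u z)"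
  by (rule ext_cong) (auto simp: flip_def)

lemma ext_mono: "Q \<subseteq> Q' \<Longrightarrow> ext Q n \<subseteq> ext Q' n"
  by (induction n) auto

lemma ext_SucI:
  "f \<in> ext Q n \<Longrightarrow> g \<in> ext Q n \<Longrightarrow> h = (\<lambda>p z. f p z + g p z * z n) \<Longrightarrow> h \<in> ext Q (Suc n)"
  by auto

lemma ext_base: "(\<lambda>_. 0) \<in> Q \<Longrightarrow> q \<in> Q \<Longrightarrow> (\<lambda>p z. q p) \<in> ext Q n"
proof (induction n arbitrary: q)
  case (Suc n)
  then have "(\<lambda>p z. q p) \<in> ext Q n" "(\<lambda>p z. 0) \<in> ext Q n" by auto
  then show ?case by (rule ext_SucI) simp
qed auto

lemma ext_add:
  assumes Q: "\<And>f g. f \<in> Q \<Longrightarrow> g \<in> Q \<Longrightarrow> (\<lambda>p. f p + g p) \<in> Q"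
  shows "f \<in> ext Q n \<Longrightarrow> g \<in> ext Q n \<Longrightarrow> (\<lambda>p z. f p z + g p z) \<in> ext Q n"
proof (induction n arbitrary: f g)
  case 0
  then obtain q q' where "f = (\<lambda>p z. q p)" "g = (\<lambda>p z. q' p)" "q \<in> Q" "q' \<in> Q" by auto
  then show ?case using Q[of q q'] by auto
next
  case (Suc n)
  then obtain f0 f1 g0 g1 where
    eq: "f = (\<lambda>p z. f0 p z + f1 p z * z n)" "g = (\<lambda>p z. g0 p z + g1 p z * z n)"
    and m: "f0 \<in> ext Q n" "f1 \<in> ext Q n" "g0 \<in> ext Q n" "g1 \<in> ext Q n" by auto
  show ?case
    by (rule ext_SucI[OF Suc.IH[OF m(1,3)] Suc.IH[OF m(2,4)]]) (simp add: eq fun_eq_iff algebra_simps)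
qed

lemma ext_scale:
  assumes Q: "\<And>f. f \<in> Q \<Longrightarrow> (\<lambda>p. q p * f p) \<in> Q'"
  shows "f \<in> ext Q n \<Longrightarrow> (\<lambda>p z. q p * f p z) \<in> ext Q' n"
proof (induction n arbitrary: f)
  case 0
  then show ?case using Q by auto
next
  case (Suc n)
  then obtain f0 f1 where eq: "f = (\<lambda>p z. f0 p z + f1 p z * z n)"
    and m: "f0 \<in> ext Q n" "f1 \<in> ext Q n" by auto
  show ?case
    by (rule ext_SucI[OF Suc.IH[OF m(1)] Suc.IH[OF m(2)]]) (simp add: eq fun_eq_iff algebra_simps)
qed

section \<open>Multiplication, conjugation and norm over a base ring\<close>

context
  fixes a :: "nat \<Rightarrow> 'k::field" and Q :: "('p \<Rightarrow> 'k) set" and v :: "'p \<Rightarrow> 'k"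
  assumes ring: "fun_ring Q" and v: "\<And>i. (\<lambda>p. v p - a i) \<in> Q"
begin

lemma ring_simps: "(\<lambda>_. 0) \<in> Q" "f \<in> Q \<Longrightarrow> (\<lambda>p. - f p) \<in> Q"
    "f \<in> Q \<Longrightarrow> g \<in> Q \<Longrightarrow> (\<lambda>p. f p + g p) \<in> Q" "f \<in> Q \<Longrightarrow> g \<in> Q \<Longrightarrow> (\<lambda>p. f p * g p) \<in> Q"
  using ring unfolding fun_ring_def by blast+

lemma ext_add_ring:
  "f \<in> ext Q n \<Longrightarrow> g \<in> ext Q n \<Longrightarrow> (\<lambda>p z. f p z + g p z) \<in> ext Q n"
  using ext_add[of Q f n g] ring_simps(3) by blast

lemma ext_scale_ring: "q \<in> Q \<Longrightarrow> f \<in> ext Q n \<Longrightarrow> (\<lambda>p z. q p * f p z) \<in> ext Q n"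
  using ext_scale[of Q q Q f n] ring_simps(4) by blast

lemma ext_uminus_ring: "f \<in> ext Q n \<Longrightarrow> (\<lambda>p z. - f p z) \<in> ext Q n"
proof (induction n arbitrary: f)
  case 0
  then show ?case using ring_simps(2) by auto
next
  case (Suc n)
  then obtain f0 f1 where eq: "f = (\<lambda>p z. f0 p z + f1 p z * z n)"
    and m: "f0 \<in> ext Q n" "f1 \<in> ext Q n" by auto
  show ?case
    by (rule ext_SucI[OF Suc.IH[OF m(1)] Suc.IH[OF m(2)]]) (simp add: eq fun_eq_iff)
qed

lemma ext_mult:
  assumes "f \<in> ext Q n" "g \<in> ext Q n"
  shows "\<exists>h\<in>ext Q n. \<forall>p z. on_curve a n (v p) z \<longrightarrow> h p z = f p z * g p z"
  using assms
proof (induction n arbitrary: f g)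
  case 0
  then obtain q q' where "f = (\<lambda>p z. q p)" "g = (\<lambda>p z. q' p)" "q \<in> Q" "q' \<in> Q" by auto
  then show ?case using ring_simps(4)[of q q'] by auto
next
  case (Suc n)
  then obtain f0 f1 g0 g1 where
    eq: "f = (\<lambda>p z. f0 p z + f1 p z * z n)" "g = (\<lambda>p z. g0 p z + g1 p z * z n)"
    and m: "f0 \<in> ext Q n" "f1 \<in> ext Q n" "g0 \<in> ext Q n" "g1 \<in> ext Q n" by auto
  from Suc.IH[OF m(1,3)] Suc.IH[OF m(1,4)] Suc.IH[OF m(2,3)] Suc.IH[OF m(2,4)]
  obtain h1 h2 h3 h4 where h: "h1 \<in> ext Q n" "h2 \<in> ext Q n" "h3 \<in> ext Q n" "h4 \<in> ext Q n"
    "\<And>p z. on_curve a n (v p) z \<Longrightarrow> h1 p z = f0 p z * g0 p z"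
    "\<And>p z. on_curve a n (v p) z \<Longrightarrow> h2 p z = f0 p z * g1 p z"
    "\<And>p z. on_curve a n (v p) z \<Longrightarrow> h3 p z = f1 p z * g0 p z"
    "\<And>p z. on_curve a n (v p) z \<Longrightarrow> h4 p z = f1 p z * g1 p z"
    by metis
  let ?d = "\<lambda>p. v p - a n"
  let ?A = "\<lambda>p z. h1 p z + ?d p * h4 p z"
  let ?B = "\<lambda>p z. (h2 p z + h3 p z) + - (?d p * h4 p z)"
  have "?A \<in> ext Q n"
    by (intro ext_add_ring ext_scale_ring h v)
  moreover have "?B \<in> ext Q n"
    by (intro ext_add_ring ext_scale_ring ext_uminus_ring h v)
  ultimately have "(\<lambda>p z. ?A p z + ?B p z * z n) \<in> ext Q (Suc n)" by (rule ext_SucI) (rule refl)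
  moreover have "?A p z + ?B p z * z n = f p z * g p z" if "on_curve a (Suc n) (v p) z" for p z
  proof -
    have "on_curve a n (v p) z" "(z n)\<^sup>2 = ?d p * (1 - z n)"
      using that by (auto simp: on_curve_def)
    then have 1: "?A p z + ?B p z * z n = (f0 p z * g0 p z + ?d p * (f1 p z * g1 p z))
        + (f0 p z * g1 p z + f1 p z * g0 p z - ?d p * (f1 p z * g1 p z)) * z n"
      using h by simp
    have "f p z * g p z = f0 p z * g0 p z + (f0 p z * g1 p z + f1 p z * g0 p z) * z n
        + f1 p z * g1 p z * (z n)\<^sup>2"
      unfolding eq by (simp add: algebra_simps power2_eq_square)
    then show ?thesis
      unfolding 1 \<open>(z n)\<^sup>2 = _\<close> by (simp add: algebra_simps)
  qed
  ultimately show ?case by (intro bexI) auto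
qed

text \<open>\<open>h\<close> is the relative norm of \<open>f + g * z n\<close>: the two conjugates
  of \<open>z n\<close> have sum and product both equal to \<open>- (v p - a n)\<close>.\<close>

lemma ext_quadratic:
  assumes f: "f \<in> ext Q n" and g: "g \<in> ext Q n"
  shows "\<exists>h\<in>ext Q n. \<forall>p z. on_curve a n (v p) z \<longrightarrow>
    h p z = (f p z)\<^sup>2 - (v p - a n) * (f p z * g p z) - (v p - a n) * (g p z)\<^sup>2"
proof -
  from ext_mult[OF f f] ext_mult[OF f g] ext_mult[OF g g]
  obtain h1 h2 h3 where h: "h1 \<in> ext Q n" "h2 \<in> ext Q n" "h3 \<in> ext Q n"
    "\<And>p z. on_curve a n (v p) z \<Longrightarrow> h1 p z = f p z * f p z"
    "\<And>p z. on_curve a n (v p) z \<Longrightarrow> h2 p z = f p z * g p z"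
    "\<And>p z. on_curve a n (v p) z \<Longrightarrow> h3 p z = g p z * g p z"
    by metis
  let ?d = "\<lambda>p. v p - a n"
  have "(\<lambda>p z. (h1 p z + - (?d p * h2 p z)) + - (?d p * h3 p z)) \<in> ext Q n"
    by (intro ext_add_ring ext_scale_ring ext_uminus_ring h v)
  then show ?thesis
    by (rule bexI[rotated]) (auto simp: h power2_eq_square)
qed

text \<open>One coordinate is removed at a time. The conjugates for \<open>S\<close> and for
  \<open>insert n S\<close> differ only in \<open>z n\<close>, so their product is a conjugate of
  the relative norm, to which the induction hypothesis applies.\<close>

lemma ext_norm:
  assumes "f \<in> ext Q n"
  shows "\<exists>q\<in>Q. \<forall>p z. on_curve a n (v p) z \<longrightarrow> (\<Prod>S\<in>Pow {..<n}. f p (flip a S (v p) z)) = q p"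
  using assms
proof (induction n arbitrary: f)
  case 0
  then show ?case by auto
next
  case (Suc n)
  then obtain f0 f1 where eq: "f = (\<lambda>p z. f0 p z + f1 p z * z n)"
    and m: "f0 \<in> ext Q n" "f1 \<in> ext Q n" by auto
  obtain h where h: "h \<in> ext Q n" "\<And>p z. on_curve a n (v p) z \<Longrightarrow>
      h p z = (f0 p z)\<^sup>2 - (v p - a n) * (f0 p z * f1 p z) - (v p - a n) * (f1 p z)\<^sup>2"
    using ext_quadratic[OF m] by blast
  obtain q where q: "q \<in> Q"
      "\<And>p z. on_curve a n (v p) z \<Longrightarrow> (\<Prod>S\<in>Pow {..<n}. h p (flip a S (v p) z)) = q p"
    using Suc.IH[OF h(1)] by blast
  have "(\<Prod>S\<in>Pow {..<Suc n}. f p (flip a S (v p) z)) = q p" if z: "on_curve a (Suc n) (v p) z" for p z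
  proof -
    let ?F = "\<lambda>S. flip a S (v p) z"
    have zn: "on_curve a n (v p) z" "(z n)\<^sup>2 = (v p - a n) * (1 - z n)"
      using z by (auto simp: on_curve_def)
    have step: "f p (?F S) * f p (?F (insert n S)) = h p (?F S)" if "S \<in> Pow {..<n}" for S
    proof -
      have "f0 p (?F (insert n S)) = f0 p (?F S)" "f1 p (?F (insert n S)) = f1 p (?F S)"
        by (rule ext_cong_flip[OF m(1)], force) (rule ext_cong_flip[OF m(2)], force)
      moreover have "?F S n = z n" "?F (insert n S) n = - (v p - a n) - z n"
        using that by (auto simp: flip_def)
      ultimately have "f p (?F S) * f p (?F (insert n S)) =
          (f0 p (?F S) + f1 p (?F S) * z n) * (f0 p (?F S) + f1 p (?F S) * (- (v p - a n) - z n))"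
        unfolding eq by simp
      also have "\<dots> = (f0 p (?F S))\<^sup>2 - (v p - a n) * (f0 p (?F S) * f1 p (?F S))
          - (f1 p (?F S))\<^sup>2 * ((v p - a n) * z n + (z n)\<^sup>2)"
        by (simp add: algebra_simps power2_eq_square)
      also have "(v p - a n) * z n + (z n)\<^sup>2 = v p - a n"
        unfolding zn(2) by (simp add: algebra_simps)
      finally show ?thesis using h(2)[OF on_curve_flip[OF zn(1)]] by (simp add: mult.commute)
    qed
    have "Pow {..<Suc n} = Pow {..<n} \<union> insert n ` Pow {..<n}"
      by (simp add: lessThan_Suc Pow_insert)
    moreover have "Pow {..<n} \<inter> insert n ` Pow {..<n} = {}" by auto
    moreover have "inj_on (insert n) (Pow {..<n})"
      by (rule inj_onI) (metis Pow_iff insert_ident lessThan_iff less_irrefl subsetD)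
    ultimately have "(\<Prod>S\<in>Pow {..<Suc n}. f p (?F S))
        = (\<Prod>S\<in>Pow {..<n}. f p (?F S)) * (\<Prod>S\<in>Pow {..<n}. f p (?F (insert n S)))"
      by (simp add: prod.union_disjoint prod.reindex)
    also have "\<dots> = (\<Prod>S\<in>Pow {..<n}. h p (?F S))"
      unfolding prod.distrib[symmetric] by (rule prod.cong) (auto simp: step)
    finally show ?thesis using q(2)[OF zn(1)] by simp
  qed
  then show ?case using q(1) by blast
qed

lemma ext_flip:
  assumes "f \<in> ext Q n"
  shows "(\<lambda>p z. f p (flip a S (v p) z)) \<in> ext Q n"
  using assms
proof (induction n arbitrary: f)
  case (Suc n)
  then obtain f0 f1 where eq: "f = (\<lambda>p z. f0 p z + f1 p z * z n)"
    and m: "f0 \<in> ext Q n" "f1 \<in> ext Q n" by auto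
  let ?F = "\<lambda>p z. flip a S (v p) z"
  have 0: "(\<lambda>p z. f0 p (?F p z)) \<in> ext Q n" "(\<lambda>p z. f1 p (?F p z)) \<in> ext Q n"
    using Suc.IH m by blast+
  show ?case
  proof (cases "n \<in> S")
    case False
    then have "(\<lambda>p z. f p (?F p z)) = (\<lambda>p z. f0 p (?F p z) + f1 p (?F p z) * z n)"
      unfolding eq by (simp add: flip_def)
    then show ?thesis using 0 by auto
  next
    case True
    have 1: "(\<lambda>p z. f p (?F p z)) = (\<lambda>p z. (f0 p (?F p z) + - ((v p - a n) * f1 p (?F p z)))
        + (- f1 p (?F p z)) * z n)"
      unfolding eq fun_eq_iff using True by (simp add: flip_def algebra_simps)
    have 2: "(\<lambda>p z. f0 p (?F p z) + - ((v p - a n) * f1 p (?F p z))) \<in> ext Q n"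
      by (intro ext_add_ring ext_scale_ring ext_uminus_ring 0 v)
    have 3: "(\<lambda>p z. - f1 p (?F p z)) \<in> ext Q n"
      by (intro ext_uminus_ring 0)
    show ?thesis by (rule ext_SucI[OF 2 3 1])
  qed
qed auto

end

section \<open>Polynomial coefficients: unramified fibres and irreducibility of the curve\<close>

lemma fun_ring_polys: "fun_ring (range poly :: ('k::field \<Rightarrow> 'k) set)"
  unfolding fun_ring_def
proof (intro conjI ballI)
  show "(\<lambda>_. 0) \<in> range (poly :: 'k poly \<Rightarrow> _)" by (rule range_eqI[of _ _ 0]) auto
  fix f :: "'k \<Rightarrow> 'k" assume "f \<in> range poly"
  then obtain p where p: "f = poly p" by auto
  then show "(\<lambda>x. - f x) \<in> range poly" by (intro range_eqI[of _ _ "- p"]) auto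
  fix g :: "'k \<Rightarrow> 'k" assume "g \<in> range poly"
  then obtain q where q: "g = poly q" by auto
  show "(\<lambda>x. f x + g x) \<in> range poly" using p q by (intro range_eqI[of _ _ "p + q"]) auto
  show "(\<lambda>x. f x * g x) \<in> range poly" using p q by (intro range_eqI[of _ _ "p * q"]) auto
qed

lemma linear_polys: "(\<lambda>u. u - c) \<in> range (poly :: 'k::field poly \<Rightarrow> _)"
  by (rule range_eqI[of _ _ "[:- c, 1:]"]) auto

lemma polys_subset: "polys d \<subseteq> range poly"
  by (auto simp: polys_def)

lemma polys_mono: "d \<le> d' \<Longrightarrow> polys d \<subseteq> polys d'"
  by (auto simp: polys_def)

lemma ext_polys_bound: "f \<in> ext (range poly) n \<Longrightarrow> \<exists>d. f \<in> ext (polys d) n"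
proof (induction n arbitrary: f)
  case 0
  then obtain p where "f = (\<lambda>u z. poly p u)" by auto
  moreover have "poly p \<in> polys (Suc (degree p))"
    unfolding polys_def by (auto intro!: exI[of _ p] coeff_eq_0)
  ultimately show ?case by auto
next
  case (Suc n)
  then obtain f0 f1 where eq: "f = (\<lambda>p z. f0 p z + f1 p z * z n)"
    and m: "f0 \<in> ext (range poly) n" "f1 \<in> ext (range poly) n" by auto
  from Suc.IH[OF m(1)] Suc.IH[OF m(2)] obtain d0 d1
    where d: "f0 \<in> ext (polys d0) n" "f1 \<in> ext (polys d1) n" by blast
  have "f0 \<in> ext (polys (max d0 d1)) n" "f1 \<in> ext (polys (max d0 d1)) n"
    using d ext_mono[OF polys_mono[OF max.cobounded1], of d0 n d1]
      ext_mono[OF polys_mono[OF max.cobounded2], of d1 n d0] by blast+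
  then have "f \<in> ext (polys (max d0 d1)) (Suc n)" by (rule ext_SucI) (simp add: eq)
  then show ?case ..
qed

lemma ext_polys_0: "f \<in> ext (polys 0) n \<Longrightarrow> f u z = 0"
proof (induction n arbitrary: f)
  case 0
  then obtain p :: "'a poly" where "f = (\<lambda>u z. poly p u)" "\<forall>i. coeff p i = 0"
    by (auto simp: polys_def)
  then show ?case by (simp add: poly_eq_iff[symmetric] flip: coeff_0) (metis coeff_0 poly_0 poly_eq_iff)
next
  case (Suc n)
  then obtain f0 f1 where "f = (\<lambda>p z. f0 p z + f1 p z * z n)" "f0 \<in> ext (polys 0) n" "f1 \<in> ext (polys 0) n"
    by auto
  then show ?case using Suc.IH[of f0] Suc.IH[of f1] by simp
qed

text \<open>Over \<open>c\<close> the conjugate values of each coordinate differ by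
  \<open>2 * z0 i + (c - a i)\<close>, which is nonzero. Vanishing at all conjugates of
  \<open>z0\<close> can thus be passed on to both components \<open>f0\<close> and
  \<open>f1\<close>, and in the end to every polynomial coefficient, which is then divisible by
  \<open>u - c\<close>.\<close>

lemma ext_polys_divide:
  fixes a :: "nat \<Rightarrow> 'k::field"
  assumes z0: "on_curve a n c z0" "\<And>i. i < n \<Longrightarrow> 2 * z0 i + (c - a i) \<noteq> 0"
    and f: "f \<in> ext (polys (Suc d)) n" and zero: "\<And>S. f c (flip a S c z0) = 0"
  shows "\<exists>g\<in>ext (polys d) n. \<forall>u z. f u z = (u - c) * g u z"
  using assms
proof (induction n arbitrary: f)
  case 0
  then obtain p where p: "f = (\<lambda>u z. poly p u)" "\<forall>i\<ge>Suc d. coeff p i = 0"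
    by (auto simp: polys_def)
  with 0 have "poly p c = 0" by auto
  then obtain q where q: "p = [:- c, 1:] * q" by (auto simp: poly_eq_0_iff_dvd)
  have "coeff q i = 0" if "i \<ge> d" for i
  proof (cases "q = 0")
    case False
    then have "degree p = degree [:- c, 1:] + degree q" unfolding q by (intro degree_mult_eq) auto
    then have "degree p = Suc (degree q)" "p \<noteq> 0" using False q by (simp, metis mult_eq_0_iff one_neq_zero pCons_eq_0_iff)
    then have "degree p < Suc d"
      using p(2) by (metis leading_coeff_0_iff not_le_imp_less)
    then show ?thesis using that \<open>degree p = Suc (degree q)\<close> by (intro coeff_eq_0) auto
  qed simp
  then have "poly q \<in> polys d" by (auto simp: polys_def)
  then show ?case unfolding p by (intro bexI[of _ "\<lambda>u z. poly q u"]) (auto simp: q algebra_simps)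
next
  case (Suc n)
  from Suc.prems(3) obtain f0 f1 where eq: "f = (\<lambda>p z. f0 p z + f1 p z * z n)"
    and m: "f0 \<in> ext (polys (Suc d)) n" "f1 \<in> ext (polys (Suc d)) n" by auto
  have *: "f0 c (flip a S c z0) = 0 \<and> f1 c (flip a S c z0) = 0" for S
  proof -
    have "f0 c (flip a (S - {n}) c z0) = f0 c (flip a S c z0)"
      "f0 c (flip a (insert n S) c z0) = f0 c (flip a S c z0)"
      "f1 c (flip a (S - {n}) c z0) = f1 c (flip a S c z0)"
      "f1 c (flip a (insert n S) c z0) = f1 c (flip a S c z0)"
      using m by (auto intro!: ext_cong_flip)
    with Suc.prems(4)[of "S - {n}"] Suc.prems(4)[of "insert n S"]
    have 1: "f0 c (flip a S c z0) + f1 c (flip a S c z0) * z0 n = 0"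
      "f0 c (flip a S c z0) + f1 c (flip a S c z0) * (- (c - a n) - z0 n) = 0"
      unfolding eq by (simp_all add: flip_def)
    have "f1 c (flip a S c z0) * (2 * z0 n + (c - a n)) = (f0 c (flip a S c z0) + f1 c (flip a S c z0) * z0 n)
        - (f0 c (flip a S c z0) + f1 c (flip a S c z0) * (- (c - a n) - z0 n))"
      by (simp add: algebra_simps)
    also have "\<dots> = 0" unfolding 1 by simp
    finally have "f1 c (flip a S c z0) = 0" using Suc.prems(2)[of n] by simp
    then show ?thesis using 1 by simp
  qed
  have z0: "on_curve a n c z0" using Suc.prems(1) by (auto simp: on_curve_def)
  obtain g0 where g0: "g0 \<in> ext (polys d) n" "\<And>u z. f0 u z = (u - c) * g0 u z"
    using Suc.IH[OF z0 Suc.prems(2) m(1)] * by force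
  obtain g1 where g1: "g1 \<in> ext (polys d) n" "\<And>u z. f1 u z = (u - c) * g1 u z"
    using Suc.IH[OF z0 Suc.prems(2) m(2)] * by force
  show ?case
  proof (intro bexI allI)
    show "f u z = (u - c) * (g0 u z + g1 u z * z n)" for u z
      unfolding eq g0(2) g1(2) by (simp add: algebra_simps)
    show "(\<lambda>u z. g0 u z + g1 u z * z n) \<in> ext (polys d) (Suc n)"
      by (rule ext_SucI[OF g0(1) g1(1) refl])
  qed
qed

text \<open>
  This is irreducibility of the curve: the norm to the curve with one coordinate less reduces to
  smaller \<open>n\<close>, and as that smaller curve is unramified over \<open>u = a n\<close>, both components of \<open>f\<close> are
  divisible by \<open>u - a n\<close>, which starts an infinite descent.
\<close>

lemma ext_zero:
  fixes a :: "nat \<Rightarrow> 'k::field"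
  assumes unram: "\<And>k. k < n \<Longrightarrow> \<exists>z. on_curve a k (a k) z \<and> (\<forall>i<k. 2 * z i + (a k - a i) \<noteq> 0)"
    and f: "f \<in> ext (range poly) n"
    and inf: "infinite {u. \<exists>z. on_curve a n u z \<and> f u z = 0}"
    and z: "on_curve a n u z"
  shows "f u z = 0"
  using assms
proof (induction n arbitrary: f u z)
  case 0
  then obtain p where p: "f = (\<lambda>u z. poly p u)" by auto
  with 0 have "infinite {u. poly p u = 0}" by (auto simp: on_curve_def)
  then have "p = 0" using poly_roots_finite by blast
  then show ?case by (simp add: p)
next
  case (Suc n)
  have IH: "f u z = 0" if "f \<in> ext (range poly) n" "infinite {u. \<exists>z. on_curve a n u z \<and> f u z = 0}"
    "on_curve a n u z" for f u z
    using Suc.IH[of f u z] Suc.prems(1) that by (meson less_SucI)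
  obtain z0 where z0: "on_curve a n (a n) z0" "\<And>i. i < n \<Longrightarrow> 2 * z0 i + (a n - a i) \<noteq> 0"
    using Suc.prems(1)[of n] by auto
  note quad = ext_quadratic[where a = a and v = "\<lambda>u. u", OF fun_ring_polys linear_polys]
  obtain d where "f \<in> ext (polys d) (Suc n)" using ext_polys_bound[OF Suc.prems(2)] by blast
  then show ?case using Suc.prems(3,4)
  proof (induction d arbitrary: f)
    case 0
    then show ?case using ext_polys_0 by blast
  next
    case (Suc d)
    from Suc.prems(1) obtain f0 f1 where eq: "f = (\<lambda>p z. f0 p z + f1 p z * z n)"
      and m: "f0 \<in> ext (polys (Suc d)) n" "f1 \<in> ext (polys (Suc d)) n" by auto
    have mr: "f \<in> ext (range poly) n" if "f \<in> ext (polys d) n" for f :: "'k \<Rightarrow> (nat \<Rightarrow> 'k) \<Rightarrow> 'k" and d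
      using that ext_mono[OF polys_subset] by blast
    have dec: "{u. \<exists>z. on_curve a (Suc n) u z \<and> P u z} \<subseteq> {u. \<exists>z. on_curve a n u z \<and> R u z}"
      if "\<And>u z. on_curve a (Suc n) u z \<Longrightarrow> P u z \<Longrightarrow> R u z" for P R
      using that on_curve_le[of a "Suc n" _ _ n] by fastforce
    have inf_n: "infinite {u. \<exists>z. on_curve a n u z \<and> R u z}"
      if "\<And>u z. on_curve a (Suc n) u z \<Longrightarrow> f u z = 0 \<Longrightarrow> R u z" for R
      using dec[of "\<lambda>u z. f u z = 0" R] that Suc.prems(2) infinite_super by blast
    \<comment> \<open>The relative norm of \<open>f\<close>; it inherits infinitely many zeros and
      so vanishes identically by the induction on the number of coordinates.\<close>
    obtain h where h: "h \<in> ext (range poly) n" "\<And>u z. on_curve a n u z \<Longrightarrow>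
        h u z = (f0 u z)\<^sup>2 - (u - a n) * (f0 u z * f1 u z) - (u - a n) * (f1 u z)\<^sup>2"
      using quad[OF mr[OF m(1)] mr[OF m(2)]] by blast
    have h0: "h u z = 0" if "on_curve a n u z" for u z
    proof (rule IH[OF h(1) inf_n that])
      fix u z assume z: "on_curve a (Suc n) u z" "f u z = 0"
      have zn: "on_curve a n u z" "(z n)\<^sup>2 = (u - a n) * (1 - z n)" using z by (auto simp: on_curve_def)
      have "f0 u z = - f1 u z * z n" using z(2) unfolding eq by (simp add: add_eq_0_iff)
      then have "h u z = (f1 u z)\<^sup>2 * ((z n)\<^sup>2 + (u - a n) * z n - (u - a n))"
        unfolding h(2)[OF zn(1)] by (simp add: algebra_simps power2_eq_square)
      then show "h u z = 0" unfolding zn(2) by (simp add: algebra_simps)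
    qed
    \<comment> \<open>At \<open>u = a n\<close> the norm reduces to the square of
      \<open>f0\<close>.\<close>
    have f0: "f0 (a n) (flip a S (a n) z0) = 0" for S
      using h0[OF on_curve_flip[OF z0(1)]] h(2)[OF on_curve_flip[OF z0(1)]] by simp
    obtain g0 where g0: "g0 \<in> ext (polys d) n" "\<And>u z. f0 u z = (u - a n) * g0 u z"
      using ext_polys_divide[OF z0(1) z0(2) m(1)] f0 by blast
    \<comment> \<open>After substituting \<open>f0 = (u - a n) * g0\<close>, the norm
      \<open>h\<close> has a factor \<open>u - a n\<close>; up to sign the cofactor \<open>k\<close>
      is again a relative norm, that of \<open>f1 - g0 * z n\<close>. It vanishes where
      \<open>u \<noteq> a n\<close>, hence everywhere, and reduces to the square of
      \<open>f1\<close> at \<open>u = a n\<close>.\<close>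
    obtain k where k: "k \<in> ext (range poly) n" "\<And>u z. on_curve a n u z \<Longrightarrow>
        k u z = (f1 u z)\<^sup>2 - (u - a n) * (f1 u z * (- g0 u z)) - (u - a n) * (- g0 u z)\<^sup>2"
      using quad[OF mr[OF m(2)] ext_uminus_ring[OF fun_ring_polys linear_polys mr[OF g0(1)]]] by blast
    have inf': "infinite ({u. \<exists>z. on_curve a (Suc n) u z \<and> f u z = 0} - {a n})"
      using Suc.prems(2) by simp
    have k0: "k u z = 0" if "on_curve a n u z" for u z
    proof (rule IH[OF k(1) _ that])
      have "{u. \<exists>z. on_curve a (Suc n) u z \<and> f u z = 0} - {a n} \<subseteq> {u. \<exists>z. on_curve a n u z \<and> k u z = 0}"
      proof
        fix u assume "u \<in> {u. \<exists>z. on_curve a (Suc n) u z \<and> f u z = 0} - {a n}"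
        then obtain z where z: "on_curve a n u z" "u \<noteq> a n"
          using on_curve_le[of a "Suc n" u _ n] by auto
        have "(u - a n) * k u z = - h u z"
          unfolding k(2)[OF z(1)] h(2)[OF z(1)] g0(2) by (simp add: algebra_simps power2_eq_square)
        then have "k u z = 0" using h0[OF z(1)] z(2) by simp
        then show "u \<in> {u. \<exists>z. on_curve a n u z \<and> k u z = 0}" using z(1) by blast
      qed
      then show "infinite {u. \<exists>z. on_curve a n u z \<and> k u z = 0}" using inf' infinite_super by blast
    qed
    have f1: "f1 (a n) (flip a S (a n) z0) = 0" for S
      using k0[OF on_curve_flip[OF z0(1)]] k(2)[OF on_curve_flip[OF z0(1)]] by simp
    obtain g1 where g1: "g1 \<in> ext (polys d) n" "\<And>u z. f1 u z = (u - a n) * g1 u z"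
      using ext_polys_divide[OF z0(1) z0(2) m(2)] f1 by blast
    let ?g = "\<lambda>u z. g0 u z + g1 u z * z n"
    have fg: "f u z = (u - a n) * ?g u z" for u z
      unfolding eq g0(2) g1(2) by (simp add: algebra_simps)
    have "?g u z = 0"
    proof (rule Suc.IH)
      show "?g \<in> ext (polys d) (Suc n)" using g0(1) g1(1) by auto
      have "{u. \<exists>z. on_curve a (Suc n) u z \<and> f u z = 0} - {a n}
          \<subseteq> {u. \<exists>z. on_curve a (Suc n) u z \<and> ?g u z = 0}"
        using fg by auto
      then show "infinite {u. \<exists>z. on_curve a (Suc n) u z \<and> ?g u z = 0}"
        using inf' infinite_super by blast
    qed (rule Suc.prems(3))
    then show ?case using fg by simp
  qed
qed


section \<open>Functions with poles at one point at infinity\<close>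

text \<open>Elimination: a nonzero entry in row \<open>k\<close> expresses one unknown through the
  others, which leaves one equation and one unknown less.\<close>

lemma homogeneous_system_nontrivial:
  fixes M :: "'i \<Rightarrow> 'j \<Rightarrow> 'k::field"
  assumes "finite I" "finite J" "card I < card J"
  shows "\<exists>c. (\<exists>j\<in>J. c j \<noteq> 0) \<and> (\<forall>i\<in>I. (\<Sum>j\<in>J. M i j * c j) = 0)"
  using assms
proof (induction I arbitrary: J M rule: finite_induct)
  case empty
  then obtain j where "j \<in> J" by fastforce
  then show ?case by (intro exI[of _ "\<lambda>_. 1"]) auto
next
  case (insert k I)
  show ?case
  proof (cases "\<forall>j\<in>J. M k j = 0")
    case True
    with insert.IH[of J M] insert.hyps insert.prems show ?thesis by auto
  next
    case False
    then obtain j where j: "j \<in> J" "M k j \<noteq> 0" by blast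
    define J' where "J' = J - {j}"
    have J': "finite J'" "card I < card J'" "J = insert j J'" "j \<notin> J'"
      using insert.hyps insert.prems j unfolding J'_def by (auto simp: card_Diff_singleton)
    obtain c where c: "\<exists>j\<in>J'. c j \<noteq> 0"
      "\<forall>i\<in>I. (\<Sum>l\<in>J'. (M i l - M i j * M k l / M k j) * c l) = 0"
      using insert.IH[OF J'(1,2), of "\<lambda>i l. M i l - M i j * M k l / M k j"] by blast
    define c' where "c' = c(j := - (\<Sum>l\<in>J'. M k l * c l) / M k j)"
    have c'_l: "c' l = c l" if "l \<in> J'" for l using that J'(4) by (auto simp: c'_def)
    have sum: "(\<Sum>l\<in>J. M i l * c' l) = M i j * c' j + (\<Sum>l\<in>J'. M i l * c l)" for i
      using J' c'_l by simp
    have "(\<Sum>l\<in>J. M i l * c' l) = 0" if "i \<in> I" for i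
    proof -
      have "0 = (\<Sum>l\<in>J'. M i l * c l - M i j * (M k l * c l) / M k j)"
        using c(2) that by (simp add: left_diff_distrib mult.assoc)
      also have "\<dots> = (\<Sum>l\<in>J'. M i l * c l) - M i j * (\<Sum>l\<in>J'. M k l * c l) / M k j"
        by (simp add: sum_subtractf sum_distrib_left sum_divide_distrib)
      finally show ?thesis unfolding sum by (simp add: c'_def)
    qed
    moreover have "(\<Sum>l\<in>J. M k l * c' l) = 0"
      unfolding sum using j(2) by (simp add: c'_def)
    moreover have "\<exists>l\<in>J. c' l \<noteq> 0" using c(1) c'_l J'(3) by auto
    ultimately show ?thesis by (intro exI[of _ c']) auto
  qed
qed

lemma ext_sum:
  fixes f :: "'j \<Rightarrow> 'k::field \<Rightarrow> (nat \<Rightarrow> 'k) \<Rightarrow> 'k"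
  assumes "\<And>j. j \<in> J \<Longrightarrow> f j \<in> ext (range poly) n"
  shows "(\<lambda>u z. \<Sum>j\<in>J. c j * f j u z) \<in> ext (range poly) n"
  using assms
proof (induction J rule: infinite_finite_induct)
  case (insert x F)
  have "(\<lambda>_. c x) \<in> range poly" by (rule range_eqI[of _ _ "[:c x:]"]) auto
  then have "(\<lambda>u z. c x * f x u z) \<in> ext (range poly) n"
    using ext_scale_ring[OF fun_ring_polys linear_polys] insert.prems by blast
  then show ?case
    using insert by (simp add: ext_add_ring[OF fun_ring_polys linear_polys])
next
  case (infinite A)
  then show ?case using fun_ring_polys[where ?'k = 'k] by (auto simp: fun_ring_def intro!: ext_base)
next
  case empty
  then show ?case using fun_ring_polys[where ?'k = 'k] by (auto simp: fun_ring_def intro!: ext_base)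
qed

text \<open>The functions are the products of \<open>u ^ j\<close> with \<open>j < d\<close> and
  square-free monomials in the coordinates. Independence is needed over \<open>\<Omega>\<close>
  only, where unramified rational points exist: there the two values of \<open>z n\<close> separate
  the functions without \<open>z n\<close> from those with it.\<close>

lemma ext_polys_basis:
  fixes a :: "nat \<Rightarrow> 'k::field"
  assumes \<Omega>: "infinite \<Omega>"
    and pts: "\<And>u. u \<in> \<Omega> \<Longrightarrow> \<exists>z. on_curve a n u z \<and> (\<forall>i<n. 2 * z i + (u - a i) \<noteq> 0)"
  shows "\<exists>b :: nat \<Rightarrow> 'k \<Rightarrow> (nat \<Rightarrow> 'k) \<Rightarrow> 'k. (\<forall>j<2 ^ n * d. b j \<in> ext (polys d) n) \<and>
    (\<forall>c. (\<forall>u\<in>\<Omega>. \<forall>z. on_curve a n u z \<longrightarrow> (\<forall>i<n. 2 * z i + (u - a i) \<noteq> 0) \<longrightarrow>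
        (\<Sum>j<2 ^ n * d. c j * b j u z) = 0) \<longrightarrow> (\<forall>j<2 ^ n * d. c j = 0))"
  using pts
proof (induction n)
  case 0
  let ?b = "\<lambda>j u z. poly (monom 1 j) u :: 'k"
  have "?b j \<in> ext (polys d) 0" if "j < d" for j
    using that by (auto simp: polys_def intro!: exI[of _ "monom 1 j"])
  moreover have "c j = 0" if z: "\<forall>u\<in>\<Omega>. (\<Sum>j<d. c j * u ^ j) = 0" and "j < d" for c j
  proof -
    define p where "p = (\<Sum>j<d. monom (c j) j)"
    have "poly p u = 0" if "u \<in> \<Omega>" for u
      using z that by (simp add: p_def poly_sum poly_monom)
    then have "\<Omega> \<subseteq> {u. poly p u = 0}" by blast
    then have "p = 0" using \<Omega> poly_roots_finite finite_subset by blast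
    moreover have "coeff p j = c j" using \<open>j < d\<close> by (simp add: p_def coeff_sum)
    ultimately show ?thesis by simp
  qed
  ultimately show ?case
    by (intro exI[of _ ?b]) (auto simp: poly_monom on_curve_def)
next
  case (Suc n)
  let ?N = "2 ^ n * d"
  have pts_n: "\<exists>z. on_curve a n u z \<and> (\<forall>i<n. 2 * z i + (u - a i) \<noteq> 0)" if "u \<in> \<Omega>" for u
    using Suc.prems[OF that] on_curve_le[of a "Suc n" u _ n] by (meson le_SucI le_refl less_SucI)
  from Suc.IH[OF pts_n] obtain b :: "nat \<Rightarrow> 'k \<Rightarrow> (nat \<Rightarrow> 'k) \<Rightarrow> 'k" where
    b_ind: "(\<forall>j<?N. b j \<in> ext (polys d) n) \<and>
      (\<forall>c. (\<forall>u\<in>\<Omega>. \<forall>z. on_curve a n u z \<longrightarrow> (\<forall>i<n. 2 * z i + (u - a i) \<noteq> 0) \<longrightarrow>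
        (\<Sum>j<?N. c j * b j u z) = 0) \<longrightarrow> (\<forall>j<?N. c j = 0))" ..
  then have b: "\<And>j. j < ?N \<Longrightarrow> b j \<in> ext (polys d) n" by blast
  have ind: "c j = 0" if "\<And>u z. u \<in> \<Omega> \<Longrightarrow> on_curve a n u z \<Longrightarrow> (\<forall>i<n. 2 * z i + (u - a i) \<noteq> 0) \<Longrightarrow>
        (\<Sum>j<?N. c j * b j u z) = 0" "j < ?N" for c j
    using b_ind[THEN conjunct2, THEN spec[of _ c]] that by blast
  define b' where "b' j u z = (if j < ?N then b j u z else b (j - ?N) u z * z n)" for j u z
  have zero: "(\<lambda>u z. 0) \<in> ext (polys d) n"
    by (rule ext_base) (auto simp: polys_def intro!: exI[of _ 0])
  have "b' j \<in> ext (polys d) (Suc n)" if "j < 2 ^ Suc n * d" for j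
  proof (cases "j < ?N")
    case True
    show ?thesis by (rule ext_SucI[OF b[OF True] zero]) (simp add: b'_def True fun_eq_iff)
  next
    case False
    then have "j - ?N < ?N" using that by simp
    from b[OF this] show ?thesis by (rule ext_SucI[OF zero]) (simp add: b'_def False fun_eq_iff)
  qed
  moreover have "c j = 0" if c: "\<forall>u\<in>\<Omega>. \<forall>z. on_curve a (Suc n) u z \<longrightarrow>
      (\<forall>i<Suc n. 2 * z i + (u - a i) \<noteq> 0) \<longrightarrow> (\<Sum>j<2 ^ Suc n * d. c j * b' j u z) = 0"
    and j: "j < 2 ^ Suc n * d" for c j
  proof -
    have split: "(\<Sum>j<2 ^ Suc n * d. g j) = (\<Sum>j<?N. g j) + (\<Sum>j<?N. g (?N + j))" for g :: "nat \<Rightarrow> 'k"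
    proof -
      have "{..<2 ^ Suc n * d} = {..<?N} \<union> (+) ?N ` {..<?N}"
      proof (intro equalityI subsetI)
        fix x assume "x \<in> {..<2 ^ Suc n * d}"
        then show "x \<in> {..<?N} \<union> (+) ?N ` {..<?N}"
          by (cases "x < ?N") (auto intro!: image_eqI[of _ _ "x - ?N"])
      next
        fix x assume "x \<in> {..<?N} \<union> (+) ?N ` {..<?N}"
        then consider "x < ?N" | y where "y < ?N" "x = ?N + y" by blast
        then have "x < ?N + ?N" by cases simp_all
        then show "x \<in> {..<2 ^ Suc n * d}" by simp
      qed
      then have "(\<Sum>j<2 ^ Suc n * d. g j) = (\<Sum>j<?N. g j) + sum g ((+) ?N ` {..<?N})"
        by (simp only:) (rule sum.union_disjoint, auto)
      then show ?thesis by (simp add: sum.reindex)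
    qed
    have zz: "(\<Sum>j<?N. c j * b j u z) = 0 \<and> (\<Sum>j<?N. c (?N + j) * b j u z) = 0"
      if u: "u \<in> \<Omega>" and z: "on_curve a n u z" "\<forall>i<n. 2 * z i + (u - a i) \<noteq> 0" for u z
    proof -
      let ?s = "\<Sum>j<?N. c j * b j u z" and ?s' = "\<Sum>j<?N. c (?N + j) * b j u z"
      obtain w where w: "on_curve a (Suc n) u w" "\<forall>i<Suc n. 2 * w i + (u - a i) \<noteq> 0"
        using Suc.prems[OF u] by blast
      \<comment> \<open>The last coordinate is constrained by \<open>u\<close> alone, so either root
        \<open>y\<close> can be attached to the given \<open>z\<close>. The two resulting equations
        have determinant \<open>2 * w n + (u - a n)\<close> up to sign.\<close>
      have eq: "?s + ?s' * y = 0" if y: "y = w n \<or> y = - (u - a n) - w n" for y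
      proof -
        let ?z = "z(n := y)"
        have "y\<^sup>2 = (u - a n) * (1 - y)"
          using on_curve_flip[OF w(1), of "{n}"] w(1) y by (auto simp: on_curve_def flip_def)
        then have "on_curve a (Suc n) u ?z" using z(1) by (auto simp: on_curve_def less_Suc_eq)
        moreover have "2 * y + (u - a n) = 2 * w n + (u - a n) \<or> 2 * y + (u - a n) = - (2 * w n + (u - a n))"
          using y
        proof
          assume y: "y = - (u - a n) - w n"
          have "2 * y + (u - a n) = - (2 * w n + (u - a n))"
            unfolding y by (simp add: algebra_simps)
          then show ?thesis ..
        qed simp
        then have "2 * y + (u - a n) \<noteq> 0" using w(2) by (metis lessI neg_equal_0_iff_equal)
        then have "\<forall>i<Suc n. 2 * ?z i + (u - a i) \<noteq> 0" using z(2) by (auto simp: less_Suc_eq)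
        ultimately have "(\<Sum>j<2 ^ Suc n * d. c j * b' j u ?z) = 0" using c u by blast
        moreover have "b j u ?z = b j u z" if "j < ?N" for j
          by (rule ext_cong[OF b[OF that]]) simp
        moreover from this have "(\<Sum>j<?N. c j * b' j u ?z) = ?s"
          by (intro sum.cong) (auto simp: b'_def)
        moreover have "(\<Sum>j<?N. c (?N + j) * b' (?N + j) u ?z) = ?s' * y"
          unfolding sum_distrib_right using \<open>\<And>j. j < ?N \<Longrightarrow> b j u ?z = b j u z\<close>
          by (intro sum.cong) (auto simp: b'_def)
        ultimately show ?thesis unfolding split by simp
      qed
      have "?s' * (2 * w n + (u - a n)) = (?s + ?s' * w n) - (?s + ?s' * (- (u - a n) - w n))"
        by (simp add: algebra_simps)
      also have "\<dots> = 0" using eq by simp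
      finally have "?s' = 0" using w(2) by simp
      then show ?thesis using eq[of "w n"] by simp
    qed
    show ?thesis
    proof (cases "j < ?N")
      case True
      then show ?thesis using ind[of c j] zz by blast
    next
      case False
      then have "j - ?N < ?N" "j = ?N + (j - ?N)" using j by auto
      then show ?thesis using ind[of "\<lambda>j. c (?N + j)" "j - ?N"] zz by auto
    qed
  qed
  ultimately show ?case by (intro exI[of _ b']) blast
qed

section \<open>Points at infinity and orders of poles\<close>

context V_ball
begin

text \<open>For the two roots \<open>z\<close> and \<open>w\<close> the sum equals the product. If
  \<open>z \<preceq> w\<close>, then \<open>z * w = z + w \<preceq> e * w\<close>, and
  \<open>w\<close> cancels.\<close>

lemma standard_root:
  assumes "z\<^sup>2 = (u - c) * (1 - z)" "u \<noteq> c" "z \<preceq> - (u - c) - z"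
  shows "z \<preceq> e"
proof -
  define w where "w = - (u - c) - z"
  have d: "u - c = - z - w" by (simp add: w_def)
  have "z * w = - (u - c)"
    using assms(1) unfolding w_def by (simp add: algebra_simps power2_eq_square)
  then have zw: "z * w = z + w" by (simp add: d)
  have "z \<preceq> w" using assms(3) by (simp add: w_def)
  then have "z + w \<preceq> e * w" by (intro le_add) auto
  then have "w * z \<preceq> w * e" using zw by (simp add: mult.commute)
  moreover have "w \<noteq> 0" using zw d assms(2) by auto
  ultimately show ?thesis using le_mult_cancel by blast
qed

text \<open>Convergence to one chosen point over \<open>u = \<infinity>\<close>, where every
  coordinate is the smaller root; by the equation of the curve all coordinates then tend to 1. The
  other points at infinity are reached by composing with \<open>flip a S\<close>.\<close>

definition std :: "(nat \<Rightarrow> 'k) \<Rightarrow> nat \<Rightarrow> ('k \<times> (nat \<Rightarrow> 'k)) filter" where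
  "std a n = (INF c. principal {(u, y). on_curve a n u y \<and> (\<forall>i<n. y i \<preceq> e) \<and> \<not> u \<preceq> c})"

lemma eventually_std:
  "eventually P (std a n) \<longleftrightarrow>
    (\<exists>c. \<forall>u y. on_curve a n u y \<longrightarrow> (\<forall>i<n. y i \<preceq> e) \<longrightarrow> \<not> u \<preceq> c \<longrightarrow> P (u, y))"
  unfolding std_def
proof (subst eventually_INF_base)
  fix c c' :: 'k
  obtain d where "c \<preceq> d" "c' \<preceq> d" using ex_upper by blast
  then have "\<not> u \<preceq> c \<and> \<not> u \<preceq> c'" if "\<not> u \<preceq> d" for u using le_trans that by blast
  then show "\<exists>x\<in>UNIV. principal {(u, y). on_curve a n u y \<and> (\<forall>i<n. y i \<preceq> e) \<and> \<not> u \<preceq> x}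
      \<le> inf (principal {(u, y). on_curve a n u y \<and> (\<forall>i<n. y i \<preceq> e) \<and> \<not> u \<preceq> c})
        (principal {(u, y). on_curve a n u y \<and> (\<forall>i<n. y i \<preceq> e) \<and> \<not> u \<preceq> c'})"
    by (intro bexI[of _ d]) auto
qed (auto simp: eventually_principal)

context
  fixes a :: "nat \<Rightarrow> 'k" and N :: nat
begin

abbreviation "G \<equiv> std a N"

lemma std_large: "large G fst"
  unfolding vlarge_def eventually_std by auto

lemma std_large_diff: "large G (\<lambda>p. fst p - c)"
  using large_add_bdd[OF std_large bdd_const[of G "- c"]] by simp

lemma std_on_curve: "\<forall>\<^sub>F p in G. on_curve a N (fst p) (snd p)"
  unfolding eventually_std by auto

lemma std_bdd: "i < N \<Longrightarrow> bdd G (\<lambda>p. snd p i)"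
  unfolding vbdd_def eventually_std by (rule exI[of _ e]) auto

abbreviation "t \<equiv> \<lambda>p :: 'k \<times> (nat \<Rightarrow> 'k). inverse (fst p)"

lemma std_t: "bdd G t"
  using std_large large_iff_null_inverse null_imp_bdd by blast

lemma std_nz: "\<forall>\<^sub>F p in G. fst p \<noteq> c"
  using std_large_diff[of c] unfolding large_iff_null_inverse by simp

text \<open>Iteration of \<open>1 / (u - c) = t + c * t / (u - c)\<close>.\<close>

lemma expands_inverse: "expands G t r (\<lambda>p. inverse (fst p - c))"
proof (induction r)
  case 0
  have "bdd G (\<lambda>p. inverse (fst p - c))"
    using std_large_diff[of c] large_iff_null_inverse null_imp_bdd by blast
  then show ?case by (intro expands_big_o) (simp add: bdd_iff_big_o)
next
  case (Suc r)
  have "\<forall>\<^sub>F p in G. t p + c * (t p * inverse (fst p - c)) = inverse (fst p - c)"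
    using std_nz[of 0] std_nz[of c] by eventually_elim (simp add: field_simps)
  then show ?case
    by (rule expands_cong)
      (intro expands_add expands_id expands_mult[OF std_t] expands_const expands_Suc[OF Suc])
qed

text \<open>The equation of the curve reads \<open>y = 1 - y\<^sup>2 / (u - a i)\<close>, and
  \<open>1 / (u - a i)\<close> contains a factor \<open>t\<close>, so each iteration gains one
  order.\<close>

lemma expands_coord:
  assumes "i < N" shows "expands G t r (\<lambda>p. snd p i)"
proof (induction r)
  case 0
  then show ?case using std_bdd[OF assms] by (intro expands_big_o) (simp add: bdd_iff_big_o)
next
  case (Suc r)
  let ?g = "\<lambda>p. (1 + a i * inverse (fst p - a i)) * (snd p i * snd p i)"
  have "expands G t r ?g"
    by (intro expands_mult[OF std_t] expands_add expands_const expands_inverse Suc)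
  then have "expands G t (Suc r) (\<lambda>p. 1 - t p * ?g p)"
    by (intro expands_diff expands_const expands_Suc)
  have "\<forall>\<^sub>F p in G. 1 - t p * ?g p = snd p i"
    using std_nz[of 0] std_nz[of "a i"] std_on_curve
  proof eventually_elim
    case (elim p)
    have "(snd p i)\<^sup>2 = (fst p - a i) * (1 - snd p i)" using elim assms by (auto simp: on_curve_def)
    moreover have "t p * (1 + a i * inverse (fst p - a i)) = inverse (fst p - a i)"
      using elim by (simp add: field_simps)
    ultimately have "t p * ?g p = inverse (fst p - a i) * ((fst p - a i) * (1 - snd p i))"
      by (metis mult.assoc power2_eq_square)
    then have "1 - t p * ?g p = 1 - inverse (fst p - a i) * (fst p - a i) * (1 - snd p i)"
      by (simp only: mult.assoc)
    then show ?case using elim by simp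
  qed
  from this \<open>expands G t (Suc r) _\<close> show ?case by (rule expands_cong)
qed

lemma expands_sum: "(\<And>j. j \<in> J \<Longrightarrow> expands F s r (f j)) \<Longrightarrow> expands F s r (\<lambda>p. \<Sum>j\<in>J. f j p)"
  by (induction J rule: infinite_finite_induct) (simp_all add: expands_const expands_add)

lemma expands_power: "bdd F s \<Longrightarrow> expands F s r f \<Longrightarrow> expands F s r (\<lambda>p. f p ^ k)"
  by (induction k) (simp_all add: expands_const expands_mult)

text \<open>The exponent \<open>d + n\<close> bounds the order of the pole: coefficients have degree
  at most \<open>d\<close>, and each coordinate contributes at most one, because a flipped
  coordinate grows like \<open>u\<close>.\<close>

lemma expands_ext:
  assumes "f \<in> ext (polys (Suc d)) n" "n \<le> N"
  shows "expands G t r (\<lambda>p. t p ^ (d + n) * f (fst p) (flip a S (fst p) (snd p)))"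
  using assms
proof (induction n arbitrary: f)
  case 0
  then obtain q where q: "f = (\<lambda>u z. poly q u)" "\<And>i. i \<ge> Suc d \<Longrightarrow> coeff q i = 0"
    by (auto simp: polys_def)
  have eq: "poly q u = (\<Sum>i\<le>d. coeff q i * u ^ i)" for u
  proof -
    have "degree q \<le> d" using q(2) by (intro degree_le) auto
    then have "poly q u = poly (\<Sum>i\<le>d. monom (coeff q i) i) u"
      by (simp only: poly_as_sum_of_monoms')
    then show ?thesis by (simp add: poly_sum poly_monom)
  qed
  have "\<forall>\<^sub>F p in G. (\<Sum>i\<le>d. coeff q i * t p ^ (d - i)) = t p ^ (d + 0) * f (fst p) (flip a S (fst p) (snd p))"
    using std_nz[of 0]
  proof eventually_elim
    case (elim p)
    have "t p ^ d * (coeff q i * fst p ^ i) = coeff q i * t p ^ (d - i)" if "i \<le> d" for i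
    proof -
      have "t p ^ d = t p ^ (d - i) * t p ^ i" using that by (simp flip: power_add)
      then show ?thesis using elim by (simp add: field_simps)
    qed
    then show ?case unfolding q(1) eq by (simp only: sum_distrib_left add_0_right) (rule sum.cong[OF refl], simp only: atMost_iff)
  qed
  then show ?case
    by (rule expands_cong)
      (intro expands_sum expands_mult[OF std_t] expands_const expands_power[OF std_t] expands_id)
next
  case (Suc n)
  from Suc.prems(1) obtain f0 f1 where eq: "f = (\<lambda>p z. f0 p z + f1 p z * z n)"
    and m: "f0 \<in> ext (polys (Suc d)) n" "f1 \<in> ext (polys (Suc d)) n" by auto
  let ?z = "\<lambda>p. flip a S (fst p) (snd p)"
  have coord: "expands G t r (\<lambda>p. t p * ?z p n)"
  proof (cases "n \<in> S")
    case True
    have "\<forall>\<^sub>F p in G. - (1 - a n * t p) - t p * snd p n = t p * ?z p n"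
      using std_nz[of 0] by eventually_elim (use True in \<open>simp add: flip_def field_simps\<close>)
    then show ?thesis
      by (rule expands_cong) (use Suc.prems(2) in \<open>intro expands_diff expands_uminus expands_const
        expands_mult[OF std_t] expands_id expands_coord; simp\<close>)
  next
    case False
    then have "(\<lambda>p. t p * ?z p n) = (\<lambda>p. t p * snd p n)" by (simp add: flip_def)
    then show ?thesis
      using Suc.prems(2) by (simp add: expands_mult[OF std_t] expands_id expands_coord)
  qed
  have "(\<lambda>p. t p ^ (d + Suc n) * f (fst p) (?z p)) =
      (\<lambda>p. t p * (t p ^ (d + n) * f0 (fst p) (?z p)) + (t p ^ (d + n) * f1 (fst p) (?z p)) * (t p * ?z p n))"
    unfolding eq by (simp add: fun_eq_iff algebra_simps)
  moreover have "n \<le> N" using Suc.prems(2) by simp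
  ultimately show ?case
    by (simp only:) (rule expands_add[OF expands_mult[OF std_t expands_id Suc.IH[OF m(1)]]
      expands_mult[OF std_t Suc.IH[OF m(2)] coord]]; assumption)
qed

lemma poly_bdd_imp_const:
  assumes "F \<noteq> bot" "large F f" "bdd F (\<lambda>i. poly p (f i))"
  shows "degree p = 0"
  using assms(3)
proof (induction p)
  case (pCons c p)
  have inv: "null F (\<lambda>i. inverse (f i))" "\<forall>\<^sub>F i in F. f i \<noteq> 0"
    using assms(2) large_iff_null_inverse by blast+
  have "bdd F (\<lambda>i. poly (pCons c p) (f i) - c)"
    by (intro bdd_diff pCons.prems bdd_const)
  then have "bdd F (\<lambda>i. f i * poly p (f i))" by simp
  then have "null F (\<lambda>i. inverse (f i) * (f i * poly p (f i)))" by (rule null_mult_bdd[OF inv(1)])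
  moreover have "\<forall>\<^sub>F i in F. inverse (f i) * (f i * poly p (f i)) = poly p (f i)"
    using inv(2) by eventually_elim simp
  ultimately have n: "null F (\<lambda>i. poly p (f i))" by (rule null_cong[rotated])
  then have "degree p = 0" using pCons.IH null_imp_bdd by blast
  then obtain k where k: "p = [:k:]" using degree_eq_zeroE by blast
  then have "k = 0" using n null_const_iff[OF assms(1)] by simp
  then show ?case using k by simp
qed simp

text \<open>A function without poles is constant.\<close>

lemma ext_bdd_imp_const:
  assumes "G \<noteq> bot" "f \<in> ext (range poly) n" "n \<le> N"
    and "\<And>S. bdd G (\<lambda>p. f (fst p) (flip a S (fst p) (snd p)))"
  shows "\<exists>k. \<forall>u z. on_curve a n u z \<longrightarrow> f u z = k"
  using assms
proof (induction n arbitrary: f)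
  case 0
  then obtain q where q: "f = (\<lambda>u z. poly q u)" by auto
  have "degree q = 0"
    using poly_bdd_imp_const[OF assms(1) std_large] 0(4) by (simp add: q)
  then obtain k where "q = [:k:]" using degree_eq_zeroE by blast
  then show ?case by (auto simp: q)
next
  case (Suc n)
  from Suc.prems(2) obtain f0 f1 where eq: "f = (\<lambda>p z. f0 p z + f1 p z * z n)"
    and m: "f0 \<in> ext (range poly) n" "f1 \<in> ext (range poly) n" by auto
  let ?F = "\<lambda>S p. flip a S (fst p) (snd p)"
  let ?D = "\<lambda>p. (fst p - a n) + 2 * snd p n"
  have D: "large G ?D"
    by (rule large_add_bdd[OF std_large_diff]) (use Suc.prems(3) in \<open>intro bdd_mult bdd_const std_bdd; simp\<close>)
  \<comment> \<open>Exchanging the two roots \<open>z n\<close> changes \<open>f\<close> by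
    \<open>f1 * ?D\<close>. This is bounded while \<open>?D\<close> is large, so \<open>f1\<close>
    vanishes at every point at infinity; being constant by induction, it is 0.\<close>
  have f1_null: "null G (\<lambda>p. f1 (fst p) (?F S p))" for S
  proof -
    have eqs: "f0 (fst p) (?F (S - {n}) p) = f0 (fst p) (?F S p)"
      "f0 (fst p) (?F (insert n S) p) = f0 (fst p) (?F S p)"
      "f1 (fst p) (?F (S - {n}) p) = f1 (fst p) (?F S p)"
      "f1 (fst p) (?F (insert n S) p) = f1 (fst p) (?F S p)" for p
      using m by (auto intro!: ext_cong_flip)
    have "f (fst p) (?F (S - {n}) p) - f (fst p) (?F (insert n S) p) = f1 (fst p) (?F S p) * ?D p" for p
    proof -
      have "?F (S - {n}) p n = snd p n" "?F (insert n S) p n = - (fst p - a n) - snd p n"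
        by (simp_all add: flip_def)
      then have "f (fst p) (?F (S - {n}) p) - f (fst p) (?F (insert n S) p) =
          f1 (fst p) (?F S p) * snd p n - f1 (fst p) (?F S p) * (- (fst p - a n) - snd p n)"
        unfolding eq eqs by simp
      then show ?thesis by (simp add: algebra_simps)
    qed
    then have "bdd G (\<lambda>p. f1 (fst p) (?F S p) * ?D p)"
      using bdd_diff[OF Suc.prems(4)[of "S - {n}"] Suc.prems(4)[of "insert n S"]] by simp
    moreover have inv: "null G (\<lambda>p. inverse (?D p))" "\<forall>\<^sub>F p in G. ?D p \<noteq> 0"
      using D unfolding large_iff_null_inverse by blast+
    ultimately have "null G (\<lambda>p. (f1 (fst p) (?F S p) * ?D p) * inverse (?D p))"
      by (intro null_mult_bdd')
    moreover have "\<forall>\<^sub>F p in G. (f1 (fst p) (?F S p) * ?D p) * inverse (?D p) = f1 (fst p) (?F S p)"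
      using inv(2) by eventually_elim simp
    ultimately show ?thesis by (rule null_cong[rotated])
  qed
  obtain k where k: "\<And>u z. on_curve a n u z \<Longrightarrow> f1 u z = k"
    using Suc.IH[OF Suc.prems(1) m(2)] Suc.prems(3) null_imp_bdd[OF f1_null] by auto
  have "\<forall>\<^sub>F p in G. f1 (fst p) (?F {} p) = k"
    using std_on_curve
    by eventually_elim (use k on_curve_le[of a N _ _ n] Suc.prems(3) in auto)
  then have "null G (\<lambda>p. k)" using f1_null by (rule null_cong)
  then have "k = 0" using null_const_iff[OF Suc.prems(1)] by blast
  then have f: "f u z = f0 u z" if "on_curve a n u z" for u z
    using k[OF that] by (simp add: eq)
  have "bdd G (\<lambda>p. f0 (fst p) (?F S p))" for S
  proof (rule bdd_cong[OF _ Suc.prems(4)[of S]])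
    show "\<forall>\<^sub>F p in G. f (fst p) (?F S p) = f0 (fst p) (?F S p)"
      using std_on_curve
      by eventually_elim (use f on_curve_flip on_curve_le Suc.prems(3) Suc_leD in blast)
  qed
  then obtain l where l: "\<And>u z. on_curve a n u z \<Longrightarrow> f0 u z = l"
    using Suc.IH[OF Suc.prems(1) m(1)] Suc.prems(3) by auto
  then show ?case using f on_curve_le[of a "Suc n" _ _ n] by (intro exI[of _ l]) auto
qed

text \<open>
  There are \<open>2 ^ N * Suc d\<close> coefficients and \<open>2 ^ N - 1\<close> points at infinity with \<open>d + N + 1\<close>
  conditions each.
\<close>

lemma ex_ext_pole_at:
  assumes \<Omega>: "infinite \<Omega>"
    and pts: "\<And>u. u \<in> \<Omega> \<Longrightarrow> \<exists>z. on_curve a N u z \<and> (\<forall>i<N. 2 * z i + (u - a i) \<noteq> 0)"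
    and Q: "Q \<subseteq> {..<N}"
  shows "\<exists>f\<in>ext (range poly) N. (\<exists>u z. on_curve a N u z \<and> f u z \<noteq> 0) \<and>
    (\<forall>S\<subseteq>{..<N}. S \<noteq> Q \<longrightarrow> bdd G (\<lambda>p. fst p * f (fst p) (flip a S (fst p) (snd p))))"
proof -
  \<comment> \<open>There are fewer equations than unknowns exactly if
    \<open>2 ^ N * N < d + N + 1\<close>.\<close>
  define d where "d = 2 ^ N * N"
  let ?J = "{..<2 ^ N * Suc d}" and ?I = "(Pow {..<N} - {Q}) \<times> {..d + N}"
  from ext_polys_basis[OF \<Omega> pts, of "Suc d"] obtain b :: "nat \<Rightarrow> 'k \<Rightarrow> (nat \<Rightarrow> 'k) \<Rightarrow> 'k"
    where b_ind: "(\<forall>j<2 ^ N * Suc d. b j \<in> ext (polys (Suc d)) N) \<and>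
      (\<forall>c. (\<forall>u\<in>\<Omega>. \<forall>z. on_curve a N u z \<longrightarrow> (\<forall>i<N. 2 * z i + (u - a i) \<noteq> 0) \<longrightarrow>
        (\<Sum>j\<in>?J. c j * b j u z) = 0) \<longrightarrow> (\<forall>j<2 ^ N * Suc d. c j = 0))" ..
  then have b: "\<And>j. j \<in> ?J \<Longrightarrow> b j \<in> ext (polys (Suc d)) N" by blast
  let ?h = "\<lambda>S f p. t p ^ (d + N) * f (fst p) (flip a S (fst p) (snd p))"
  have "expands G t (Suc (d + N)) (?h S (b j))" if "j \<in> ?J" for S j
    using expands_ext[OF b[OF that] order_refl] .
  then have ex_P: "\<exists>P. big_o G (\<lambda>p. ?h S (b j) p - poly P (t p)) (\<lambda>p. t p ^ Suc (d + N))" if "j \<in> ?J" for S j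
    using that unfolding expands_def .
  define P where
    "P S j = (SOME P. big_o G (\<lambda>p. ?h S (b j) p - poly P (t p)) (\<lambda>p. t p ^ Suc (d + N)))" for S j
  have P: "big_o G (\<lambda>p. ?h S (b j) p - poly (P S j) (t p)) (\<lambda>p. t p ^ Suc (d + N))" if "j \<in> ?J" for S j
    unfolding P_def by (rule someI_ex[OF ex_P[OF that]])
  have "card ?I = (2 ^ N - 1) * Suc (d + N)"
    using Q by (simp add: card_cartesian_product card_Diff_singleton card_Pow)
  also have "\<dots> < 2 ^ N * Suc d"
  proof -
    obtain m where m: "(2::nat) ^ N = Suc m" by (metis gr0_implies_Suc zero_less_numeral zero_less_power)
    show ?thesis unfolding d_def m by (simp add: algebra_simps)
  qed
  finally obtain c where c: "\<exists>j\<in>?J. c j \<noteq> 0"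
      "\<forall>i\<in>?I. (\<Sum>j\<in>?J. coeff (P (fst i) j) (snd i) * c j) = 0"
    using homogeneous_system_nontrivial[of ?I ?J "\<lambda>i j. coeff (P (fst i) j) (snd i)"] by auto
  define f where "f u z = (\<Sum>j\<in>?J. c j * b j u z)" for u z
  have "f \<in> ext (range poly) N"
    unfolding f_def using b ext_mono[OF polys_subset] by (intro ext_sum) blast
  moreover have "\<exists>u z. on_curve a N u z \<and> f u z \<noteq> 0"
    using b_ind[THEN conjunct2, THEN spec[of _ c]] c(1) unfolding f_def by blast
  moreover have "bdd G (\<lambda>p. fst p * f (fst p) (flip a S (fst p) (snd p)))"
    if S: "S \<subseteq> {..<N}" "S \<noteq> Q" for S
  proof -
    \<comment> \<open>The equations kill the coefficients of \<open>R\<close> up to index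
      \<open>d + N\<close>. Hence \<open>t ^ (d + N) * f\<close> is of order
      \<open>t ^ (d + N + 1)\<close>, which says that even \<open>u * f\<close> is bounded; this
      extra order makes it possible to replace \<open>f\<close> by \<open>u * f\<close>
      later.\<close>
    define R where "R = (\<Sum>j\<in>?J. smult (c j) (P S j))"
    have "coeff R k = 0" if "k \<le> d + N" for k
      using c(2) S that by (auto simp: R_def coeff_sum mult.commute)
    then obtain R' where R': "R = monom 1 (Suc (d + N)) * R'"
      by (metis monom_1_dvd_iff' dvdE less_Suc_eq_le)
    have "big_o G (\<lambda>p. \<Sum>j\<in>?J. c j * (?h S (b j) p - poly (P S j) (t p))) (\<lambda>p. t p ^ Suc (d + N))"
    proof -
      have "big_o G (\<lambda>p. \<Sum>j\<in>J. c j * (?h S (b j) p - poly (P S j) (t p))) (\<lambda>p. t p ^ Suc (d + N))"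
        if "J \<subseteq> ?J" for J
        using finite_subset[OF that finite_lessThan] that
      proof (induction J rule: finite_induct)
        case (insert x F)
        have "big_o G (\<lambda>p. c x * (?h S (b x) p - poly (P S x) (t p))) (\<lambda>p. t p ^ Suc (d + N))"
          using insert.prems by (intro big_o_mult_bdd bdd_const P) auto
        moreover have "F \<subseteq> ?J" using insert.prems by blast
        ultimately show ?case
          unfolding sum.insert[OF insert.hyps] by (intro big_o_add insert.IH)
      qed (simp add: big_o_zero)
      then show ?thesis by blast
    qed
    moreover have "(\<Sum>j\<in>?J. c j * (?h S (b j) p - poly (P S j) (t p))) = ?h S f p - poly R (t p)" for p
      by (simp add: f_def R_def poly_sum sum_distrib_left sum_subtractf right_diff_distrib ac_simps)
    ultimately have 1: "big_o G (\<lambda>p. ?h S f p - poly R (t p)) (\<lambda>p. t p ^ Suc (d + N))" by simp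
    have "big_o G (\<lambda>p. poly R' (t p) * t p ^ Suc (d + N)) (\<lambda>p. t p ^ Suc (d + N))"
      by (intro big_o_mult_bdd big_o_refl bdd_poly std_t)
    then have "big_o G (\<lambda>p. poly R (t p)) (\<lambda>p. t p ^ Suc (d + N))"
      by (simp add: R' poly_monom mult.commute)
    from big_o_add[OF 1 this] have "big_o G (?h S f) (\<lambda>p. t p ^ Suc (d + N))" by simp
    from big_o_mult[OF big_o_refl[of G "\<lambda>p. fst p ^ Suc (d + N)"] this]
    have "big_o G (\<lambda>p. fst p ^ Suc (d + N) * ?h S f p) (\<lambda>p. fst p ^ Suc (d + N) * t p ^ Suc (d + N))" .
    then obtain k where "\<forall>\<^sub>F p in G. fst p ^ Suc (d + N) * ?h S f p
        \<preceq> k * (fst p ^ Suc (d + N) * t p ^ Suc (d + N))"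
      unfolding vbig_o_def by blast
    with std_nz[of 0] have "\<forall>\<^sub>F p in G. fst p * f (fst p) (flip a S (fst p) (snd p)) \<preceq> k"
    proof eventually_elim
      case (elim p)
      have "fst p ^ m * t p ^ m = 1" for m using elim by (simp flip: power_mult_distrib)
      then have "fst p ^ Suc (d + N) * ?h S f p = fst p * f (fst p) (flip a S (fst p) (snd p))"
        "fst p ^ Suc (d + N) * t p ^ Suc (d + N) = 1"
        by (metis (no_types, lifting) mult.assoc mult.left_neutral mult.left_commute power_Suc)+
      then show ?case using elim by (simp only: mult_1_right)
    qed
    then show ?thesis unfolding vbdd_def by blast
  qed
  ultimately show ?thesis by blast
qed

end

end


section \<open>Hensel's lemma\<close>

definition henselian_ball :: "'k::field set \<Rightarrow> bool" where
  "henselian_ball B \<longleftrightarrow> (\<forall>n\<ge>1. \<exists>c. c \<noteq> 0 \<and> (\<forall>a :: nat \<Rightarrow> 'k. (\<forall>i<n. vle B (a i) c) \<longrightarrow>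
     (\<exists>x. x ^ Suc n + x ^ n + (\<Sum>i<n. a i * x ^ i) = 0)))"

text \<open>Prepares the substitution \<open>h = w / y\<close> in \<open>hensel\<close>, which
  reverses the order of the coefficients and singles out those with index 0 and 1.\<close>

lemma sum_split_reverse:
  fixes f :: "nat \<Rightarrow> 'a::comm_monoid_add"
  shows "(\<Sum>j\<le>Suc n. f j) = f 0 + f 1 + (\<Sum>i<n. f (Suc n - i))"
proof -
  have "(\<Sum>j\<le>Suc n. f j) = f 0 + (\<Sum>j\<le>n. f (Suc j))" by (rule sum.atMost_Suc_shift)
  also have "(\<Sum>j\<le>n. f (Suc j)) = f 1 + (\<Sum>j<n. f (Suc (Suc j)))"
    unfolding lessThan_Suc_atMost[symmetric] by (subst sum.lessThan_Suc_shift) simp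
  also have "(\<Sum>j<n. f (Suc (Suc j))) = (\<Sum>i<n. f (Suc (Suc (n - Suc i))))"
    by (rule sum.nat_diff_reindex[symmetric])
  also have "\<dots> = (\<Sum>i<n. f (Suc n - i))"
    by (rule sum.cong) (auto simp: Suc_diff_Suc Suc_diff_le)
  finally show ?thesis by (simp add: ac_simps)
qed

text \<open>Division by \<open>x - r\<close> with remainder. The quotient has leading coefficients 1
  and \<open>1 + r\<close>; for small \<open>r\<close>, rescaling by \<open>1 + r\<close> restores
  the shape of the original polynomial in one degree less.\<close>

lemma deflation:
  fixes x r :: "'k::field"
  shows "(x - r) * (x ^ Suc m + (1 + r) * x ^ m +
      (\<Sum>j<m. (r ^ (Suc m - j) + r ^ (m - j) + (\<Sum>k\<le>m. if j < k then a k * r ^ (k - Suc j) else 0)) * x ^ j))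
    = (x ^ Suc (Suc m) + x ^ Suc m + (\<Sum>k<Suc m. a k * x ^ k))
      - (r ^ Suc (Suc m) + r ^ Suc m + (\<Sum>k<Suc m. a k * r ^ k))"
proof -
  have 1: "x ^ k - r ^ k = (x - r) * (\<Sum>j<k. r ^ (k - Suc j) * x ^ j)" for k
    by (cases k) (simp_all add: diff_power_eq_sum mult.commute del: power_Suc)
  have 2: "(\<Sum>j<k. r ^ (k - Suc j) * x ^ j) = (\<Sum>j<m. if j < k then r ^ (k - Suc j) * x ^ j else 0)"
    if "k \<le> m" for k
  proof -
    have "{..<k} = {..<m} \<inter> {j. j < k}" using that by auto
    then show ?thesis by (simp add: sum.inter_restrict)
  qed
  have "(\<Sum>k\<le>m. a k * x ^ k) - (\<Sum>k\<le>m. a k * r ^ k) = (\<Sum>k\<le>m. a k * (x ^ k - r ^ k))"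
    by (simp add: sum_subtractf right_diff_distrib)
  also have "\<dots> = (x - r) * (\<Sum>k\<le>m. \<Sum>j<m. if j < k then a k * r ^ (k - Suc j) * x ^ j else 0)"
    unfolding sum_distrib_left
  proof (rule sum.cong[OF refl])
    fix k assume "k \<in> {..m}"
    then have k: "k \<le> m" by simp
    show "a k * (x ^ k - r ^ k) = (\<Sum>j<m. (x - r) * (if j < k then a k * r ^ (k - Suc j) * x ^ j else 0))"
      unfolding 1 2[OF k] sum_distrib_left by (rule sum.cong) auto
  qed
  also have "(\<Sum>k\<le>m. \<Sum>j<m. if j < k then a k * r ^ (k - Suc j) * x ^ j else 0)
      = (\<Sum>j<m. (\<Sum>k\<le>m. if j < k then a k * r ^ (k - Suc j) else 0) * x ^ j)"
    unfolding sum_distrib_right by (subst sum.swap) (intro sum.cong, auto)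
  finally have 3: "(\<Sum>k<Suc m. a k * x ^ k) - (\<Sum>k<Suc m. a k * r ^ k) =
      (x - r) * (\<Sum>j<m. (\<Sum>k\<le>m. if j < k then a k * r ^ (k - Suc j) else 0) * x ^ j)"
    unfolding lessThan_Suc_atMost .
  have 4: "x ^ Suc (Suc m) - r ^ Suc (Suc m) =
      (x - r) * ((\<Sum>j<m. r ^ (Suc m - j) * x ^ j) + r * x ^ m + x ^ Suc m)"
    unfolding 1[of "Suc (Suc m)"] by (simp add: Suc_diff_le cong: sum.cong)
  have 5: "x ^ Suc m - r ^ Suc m = (x - r) * ((\<Sum>j<m. r ^ (m - j) * x ^ j) + x ^ m)"
    unfolding 1[of "Suc m"] by simp
  have "(x ^ Suc (Suc m) + x ^ Suc m + (\<Sum>k<Suc m. a k * x ^ k))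
      - (r ^ Suc (Suc m) + r ^ Suc m + (\<Sum>k<Suc m. a k * r ^ k)) =
    (x ^ Suc (Suc m) - r ^ Suc (Suc m)) + (x ^ Suc m - r ^ Suc m)
      + ((\<Sum>k<Suc m. a k * x ^ k) - (\<Sum>k<Suc m. a k * r ^ k))"
    by simp
  also have "\<dots> = (x - r) * (x ^ Suc m + (1 + r) * x ^ m +
      (\<Sum>j<m. (r ^ (Suc m - j) + r ^ (m - j) + (\<Sum>k\<le>m. if j < k then a k * r ^ (k - Suc j) else 0)) * x ^ j))"
    unfolding 3 4 5 by (simp add: ring_distribs sum.distrib)
  finally show ?thesis ..
qed

context V_ball
begin

lemma null_cases:
  "null (inf F (principal S)) f \<Longrightarrow> null (inf F (principal (- S))) f \<Longrightarrow> null F f"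
  unfolding vnull_def eventually_inf_principal
proof (intro allI impI)
  fix c :: 'k
  assume *: "\<forall>c. c \<noteq> 0 \<longrightarrow> (\<forall>\<^sub>F x in F. x \<in> S \<longrightarrow> f x \<preceq> c)"
    "\<forall>c. c \<noteq> 0 \<longrightarrow> (\<forall>\<^sub>F x in F. x \<in> - S \<longrightarrow> f x \<preceq> c)" "c \<noteq> 0"
  then have "\<forall>\<^sub>F x in F. x \<in> S \<longrightarrow> f x \<preceq> c" "\<forall>\<^sub>F x in F. x \<in> - S \<longrightarrow> f x \<preceq> c" by blast+
  then show "\<forall>\<^sub>F x in F. f x \<preceq> c" by eventually_elim blast
qed

lemma null_power: "null F f \<Longrightarrow> 0 < k \<Longrightarrow> null F (\<lambda>i. f i ^ k)"
  by (cases k) (simp_all add: null_mult_bdd bdd_power null_imp_bdd)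

lemma null_power_mult_cancel:
  assumes "null F (\<lambda>i. g i ^ n * f i)" "\<forall>\<^sub>F i in F. f i \<preceq> g i"
  shows "null F f"
proof (rule null_power_cancel, rule null_bound[OF assms(1)])
  show "\<forall>\<^sub>F i in F. f i ^ Suc n \<preceq> g i ^ n * f i"
    using assms(2) by eventually_elim (simp add: mult.commute le_mult le_power)
qed

text \<open>
  The defining property of t-henselianity gives some root; if it is the wrong one, close to \<open>0\<close>, it
  is divided out.
\<close>

lemma henselian_root:
  assumes "henselian_ball B" "\<And>i. i < n \<Longrightarrow> null F (a i)"
  shows "\<exists>r. null F (\<lambda>T. r T + 1) \<and> (\<forall>\<^sub>F T in F. r T ^ Suc n + r T ^ n + (\<Sum>i<n. a i T * r T ^ i) = 0)"
  using assms(2)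
proof (induction n arbitrary: a F)
  case 0
  then show ?case by (intro exI[of _ "\<lambda>_. - 1"]) simp
next
  case (Suc m)
  let ?n = "Suc m"
  let ?p = "\<lambda>T x. x ^ Suc ?n + x ^ ?n + (\<Sum>i<?n. a i T * x ^ i)"
  obtain c where c: "c \<noteq> 0" "\<And>a. (\<forall>i<?n. a i \<preceq> c) \<Longrightarrow>
      \<exists>x. x ^ Suc ?n + x ^ ?n + (\<Sum>i<?n. a i * x ^ i) = 0"
    using assms(1) unfolding henselian_ball_def by (elim allE[of _ ?n]) auto
  define r where "r T = (SOME x. ?p T x = 0)" for T
  have "\<forall>\<^sub>F T in F. \<forall>i\<in>{..<?n}. a i T \<preceq> c"
    using Suc.prems c(1) by (intro eventually_ball_finite) (auto simp: vnull_def)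
  then have r: "\<forall>\<^sub>F T in F. ?p T (r T) = 0"
  proof eventually_elim
    case (elim T)
    then have "\<exists>x. ?p T x = 0" using c(2)[of "\<lambda>i. a i T"] by auto
    then show ?case unfolding r_def by (rule someI_ex)
  qed
  then have r': "\<forall>\<^sub>F T in F. r T ^ ?n * (r T + 1) = - (\<Sum>i<?n. a i T * r T ^ i)"
    by eventually_elim (simp add: algebra_simps eq_neg_iff_add_eq_0)
  \<comment> \<open>Separates the parameters whose root tends to 0 from those whose root tends to
    -1. Only on \<open>S\<close> does the root have to be divided out.\<close>
  define S where "S = {T. r T \<preceq> 1 \<and> r T \<preceq> r T + 1}"
  let ?F1 = "inf F (principal S)" and ?F2 = "inf F (principal (- S))"
  have small: "null F' (\<lambda>T. r T ^ ?n * (r T + 1))" if "F' \<le> F" "bdd F' r" for F'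
  proof (rule null_cong)
    show "null F' (\<lambda>T. - (\<Sum>i<?n. a i T * r T ^ i))"
      by (intro null_uminus null_sum null_mult_bdd bdd_power that null_mono[OF that(1)] Suc.prems) auto
    show "\<forall>\<^sub>F T in F'. - (\<Sum>i<?n. a i T * r T ^ i) = r T ^ ?n * (r T + 1)"
      using filter_leD[OF that(1) r'] by eventually_elim simp
  qed
  have large_root: "null ?F2 (\<lambda>T. r T + 1)"
  proof (rule null_cases[of _ "{T. r T \<preceq> 1}"])
    let ?F = "inf ?F2 (principal {T. r T \<preceq> 1})"
    have "bdd ?F r" unfolding vbdd_def by (auto simp: eventually_inf_principal intro!: exI[of _ 1])
    then have "null ?F (\<lambda>T. r T ^ ?n * (r T + 1))" by (intro small) (auto intro: le_infI1)
    moreover have "\<forall>\<^sub>F T in ?F. r T + 1 \<preceq> r T"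
      unfolding eventually_inf_principal S_def using le_total by (auto intro!: always_eventually)
    ultimately show "null ?F (\<lambda>T. r T + 1)" by (rule null_power_mult_cancel)
  next
    \<comment> \<open>Here \<open>1 / r\<close> is bounded, and dividing the equation by
      \<open>r ^ ?n\<close> expresses \<open>r + 1\<close> through products of the null coefficients
      with powers of \<open>1 / r\<close>.\<close>
    let ?F = "inf ?F2 (principal (- {T. r T \<preceq> 1}))"
    have big: "\<forall>\<^sub>F T in ?F. r T \<noteq> 0 \<and> inverse (r T) \<preceq> 1"
      unfolding eventually_inf_principal using le_total le_inverse[of 1] by (fastforce intro!: always_eventually)
    then have b: "bdd ?F (\<lambda>T. inverse (r T))"
      unfolding vbdd_def by (intro exI[of _ 1]) (auto elim: eventually_mono)
    have "null ?F (a i)" if "i < ?n" for i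
      by (rule null_mono[OF _ Suc.prems[OF that]]) (auto intro: le_infI1)
    then have "null ?F (\<lambda>T. - (\<Sum>i<?n. a i T * inverse (r T) ^ (?n - i)))"
      by (intro null_uminus null_sum null_mult_bdd bdd_power b) auto
    moreover have "\<forall>\<^sub>F T in ?F. - (\<Sum>i<?n. a i T * inverse (r T) ^ (?n - i)) = r T + 1"
      using big filter_leD[OF _ r', of ?F, OF le_infI1[OF inf_le1]]
    proof eventually_elim
      case (elim T)
      have *: "inverse (r T) ^ ?n * (a i T * r T ^ i) = a i T * inverse (r T) ^ (?n - i)" if "i < ?n" for i
      proof -
        have "inverse (r T) ^ ?n = inverse (r T) ^ (?n - i) * inverse (r T) ^ i"
          using that by (simp flip: power_add)
        moreover have "inverse (r T) ^ i * r T ^ i = 1" using elim by (simp flip: power_mult_distrib)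
        ultimately show ?thesis by (simp add: ac_simps)
      qed
      have "r T + 1 = inverse (r T) ^ ?n * (r T ^ ?n * (r T + 1))"
        using elim by (simp add: power_inverse field_simps)
      also have "\<dots> = - (\<Sum>i<?n. inverse (r T) ^ ?n * (a i T * r T ^ i))"
        using elim by (simp only: sum_distrib_left mult_minus_right)
      also have "\<dots> = - (\<Sum>i<?n. a i T * inverse (r T) ^ (?n - i))"
        using * by (intro arg_cong[where f = uminus] sum.cong) auto
      finally show ?case ..
    qed
    ultimately show "null ?F (\<lambda>T. r T + 1)" by (rule null_cong[rotated])
  qed
  have r0: "null ?F1 r"
  proof (rule null_power_mult_cancel[of _ "\<lambda>T. r T" ?n])
    have "bdd ?F1 r"
      unfolding vbdd_def S_def by (auto simp: eventually_inf_principal intro!: exI[of _ 1])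
    then have n: "null ?F1 (\<lambda>T. r T ^ ?n * (r T + 1))" by (intro small) auto
    show "null ?F1 (\<lambda>T. r T ^ ?n * r T)"
      by (rule null_bound[OF n]) (auto simp: eventually_inf_principal S_def intro!: always_eventually le_mult)
  qed (auto intro: always_eventually)
  \<comment> \<open>Coefficients of the quotient from \<open>deflation\<close> after the
    substitution \<open>x = (1 + r) * s\<close> and division by
    \<open>(1 + r) ^ Suc m\<close>.\<close>
  define b where "b j T = (r T ^ (Suc m - j) + r T ^ (m - j) +
      (\<Sum>k\<le>m. if j < k then a k T * r T ^ (k - Suc j) else 0)) * inverse (1 + r T) ^ (Suc m - j)" for j T
  have inv: "\<forall>\<^sub>F T in ?F1. 1 + r T \<noteq> 0" "bdd ?F1 (\<lambda>T. inverse (1 + r T))"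
    using bdd_inverse[of ?F1 "\<lambda>T. 1 + r T" 1] r0 by simp_all
  have rb: "bdd ?F1 r" using r0 null_imp_bdd by blast
  have "null ?F1 (b j)" if "j < m" for j
    unfolding b_def
  proof (intro null_mult_bdd null_add bdd_power inv null_sum)
    show "null ?F1 (\<lambda>T. r T ^ (Suc m - j))" "null ?F1 (\<lambda>T. r T ^ (m - j))"
      using that by (auto intro!: null_power r0)
    fix k assume k: "k \<in> {..m}"
    have "null ?F1 (a k)" by (rule null_mono[OF inf_le1 Suc.prems]) (use k in auto)
    then have "null ?F1 (\<lambda>T. a k T * r T ^ (k - Suc j))" by (intro null_mult_bdd bdd_power rb)
    then show "null ?F1 (\<lambda>T. if j < k then a k T * r T ^ (k - Suc j) else 0)"
      by (cases "j < k") simp_all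
  qed
  then have "\<exists>s. null ?F1 (\<lambda>T. s T + 1) \<and>
      (\<forall>\<^sub>F T in ?F1. s T ^ Suc m + s T ^ m + (\<Sum>i<m. b i T * s T ^ i) = 0)"
    by (rule Suc.IH)
  then obtain s where s: "null ?F1 (\<lambda>T. s T + 1)"
    "\<forall>\<^sub>F T in ?F1. s T ^ Suc m + s T ^ m + (\<Sum>i<m. b i T * s T ^ i) = 0" by blast
  define q where "q T = (if T \<in> S then (1 + r T) * s T else r T)" for T
  have "null ?F1 (\<lambda>T. (1 + r T) * (s T + 1) - r T)"
    by (intro null_diff null_mult_bdd' s bdd_add bdd_const rb r0)
  then have "null ?F1 (\<lambda>T. q T + 1)"
    by (rule null_cong[rotated])
      (auto simp: eventually_inf_principal q_def algebra_simps intro!: always_eventually)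
  moreover have "null ?F2 (\<lambda>T. q T + 1)"
    by (rule null_cong[OF _ large_root])
      (auto simp: eventually_inf_principal q_def intro!: always_eventually)
  ultimately have "null F (\<lambda>T. q T + 1)" by (rule null_cases)
  moreover have "\<forall>\<^sub>F T in F. ?p T (q T) = 0"
  proof -
    have "\<forall>\<^sub>F T in ?F1. ?p T (q T) = 0"
      using s(2) inv(1)
      unfolding eventually_inf_principal using r
    proof eventually_elim
      case (elim T)
      show ?case
      proof
        assume T: "T \<in> S"
        let ?v = "1 + r T" and ?x = "(1 + r T) * s T"
        let ?c = "\<lambda>j. r T ^ (Suc m - j) + r T ^ (m - j) +
          (\<Sum>k\<le>m. if j < k then a k T * r T ^ (k - Suc j) else 0)"
        have nz: "?v \<noteq> 0" using elim T by blast
        have tm: "?c j * ?x ^ j = ?v ^ Suc m * (b j T * s T ^ j)" if "j < m" for j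
        proof -
          have "?v ^ Suc m = ?v ^ (Suc m - j) * ?v ^ j" using that by (simp flip: power_add)
          moreover have "?v ^ (Suc m - j) * inverse ?v ^ (Suc m - j) = 1"
            using nz by (metis power_mult_distrib power_one right_inverse)
          moreover define C where "C = ?c j"
          moreover have "C * ?x ^ j = C * (?v ^ (Suc m - j) * inverse ?v ^ (Suc m - j)) * (?v ^ j * s T ^ j)"
            unfolding power_mult_distrib calculation(2) by simp
          ultimately show ?thesis unfolding b_def C_def[symmetric] by (simp only: ac_simps)
        qed
        have "?x ^ Suc m + ?v * ?x ^ m + (\<Sum>j<m. ?c j * ?x ^ j) =
            ?v ^ Suc m * (s T ^ Suc m + s T ^ m + (\<Sum>j<m. b j T * s T ^ j))"
        proof -
          have "(\<Sum>j<m. ?c j * ?x ^ j) = ?v ^ Suc m * (\<Sum>j<m. b j T * s T ^ j)"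
            unfolding sum_distrib_left by (rule sum.cong[OF refl], rule tm) simp
          moreover have "?x ^ Suc m = ?v ^ Suc m * s T ^ Suc m" by (rule power_mult_distrib)
          moreover have "?v * ?x ^ m = ?v ^ Suc m * s T ^ m"
            by (simp only: power_mult_distrib power_Suc mult.assoc)
          ultimately show ?thesis by (simp only: distrib_left)
        qed
        also have "\<dots> = 0" using elim T by simp
        finally have "?p T ?x - ?p T (r T) = 0"
          using deflation[of ?x "r T" m "\<lambda>k. a k T"] by simp
        then show "?p T (q T) = 0" using elim T by (simp add: q_def)
      qed
    qed
    then have "\<forall>\<^sub>F T in F. T \<in> S \<longrightarrow> ?p T (q T) = 0" unfolding eventually_inf_principal .
    with r show ?thesis by eventually_elim (auto simp: q_def)
  qed
  ultimately show ?case by blast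
qed

text \<open>With \<open>w = c0 / c1\<close> and \<open>h = w / y\<close>, multiplying the equation
  by \<open>y ^ Suc n / c0\<close> formally gives \<open>y ^ Suc n + y ^ n + ...\<close>, where the
  coefficient \<open>c j\<close> with \<open>j \<ge> 2\<close> has become
  \<open>c j * w ^ (j - 1) / c1\<close>. These tend to 0, so \<open>henselian_root\<close> supplies
  \<open>y\<close> near -1, and \<open>h\<close> is close to the Newton step
  \<open>- w\<close>.\<close>

lemma hensel:
  assumes H: "henselian_ball B" and deg: "\<And>T. degree (P T) \<le> Suc n"
    and c0: "null F (\<lambda>T. coeff (P T) 0)"
    and c1: "bdd F (\<lambda>T. inverse (coeff (P T) 1))" "\<forall>\<^sub>F T in F. coeff (P T) 1 \<noteq> 0"
    and cb: "\<And>j. bdd F (\<lambda>T. coeff (P T) j)"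
  shows "\<exists>h. null F h \<and> (\<forall>\<^sub>F T in F. poly (P T) (h T) = 0)"
proof -
  let ?c = "\<lambda>j T. coeff (P T) j"
  define w where "w T = ?c 0 T * inverse (?c 1 T)" for T
  have w: "null F w" unfolding w_def by (intro null_mult_bdd c0 c1)
  define d where "d j T = ?c j T * w T ^ (j - 1) * inverse (?c 1 T)" for j T
  define d' where "d' i = d (Suc n - i)" for i
  have "null F (d' i)" if "i < n" for i
    unfolding d'_def d_def
    by (rule null_mult_bdd[OF null_mult_bdd'[OF cb null_power[OF w]] c1(1)]) (use that in simp)
  then have "\<exists>y. null F (\<lambda>T. y T + 1) \<and>
      (\<forall>\<^sub>F T in F. y T ^ Suc n + y T ^ n + (\<Sum>i<n. d' i T * y T ^ i) = 0)"
    by (rule henselian_root[OF H])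
  then obtain y where y: "null F (\<lambda>T. y T + 1)"
    "\<forall>\<^sub>F T in F. y T ^ Suc n + y T ^ n + (\<Sum>i<n. d (Suc n - i) T * y T ^ i) = 0"
    unfolding d'_def by blast
  have inv: "\<forall>\<^sub>F T in F. y T \<noteq> 0" "bdd F (\<lambda>T. inverse (y T))"
    using bdd_inverse[of F y "- 1"] y(1) by simp_all
  let ?h = "\<lambda>T. w T * inverse (y T)"
  have "\<forall>\<^sub>F T in F. poly (P T) (?h T) = 0"
    using y(2) inv(1) c1(2)
  proof eventually_elim
    case (elim T)
    let ?z = "inverse (y T)"
    have c0: "?c 0 T = w T * ?c 1 T" using elim by (simp add: w_def)
    have tm: "?c (Suc n - i) T * ?h T ^ (Suc n - i) =
        w T * ?c 1 T * ?z ^ Suc n * (d (Suc n - i) T * y T ^ i)" if "i < n" for i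
    proof -
      have "?z ^ Suc n = ?z ^ (Suc n - i) * ?z ^ i" using that by (simp flip: power_add)
      moreover have "?z ^ i * y T ^ i = 1" using elim by (simp flip: power_mult_distrib)
      ultimately have zy: "?z ^ Suc n * y T ^ i = ?z ^ (Suc n - i)" by (simp add: mult.assoc)
      have "w T ^ (Suc n - i) = w T * w T ^ (Suc n - i - 1)"
        using that by (simp flip: power_Suc add: Suc_diff_le)
      then have "?c 1 T * w T * d (Suc n - i) T = ?c (Suc n - i) T * w T ^ (Suc n - i)"
        using elim by (simp add: d_def)
      then have *: "?c (Suc n - i) T * w T ^ (Suc n - i) = ?c 1 T * w T * d (Suc n - i) T" ..
      have "?c (Suc n - i) T * ?h T ^ (Suc n - i) = ?c (Suc n - i) T * w T ^ (Suc n - i) * ?z ^ (Suc n - i)"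
        by (simp only: power_mult_distrib mult.assoc)
      also have "\<dots> = ?c 1 T * w T * d (Suc n - i) T * (?z ^ Suc n * y T ^ i)"
        unfolding * zy ..
      finally show ?thesis by (simp only: ac_simps)
    qed
    have "poly (P T) (?h T) = (\<Sum>j\<le>Suc n. ?c j T * ?h T ^ j)"
    proof -
      have "poly (P T) (?h T) = poly (\<Sum>j\<le>Suc n. monom (?c j T) j) (?h T)"
        by (simp only: poly_as_sum_of_monoms'[OF deg])
      then show ?thesis by (simp only: poly_sum poly_monom)
    qed
    also have "\<dots> = ?c 0 T + ?c 1 T * ?h T + (\<Sum>i<n. ?c (Suc n - i) T * ?h T ^ (Suc n - i))"
      by (subst sum_split_reverse) simp
    also have "\<dots> = w T * ?c 1 T * ?z ^ Suc n *
        (y T ^ Suc n + y T ^ n + (\<Sum>i<n. d (Suc n - i) T * y T ^ i))"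
    proof -
      have 1: "?z ^ Suc n * y T ^ Suc n = 1" using elim by (metis left_inverse power_mult_distrib power_one)
      have "?z ^ n * y T ^ n = 1" using elim by (metis left_inverse power_mult_distrib power_one)
      then have "?z ^ Suc n * y T ^ n = ?z" by (simp add: mult.assoc)
      with 1 have "w T * ?c 1 T * ?z ^ Suc n * (y T ^ Suc n + y T ^ n) = w T * ?c 1 T * (1 + ?z)"
        by (simp only: ring_distribs mult.assoc)
      also have "\<dots> = ?c 0 T + ?c 1 T * ?h T" unfolding c0 by (simp add: algebra_simps)
      finally show ?thesis
        by (simp only: distrib_left[of _ _ "sum _ _"] sum_distrib_left) (simp add: tm)
    qed
    finally show ?case using elim by simp
  qed
  moreover have "null F ?h" by (intro null_mult_bdd w inv)
  ultimately show ?thesis by blast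
qed

text \<open>As \<open>x * (x + 1) = w\<close> is small, one of the factors is
  \<open>\<preceq> c\<close>; if it is \<open>x + 1\<close>, the other root \<open>- (x + 1)\<close>
  is taken.\<close>

lemma small_root:
  assumes "henselian_ball B" "c \<noteq> 0"
  shows "\<exists>k. k \<noteq> 0 \<and> (\<forall>w. w \<preceq> k \<longrightarrow> (\<exists>x. x\<^sup>2 + x = w \<and> x \<preceq> c))"
proof -
  obtain d where d: "d \<noteq> 0" "\<And>a. a 0 \<preceq> d \<Longrightarrow> \<exists>x. x ^ Suc 1 + x ^ 1 + (\<Sum>i<1. a i * x ^ i) = 0"
    using assms(1) unfolding henselian_ball_def by (elim allE[of _ 1]) auto
  obtain k' where k': "k' \<noteq> 0" "\<not> c\<^sup>2 \<preceq> 1 * k'" using not_le_one_mult[of "c\<^sup>2" 1] assms(2) by auto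
  obtain k where k: "k \<noteq> 0" "k \<preceq> d" "k \<preceq> k'" using ex_lower[OF d(1) k'(1)] by blast
  have "\<exists>x. x\<^sup>2 + x = w \<and> x \<preceq> c" if "w \<preceq> k" for w
  proof -
    have "- w \<preceq> d" using that k(2) le_trans by (auto intro: le_trans)
    then obtain x where x: "x\<^sup>2 + x = w"
      using d(2)[of "\<lambda>_. - w"] by (auto simp: power2_eq_square)
    have "x \<preceq> c \<or> x + 1 \<preceq> c"
    proof (rule ccontr)
      assume "\<not> (x \<preceq> c \<or> x + 1 \<preceq> c)"
      then have "c * c \<preceq> x * (x + 1)" using le_total by (intro le_mult) auto
      then have "c\<^sup>2 \<preceq> w" using x by (simp add: power2_eq_square algebra_simps)
      then show False using le_trans[OF _ le_trans[OF that k(3)]] k'(2) by simp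
    qed
    moreover have "(- (x + 1))\<^sup>2 + - (x + 1) = w" using x by (simp add: power2_eq_square algebra_simps)
    moreover have "- (x + 1) \<preceq> c" if "x + 1 \<preceq> c" using that le_uminus_iff by blast
    ultimately show ?thesis using x by blast
  qed
  then show ?thesis using k(1) by blast
qed

end


section \<open>Solving equations on the curve\<close>

text \<open>Polynomials in \<open>T\<close> and \<open>h\<close>, with \<open>T\<close> as the outer
  variable: specialising \<open>T\<close> leaves a polynomial in \<open>h\<close> whose degree is
  bounded uniformly and whose coefficients are polynomials in \<open>T\<close>, as
  \<open>hensel\<close> requires for a family.\<close>

definition tpolys :: "('k::field \<times> 'k \<Rightarrow> 'k) set" where
  "tpolys = {(\<lambda>p. poly (poly P [:fst p:]) (snd p)) | P. True}"

lemma tpolysI: "(\<And>T h. f (T, h) = poly (poly P [:T:]) h) \<Longrightarrow> f \<in> tpolys"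
  unfolding tpolys_def by (auto intro!: exI[of _ P])

lemma fun_ring_tpolys: "fun_ring (tpolys :: ('k::field \<times> 'k \<Rightarrow> 'k) set)"
  unfolding fun_ring_def
proof (intro conjI ballI)
  show "(\<lambda>_. 0) \<in> (tpolys :: ('k \<times> 'k \<Rightarrow> 'k) set)" by (rule tpolysI[of _ 0]) simp
  fix f :: "'k \<times> 'k \<Rightarrow> 'k" assume "f \<in> tpolys"
  then obtain P where P: "f = (\<lambda>p. poly (poly P [:fst p:]) (snd p))" by (auto simp: tpolys_def)
  show "(\<lambda>p. - f p) \<in> tpolys" by (rule tpolysI[of _ "- P"]) (simp add: P)
  fix g :: "'k \<times> 'k \<Rightarrow> 'k" assume "g \<in> tpolys"
  then obtain P' where P': "g = (\<lambda>p. poly (poly P' [:fst p:]) (snd p))" by (auto simp: tpolys_def)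
  show "(\<lambda>p. f p + g p) \<in> tpolys" by (rule tpolysI[of _ "P + P'"]) (simp add: P P')
  show "(\<lambda>p. f p * g p) \<in> tpolys" by (rule tpolysI[of _ "P * P'"]) (simp add: P P')
qed

lemma linear_tpolys: "(\<lambda>p. (u + snd p) - c) \<in> tpolys"
  by (rule tpolysI[of _ "[:[:u - c, 1:]:]"]) simp

lemma coeff_tpoly: "\<exists>q. \<forall>T. coeff (poly P [:T:]) j = poly q T"
proof (induction P)
  case 0
  then show ?case by (auto intro: exI[of _ 0])
next
  case (pCons p P)
  then obtain q where "\<And>T. coeff (poly P [:T:]) j = poly q T" by blast
  then show ?case by (auto intro!: exI[of _ "pCons (coeff p j) q"])
qed

lemma degree_tpoly: "\<exists>N. \<forall>T. degree (poly P [:T:]) \<le> N"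
proof (induction P)
  case 0
  then show ?case by (auto intro: exI[of _ 0])
next
  case (pCons p P)
  then obtain N where N: "\<And>T. degree (poly P [:T:]) \<le> N" by blast
  have "degree (poly (pCons p P) [:T:]) \<le> max (degree p) N" for T
    using N[of T] degree_smult_le[of T "poly P [:T:]"] by (auto intro!: degree_add_le)
  then show ?case by blast
qed

lemma ext_lift:
  fixes f :: "'k::field \<Rightarrow> (nat \<Rightarrow> 'k) \<Rightarrow> 'k"
  shows "f \<in> ext (range poly) n \<Longrightarrow> (\<lambda>p z. f (u + snd p) z) \<in> ext tpolys n"
proof (induction n arbitrary: f)
  case 0
  then obtain p where p: "f = (\<lambda>u z. poly p u)" by auto
  have "(\<lambda>x :: 'k \<times> 'k. poly p (u + snd x)) \<in> tpolys"
    by (rule tpolysI[of _ "[:pcompose p [:u, 1:]:]"]) (simp add: poly_pcompose)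
  then show ?case unfolding p by auto
next
  case (Suc n)
  then obtain f0 f1 where eq: "f = (\<lambda>p z. f0 p z + f1 p z * z n)"
    and m: "f0 \<in> ext (range poly) n" "f1 \<in> ext (range poly) n" by auto
  show ?case by (rule ext_SucI[OF Suc.IH[OF m(1)] Suc.IH[OF m(2)]]) (simp add: eq)
qed

section \<open>Local analysis near a finite point of the curve\<close>

context V_ball
begin

lemma ex_upper_finite: "finite S \<Longrightarrow> \<exists>M. \<forall>s\<in>S. s \<preceq> M"
proof (induction S rule: finite_induct)
  case (insert x S)
  then obtain M where M: "\<forall>s\<in>S. s \<preceq> M" by blast
  obtain M' where "x \<preceq> M'" "M \<preceq> M'" using ex_upper by blast
  then show ?case using M le_trans by (intro exI[of _ M']) blast
qed simp

lemma infinite_not_le: "infinite {u. \<not> u \<preceq> M}"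
proof
  assume "finite {u. \<not> u \<preceq> M}"
  then obtain M' where M': "\<forall>s\<in>{u. \<not> u \<preceq> M}. s \<preceq> M'" using ex_upper_finite by blast
  obtain M'' where "M \<preceq> M''" "M' \<preceq> M''" using ex_upper by blast
  moreover obtain u where "\<not> u \<preceq> M''" using ex_not_le by blast
  ultimately show False using M' le_trans by blast
qed

lemma le_diff_cancel: "x - y \<preceq> c \<Longrightarrow> y \<preceq> c \<Longrightarrow> x \<preceq> e * c"
  using le_add[of "x - y" c y] by simp

lemma ex_far:
  fixes a :: "nat \<Rightarrow> 'k"
  assumes "k \<noteq> 0"
  shows "\<exists>M. \<forall>u. \<not> u \<preceq> M \<longrightarrow> (\<forall>i<n. u \<noteq> a i \<and> inverse (u - a i) \<preceq> k)"
proof -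
  obtain M where M: "\<forall>s\<in>insert (inverse k) (a ` {..<n}). s \<preceq> M"
    using ex_upper_finite[of "insert (inverse k) (a ` {..<n})"] by blast
  have "u \<noteq> a i \<and> inverse (u - a i) \<preceq> k" if "\<not> u \<preceq> e * M" "i < n" for u i
  proof -
    have "\<not> u - a i \<preceq> M" using le_diff_cancel[of u "a i" M] M that by blast
    then have *: "\<not> u - a i \<preceq> inverse k" using M le_trans by blast
    then have "inverse k \<preceq> u - a i" "u \<noteq> a i" using le_total by auto
    then show ?thesis using le_inverse[of "inverse k" "u - a i"] assms by auto
  qed
  then show ?thesis by blast
qed

definition near0 :: "'k filter" where
  "near0 = (INF c\<in>- {0}. principal {h. h \<preceq> c})"

lemma eventually_near0: "eventually P near0 \<longleftrightarrow> (\<exists>c. c \<noteq> 0 \<and> (\<forall>h. h \<preceq> c \<longrightarrow> P h))"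
  unfolding near0_def
proof (subst eventually_INF_base)
  show "- {0} \<noteq> ({} :: 'k set)" by (metis ComplI empty_iff singletonD zero_neq_one)
  fix c c' :: 'k assume "c \<in> - {0}" "c' \<in> - {0}"
  then obtain d where "d \<noteq> 0" "d \<preceq> c" "d \<preceq> c'" using ex_lower[of c c'] by auto
  then show "\<exists>x\<in>- {0}. principal {h. h \<preceq> x} \<le> inf (principal {h. h \<preceq> c}) (principal {h. h \<preceq> c'})"
    using le_trans by (intro bexI[of _ d]) auto
qed (auto simp: eventually_principal)

lemma null_near0: "null near0 (\<lambda>h. h)"
  unfolding vnull_def eventually_near0 by blast

lemma filterlim_near0: "null F h \<Longrightarrow> filterlim h near0 F"
  unfolding filterlim_iff
proof (intro allI impI)
  fix P assume h: "null F h" and "eventually P near0"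
  then obtain c where c: "c \<noteq> 0" "\<And>h. h \<preceq> c \<Longrightarrow> P h" unfolding eventually_near0 by blast
  then have "\<forall>\<^sub>F i in F. h i \<preceq> c" using h unfolding vnull_def by blast
  then show "\<forall>\<^sub>F i in F. P (h i)" by eventually_elim (rule c)
qed

lemma punctured_near0: "inf near0 (principal (- {0})) \<noteq> bot"
  unfolding trivial_limit_def eventually_inf_principal eventually_near0 by auto

lemma bdd_filterlim: "bdd F f \<Longrightarrow> filterlim g F F' \<Longrightarrow> bdd F' (\<lambda>i. f (g i))"
  unfolding vbdd_def using eventually_compose_filterlim by blast

lemma null_filterlim: "null F f \<Longrightarrow> filterlim g F F' \<Longrightarrow> null F' (\<lambda>i. f (g i))"
  unfolding vnull_def using eventually_compose_filterlim by blast

lemma null_diff_imp_bdd: "null F (\<lambda>i. f i - c) \<Longrightarrow> bdd F f"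
  using bdd_add[OF null_imp_bdd bdd_const, of F "\<lambda>i. f i - c" c] by simp

lemma null_diff_mult:
  assumes "null F (\<lambda>i. f i - c)" "null F (\<lambda>i. g i - d)"
  shows "null F (\<lambda>i. f i * g i - c * d)"
proof -
  have "null F (\<lambda>i. (f i - c) * g i + c * (g i - d))"
    by (intro null_add null_mult_bdd null_mult_bdd' assms null_diff_imp_bdd[OF assms(2)] bdd_const)
  then show ?thesis by (simp add: algebra_simps)
qed

lemma null_diff_prod:
  "(\<And>S. S \<in> A \<Longrightarrow> null F (\<lambda>i. f S i - c S)) \<Longrightarrow> null F (\<lambda>i. (\<Prod>S\<in>A. f S i) - (\<Prod>S\<in>A. c S))"
  by (induction A rule: infinite_finite_induct) (simp_all add: null_diff_mult)

text \<open>Integrality of the coordinates: dividing by \<open>z\<close> gives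
  \<open>z = d * (1 / z - 1)\<close>, where the second factor is bounded unless
  \<open>z \<preceq> 1\<close>.\<close>

lemma root_bound:
  assumes "z\<^sup>2 = d * (1 - z)" shows "z \<preceq> 1 \<or> z \<preceq> e * d"
proof (cases "z \<preceq> 1")
  case False
  then have nz: "z \<noteq> 0" and "inverse z \<preceq> 1" using le_total[of z 1] le_inverse[of 1 z] by auto
  then have *: "inverse z - 1 \<preceq> e * 1" using le_add[of "inverse z" 1 "- 1"] by simp
  have "z = d * (inverse z - 1)"
    using assms nz by (simp add: field_simps power2_eq_square)
  then show ?thesis using le_mult_left[OF *, of d] by (simp add: mult.commute)
qed simp

lemma bdd_ext:
  assumes "f \<in> ext (range poly) n" "bdd F u" "\<And>i. i < n \<Longrightarrow> bdd F (\<lambda>j. z j i)"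
  shows "bdd F (\<lambda>j. f (u j) (z j))"
  using assms(1,3)
proof (induction n arbitrary: f)
  case 0
  then show ?case using bdd_poly[OF assms(2)] by auto
next
  case (Suc n)
  then obtain f0 f1 where "f = (\<lambda>p z. f0 p z + f1 p z * z n)"
    "f0 \<in> ext (range poly) n" "f1 \<in> ext (range poly) n" by auto
  then show ?case using Suc.IH[of f0] Suc.IH[of f1] Suc.prems(2) by (auto intro!: bdd_add bdd_mult)
qed

text \<open>Subtracting the two equations gives \<open>z = z0 + h * (1 - z0) / ?D\<close>, where
  \<open>?D\<close> tends to the derivative \<open>2 * z0 + d\<close>. The reciprocal of
  \<open>?D\<close> satisfies an identity of the same kind with a factor \<open>h\<close>, which is
  iterated.\<close>

lemma expands_near_coord:
  assumes curve: "\<forall>\<^sub>F h in near0. (z h)\<^sup>2 = (d + h) * (1 - z h)" and z0: "z0\<^sup>2 = d * (1 - z0)"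
    and lim: "null near0 (\<lambda>h. z h - z0)" and nz: "2 * z0 + d \<noteq> 0"
  shows "expands near0 (\<lambda>h. h) r z"
proof -
  let ?D = "\<lambda>h. z h + z0 + (d + h)" and ?\<delta> = "2 * z0 + d"
  have t: "bdd near0 (\<lambda>h. h)" using null_near0 null_imp_bdd by blast
  have "null near0 (\<lambda>h. (z h - z0) + h)" by (intro null_add lim null_near0)
  then have "null near0 (\<lambda>h. ?D h - ?\<delta>)" by (simp add: algebra_simps)
  note inv = bdd_inverse[OF this nz]
  have z: "\<forall>\<^sub>F h in near0. z0 + h * ((1 - z0) * inverse (?D h)) = z h"
    using curve inv(1)
  proof eventually_elim
    case (elim h)
    have "(z h - z0) * ?D h = ((z h)\<^sup>2 + (d + h) * z h) - (z0\<^sup>2 + d * z0) - h * z0"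
      by (simp add: algebra_simps power2_eq_square)
    also have "\<dots> = h * (1 - z0)" unfolding elim(1) z0 by (simp add: algebra_simps)
    finally show ?case using elim(2) by (simp add: field_simps)
  qed
  have "expands near0 (\<lambda>h. h) r (\<lambda>h. inverse (?D h))"
  proof (induction r)
    case 0
    then show ?case using inv(2) by (intro expands_big_o) (simp add: bdd_iff_big_o)
  next
    case (Suc r)
    have aux: "inverse c - h * (w * inverse b * inverse c) = inverse b"
      if "b = c + h * w" "b \<noteq> 0" "c \<noteq> 0" for b c h w :: 'k
    proof -
      have "inverse c = inverse c * (b * inverse b)" using that by simp
      then have "inverse c - h * (w * inverse b * inverse c) = inverse b * (inverse c * (b - h * w))"
        by (simp add: algebra_simps)
      then show ?thesis using that by simp
    qed
    let ?E = "\<lambda>h. ((1 - z0) * inverse (?D h) + 1) * inverse (?D h) * inverse ?\<delta>"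
    have "expands near0 (\<lambda>h. h) (Suc r) (\<lambda>h. inverse ?\<delta> - h * ?E h)"
      by (intro expands_diff expands_const expands_Suc expands_mult[OF t] expands_add Suc)
    moreover have "\<forall>\<^sub>F h in near0. inverse ?\<delta> - h * ?E h = inverse (?D h)"
      using z inv(1)
    proof eventually_elim
      case (elim h)
      have "?D h = ?\<delta> + h * ((1 - z0) * inverse (?D h) + 1)"
        using elim(1) by (simp add: algebra_simps)
      then show ?case using aux elim(2) nz by blast
    qed
    ultimately show ?case by (rule expands_cong[rotated])
  qed
  then show ?thesis
    by (intro expands_cong[OF z] expands_add expands_const expands_mult[OF t] expands_id)
qed

lemma expands_near_ext:
  assumes "f \<in> ext (range poly) n" "\<And>i. i < n \<Longrightarrow> expands near0 (\<lambda>h. h) r (\<lambda>h. z h i)"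
  shows "expands near0 (\<lambda>h. h) r (\<lambda>h. f (u0 + h) (flip a S (u0 + h) (z h)))"
  using assms
proof (induction n arbitrary: f)
  case 0
  then obtain p where p: "f = (\<lambda>u z. poly p u)" by auto
  have "expands near0 (\<lambda>h. h) r (\<lambda>h. poly (pcompose p [:u0, 1:]) h)" by (rule expands_poly)
  then show ?case by (simp add: p poly_pcompose)
next
  case (Suc n)
  then obtain f0 f1 where eq: "f = (\<lambda>p z. f0 p z + f1 p z * z n)"
    and m: "f0 \<in> ext (range poly) n" "f1 \<in> ext (range poly) n" by auto
  have t: "bdd near0 (\<lambda>h. h)" using null_near0 null_imp_bdd by blast
  have "expands near0 (\<lambda>h. h) r (\<lambda>h. flip a S (u0 + h) (z h) n)"
    unfolding flip_def using Suc.prems(2)[of n]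
    by (cases "n \<in> S") (simp_all only: if_True if_False,
      (intro expands_diff expands_uminus expands_add expands_const expands_id; simp)+)
  then show ?case
    unfolding eq using Suc.IH[OF m(1)] Suc.IH[OF m(2)] Suc.prems(2)
    by (intro expands_add expands_mult[OF t]) auto
qed

text \<open>The filter \<open>near0\<close> is not punctured: the error bound also holds at
  \<open>h = 0\<close>, where it forces \<open>f 0 = poly S 0\<close>.\<close>

lemma expands_near_at_0: "expands near0 (\<lambda>h. h) (Suc r) f \<Longrightarrow> null near0 (\<lambda>h. f h - f 0)"
proof -
  assume "expands near0 (\<lambda>h. h) (Suc r) f"
  then obtain S where S: "big_o near0 (\<lambda>h. f h - poly S h) (\<lambda>h. h ^ Suc r)"
    unfolding expands_def by blast
  then obtain c d where d: "d \<noteq> 0" "\<And>h. h \<preceq> d \<Longrightarrow> f h - poly S h \<preceq> c * h ^ Suc r"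
    unfolding vbig_o_def eventually_near0 by blast
  then have f0: "f 0 = poly S 0" using d(2)[of 0] by simp
  have "null near0 (\<lambda>h. h ^ Suc r)" using null_power[OF null_near0] by blast
  then have 1: "null near0 (\<lambda>h. f h - poly S h)" using null_big_o[OF _ S] by blast
  have "null near0 (\<lambda>h. h - 0)" using null_near0 by simp
  from null_add[OF 1 null_poly_diff[OF this, of S]] show ?thesis by (simp add: f0)
qed

text \<open>
  The norm turns \<open>g = T\<close> into a polynomial equation in \<open>h\<close> that depends polynomially on \<open>T\<close> and has
  the simple root \<open>0\<close> at \<open>T = g u0 (z 0)\<close>.
\<close>

lemma solve_near:
  fixes a :: "nat \<Rightarrow> 'k" and T :: "'i \<Rightarrow> 'k"
  assumes H: "henselian_ball B"
    and curve: "\<forall>\<^sub>F h in near0. on_curve a n (u0 + h) (z h)"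
    and coord: "\<And>i r. i < n \<Longrightarrow> expands near0 (\<lambda>h. h) r (\<lambda>h. z h i)"
    and g: "g \<in> ext (range poly) n"
    and S: "big_o near0 (\<lambda>h. g (u0 + h) (z h) - poly S h) (\<lambda>h. h ^ 2)" "coeff S 1 \<noteq> 0"
    and sep: "\<And>S. S \<subseteq> {..<n} \<Longrightarrow> S \<noteq> {} \<Longrightarrow> g u0 (flip a S u0 (z 0)) \<noteq> g u0 (z 0)"
    and T: "null F (\<lambda>i. T i - g u0 (z 0))"
  shows "\<exists>h. null F h \<and> (\<forall>\<^sub>F i in F. g (u0 + h i) (z (h i)) = T i)"
proof -
  let ?c = "g u0 (z 0)"
  let ?g = "\<lambda>S h. g (u0 + h) (flip a S (u0 + h) (z h))"
  have lim: "null near0 (\<lambda>h. ?g S h - g u0 (flip a S u0 (z 0)))" for S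
  proof -
    have "expands near0 (\<lambda>h. h) (Suc 0) (?g S)" by (rule expands_near_ext[OF g coord])
    from expands_near_at_0[OF this] show ?thesis by simp
  qed
  have "(\<lambda>p z. g (u0 + snd p) z + - fst p) \<in> ext tpolys n"
  proof (rule ext_add_ring[OF fun_ring_tpolys linear_tpolys ext_lift[OF g]])
    show "(\<lambda>p z. - fst p) \<in> ext (tpolys :: ('k \<times> 'k \<Rightarrow> 'k) set) n"
    proof (rule ext_base)
      show "(\<lambda>_. 0) \<in> (tpolys :: ('k \<times> 'k \<Rightarrow> 'k) set)" by (rule tpolysI[of _ 0]) simp
      show "(\<lambda>p. - fst p) \<in> (tpolys :: ('k \<times> 'k \<Rightarrow> 'k) set)"
        by (rule tpolysI[of _ "[:0, -1:]"]) simp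
    qed
  qed
  from ext_norm[where v = "\<lambda>p. u0 + snd p" and a = a, OF fun_ring_tpolys linear_tpolys this]
  obtain P where P: "\<And>T h z. on_curve a n (u0 + h) z \<Longrightarrow>
      (\<Prod>S\<in>Pow {..<n}. g (u0 + h) (flip a S (u0 + h) z) - T) = poly (poly P [:T:]) h"
    unfolding tpolys_def by fastforce
  let ?F = "\<lambda>T. poly P [:T:]"
  have PF: "\<forall>\<^sub>F h in near0. poly (?F t) h = (\<Prod>S\<in>Pow {..<n}. ?g S h - t)" for t
    using curve by eventually_elim (simp add: P)
  have c0: "coeff (?F ?c) 0 = 0"
  proof -
    have "poly (?F ?c) 0 = (\<Prod>S\<in>Pow {..<n}. ?g S 0 - ?c)"
      using PF[of ?c] zero_le unfolding eventually_near0 by blast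
    also have "\<dots> = 0" by (rule prod_zero) (auto intro!: bexI[of _ "{}"])
    finally show ?thesis by (simp add: poly_0_coeff_0)
  qed
  define R where "R = (\<Prod>S\<in>Pow {..<n} - {{}}. g u0 (flip a S u0 (z 0)) - ?c)"
  have "R \<noteq> 0" unfolding R_def using sep by auto
  \<comment> \<open>The factor for the empty set has linear coefficient \<open>coeff S 1\<close>,
    and the remaining factors tend to \<open>R\<close>. Dividing by \<open>h\<close> takes place in
    a punctured neighbourhood, where the limits can be compared.\<close>
  have c1: "coeff (?F ?c) 1 = coeff S 1 * R"
  proof -
    obtain F1 where F1: "?F ?c = pCons 0 F1"
      using c0 by (metis coeff_pCons_0 pCons_cases)
    obtain s0 S1 where S1: "S = pCons s0 S1" by (rule pCons_cases)
    let ?N = "inf near0 (principal (- {0}))"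
    obtain k d where kd: "d \<noteq> 0" "\<And>h. h \<preceq> d \<Longrightarrow> g (u0 + h) (z h) - poly S h \<preceq> k * h ^ 2"
      using S(1) unfolding vbig_o_def eventually_near0 by blast
    have s0: "s0 = ?c" using kd(2)[of 0] by (simp add: S1)
    let ?k = "\<lambda>h. (?g {} h - ?c) / h"
    have nN: "null ?N (\<lambda>h. h)" by (rule null_mono[OF inf_le1 null_near0])
    have "null ?N (\<lambda>h. ?k h - poly S1 h)"
    proof (rule null_big_o[OF nN])
      have "\<forall>\<^sub>F h in ?N. ?k h - poly S1 h \<preceq> k * h"
        unfolding eventually_inf_principal eventually_near0
      proof (intro exI[of _ d] conjI allI impI)
        fix h assume h: "h \<preceq> d" "h \<in> - {0}"
        have "h * (?k h - poly S1 h) = g (u0 + h) (z h) - poly S h"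
        proof -
          have "h * ?k h = ?g {} h - ?c" using h(2) by (simp only: times_divide_eq_right) simp
          then show ?thesis by (simp only: right_diff_distrib) (simp add: S1 s0)
        qed
        then have "h * (?k h - poly S1 h) \<preceq> h * (k * h)"
          using kd(2)[OF h(1)] by (simp add: power2_eq_square ac_simps)
        then show "?k h - poly S1 h \<preceq> k * h" using le_mult_cancel h(2) by blast
      qed (rule kd)
      then show "big_o ?N (\<lambda>h. ?k h - poly S1 h) (\<lambda>h. h)" unfolding vbig_o_def by blast
    qed
    moreover have "null ?N (\<lambda>h. poly S1 h - poly S1 0)" using null_poly_diff[of ?N "\<lambda>h. h" 0] nN by simp
    ultimately have "null ?N (\<lambda>h. (?k h - poly S1 h) + (poly S1 h - poly S1 0))" by (rule null_add)
    then have kl: "null ?N (\<lambda>h. ?k h - poly S1 0)" by simp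
    have "null ?N (\<lambda>h. (\<Prod>S\<in>Pow {..<n} - {{}}. ?g S h - ?c) - R)"
      unfolding R_def by (rule null_diff_prod) (use null_mono[OF inf_le1 lim] in simp)
    from null_diff_mult[OF kl this]
    have 1: "null ?N (\<lambda>h. ?k h * (\<Prod>S\<in>Pow {..<n} - {{}}. ?g S h - ?c) - poly S1 0 * R)" .
    have "\<forall>\<^sub>F h in ?N. ?k h * (\<Prod>S\<in>Pow {..<n} - {{}}. ?g S h - ?c) - poly S1 0 * R = poly F1 h - poly S1 0 * R"
      unfolding eventually_inf_principal using PF[of ?c]
    proof eventually_elim
      case (elim h)
      show ?case
      proof
        assume "h \<in> - {0}"
        have "h * poly F1 h = (?g {} h - ?c) * (\<Prod>S\<in>Pow {..<n} - {{}}. ?g S h - ?c)"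
          using elim unfolding F1 by (simp add: prod.remove[of "Pow {..<n}" "{}"])
        then show "?k h * (\<Prod>S\<in>Pow {..<n} - {{}}. ?g S h - ?c) - poly S1 0 * R = poly F1 h - poly S1 0 * R"
          using \<open>h \<in> - {0}\<close> by (simp add: field_simps)
      qed
    qed
    from null_cong[OF this 1] have "null ?N (\<lambda>h. poly F1 h - poly S1 0 * R)" .
    moreover have "null ?N (\<lambda>h. poly F1 h - poly F1 0)" using null_poly_diff[of ?N "\<lambda>h. h" 0] nN by simp
    ultimately have "null ?N (\<lambda>h. (poly F1 h - poly S1 0 * R) - (poly F1 h - poly F1 0))" by (rule null_diff)
    then have "poly F1 0 = poly S1 0 * R" using null_const_iff[OF punctured_near0] by simp
    then show ?thesis by (simp add: F1 S1 poly_0_coeff_0)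
  qed
  obtain N where N: "\<And>T. degree (?F T) \<le> N" using degree_tpoly by blast
  have coeff: "null F (\<lambda>i. coeff (?F (T i)) j - coeff (?F ?c) j)" for j
  proof -
    obtain q where q: "\<And>T. coeff (?F T) j = poly q T" using coeff_tpoly by blast
    show ?thesis unfolding q by (rule null_poly_diff[OF T])
  qed
  have "\<exists>h. null F h \<and> (\<forall>\<^sub>F i in F. poly (?F (T i)) (h i) = 0)"
  proof (rule hensel[OF H])
    show "degree (?F (T i)) \<le> Suc N" for i using N[of "T i"] by simp
    show "null F (\<lambda>i. coeff (?F (T i)) 0)" using coeff[of 0] c0 by simp
    have "coeff (?F ?c) 1 \<noteq> 0" using c1 S(2) \<open>R \<noteq> 0\<close> by simp
    from bdd_inverse[OF coeff this]
    show "bdd F (\<lambda>i. inverse (coeff (?F (T i)) 1))" "\<forall>\<^sub>F i in F. coeff (?F (T i)) 1 \<noteq> 0" by blast+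
    show "bdd F (\<lambda>i. coeff (?F (T i)) j)" for j by (rule null_diff_imp_bdd[OF coeff])
  qed
  then obtain h where h: "null F h" "\<forall>\<^sub>F i in F. poly (?F (T i)) (h i) = 0" by blast
  note lim_h = filterlim_near0[OF h(1)]
  \<comment> \<open>A root of the norm only makes some conjugate equal to \<open>T\<close>. By
    \<open>sep\<close> the proper conjugates have limits different from that of \<open>T\<close>,
    which leaves \<open>g\<close> itself.\<close>
  have ne: "\<forall>\<^sub>F i in F. \<forall>S\<in>Pow {..<n} - {{}}. ?g S (h i) \<noteq> T i"
  proof (intro eventually_ball_finite ballI)
    fix S assume S: "S \<in> Pow {..<n} - {{}}"
    have "null F (\<lambda>i. (?g S (h i) - g u0 (flip a S u0 (z 0))) - (T i - ?c))"
      by (intro null_diff null_filterlim[OF lim lim_h] T)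
    then have "null F (\<lambda>i. (?g S (h i) - T i) - (g u0 (flip a S u0 (z 0)) - ?c))"
      by (simp add: algebra_simps)
    from bdd_inverse(1)[OF this] show "\<forall>\<^sub>F i in F. ?g S (h i) \<noteq> T i" using sep[of S] S by simp
  qed simp
  have "\<forall>\<^sub>F i in F. on_curve a n (u0 + h i) (z (h i))"
    using eventually_compose_filterlim[OF curve lim_h] .
  with ne h(2) have "\<forall>\<^sub>F i in F. g (u0 + h i) (z (h i)) = T i"
  proof eventually_elim
    case (elim i)
    from elim(2) P[OF elim(3), of "T i"] have "(\<Prod>S\<in>Pow {..<n}. ?g S (h i) - T i) = 0" by simp
    then obtain S where "S \<in> Pow {..<n}" "?g S (h i) = T i" by (auto simp: prod_zero_iff)
    then show ?case using elim(1) by (cases "S = {}") auto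
  qed
  then show ?thesis using h(1) by blast
qed

end


section \<open>Simultaneous approximation\<close>

text \<open>\<open>\<xi>\<close> chooses the small root of \<open>x\<^sup>2 + x = w\<close>. The
  bound \<open>c_small\<close> keeps \<open>x + y + 1\<close> away from 0 for all
  \<open>x, y \<preceq> c\<close>, which makes small roots unique, simple and continuous in
  \<open>w\<close>.\<close>

locale root_function = V_ball +
  fixes \<xi> :: "'a \<Rightarrow> 'a" and k c :: 'a
  assumes k_nz: "k \<noteq> 0" and c_nz: "c \<noteq> 0" and c_small: "\<not> vle B 1 (e * (e * c))"
    and root: "vle B w k \<Longrightarrow> (\<xi> w)\<^sup>2 + \<xi> w = w" and root_le: "vle B w k \<Longrightarrow> vle B (\<xi> w) c"
begin

definition far :: "(nat \<Rightarrow> 'a) \<Rightarrow> nat \<Rightarrow> 'a \<Rightarrow> bool" where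
  "far a n u \<longleftrightarrow> (\<forall>i<n. u \<noteq> a i \<and> inverse (u - a i) \<preceq> k)"

definition coord :: "(nat \<Rightarrow> 'a) \<Rightarrow> 'a \<Rightarrow> nat \<Rightarrow> 'a" where
  "coord a u i = (u - a i) * \<xi> (inverse (u - a i))"

text \<open>Otherwise \<open>1 = (x + y + 1) - (x + y)\<close> would be
  \<open>\<preceq> e * (e * c)\<close>.\<close>

lemma sum_bounded_below:
  assumes "x \<preceq> c" "y \<preceq> c" shows "e * c \<preceq> x + y + 1"
proof (rule ccontr)
  assume "\<not> e * c \<preceq> x + y + 1"
  then have "x + y + 1 \<preceq> e * c" using le_total by blast
  moreover have "- (x + y) \<preceq> e * c" unfolding le_uminus_iff by (rule le_add[OF assms])
  ultimately show False using le_add[of "x + y + 1" "e * c" "- (x + y)"] c_small by simp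
qed

lemma coord_curve:
  assumes "far a n u"
  shows "on_curve a n u (coord a u)" "\<And>i. i < n \<Longrightarrow> 2 * coord a u i + (u - a i) \<noteq> 0"
proof -
  show "on_curve a n u (coord a u)"
    unfolding on_curve_def
  proof (intro allI impI)
    fix i assume "i < n"
    define d x where "d = u - a i" and "x = \<xi> (inverse d)"
    have d: "d \<noteq> 0" and "inverse d \<preceq> k" using assms \<open>i < n\<close> by (auto simp: far_def d_def)
    then have "x\<^sup>2 = inverse d - x" using root[of "inverse d"] by (simp add: x_def algebra_simps)
    then have "(d * x)\<^sup>2 = d * (d * (inverse d - x))" by (simp add: power2_eq_square)
    also have "\<dots> = d * (1 - d * x)" using d by (simp add: right_diff_distrib)
    finally show "(coord a u i)\<^sup>2 = (u - a i) * (1 - coord a u i)" by (simp add: coord_def d_def x_def)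
  qed
  fix i assume "i < n"
  define d x where "d = u - a i" and "x = \<xi> (inverse d)"
  have d: "d \<noteq> 0" and "inverse d \<preceq> k" using assms \<open>i < n\<close> by (auto simp: far_def d_def)
  then have "x \<preceq> c" using root_le by (simp add: x_def)
  then have "e * c \<preceq> x + x + 1" using sum_bounded_below by blast
  then have "x + x + 1 \<noteq> 0" using c_nz e_nz by auto
  moreover have "2 * coord a u i + (u - a i) = d * (x + x + 1)"
    by (simp add: coord_def d_def x_def algebra_simps)
  ultimately show "2 * coord a u i + (u - a i) \<noteq> 0" using d by simp
qed

text \<open>Two values of \<open>\<xi>\<close> satisfy
  \<open>(x - y) * (x + y + 1) = w - w'\<close>, and the second factor is bounded below by
  \<open>e * c\<close>.\<close>

lemma coord_continuous:
  assumes "\<forall>\<^sub>F h in near0. far a n (u + h)" "i < n"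
  shows "null near0 (\<lambda>h. coord a (u + h) i - coord a u i)"
proof -
  define d where "d = u - a i"
  define x where "x h = \<xi> (inverse (d + h))" for h
  have ev: "\<forall>\<^sub>F h in near0. d + h \<noteq> 0 \<and> inverse (d + h) \<preceq> k"
    using assms(1) by eventually_elim (use assms(2) in \<open>auto simp: far_def d_def algebra_simps\<close>)
  have "far a n (u + 0)" using assms(1) zero_le unfolding eventually_near0 by blast
  then have d0: "d \<noteq> 0" "inverse d \<preceq> k" using assms(2) by (auto simp: far_def d_def)
  have bi: "bdd near0 (\<lambda>h. inverse (d + h))"
    unfolding vbdd_def using ev by (intro exI[of _ k]) (auto elim: eventually_mono)
  have "null near0 (\<lambda>h. h * (inverse (d + h) * inverse d))"
    by (intro null_mult_bdd null_near0 bdd_mult bi bdd_const)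
  then have "null near0 (\<lambda>h. (x h - x 0) * (e * c))"
  proof (rule null_bound)
    show "\<forall>\<^sub>F h in near0. (x h - x 0) * (e * c) \<preceq> h * (inverse (d + h) * inverse d)"
      using ev
    proof eventually_elim
      case (elim h)
      have "x h \<preceq> c" "x 0 \<preceq> c" using elim d0 root_le by (auto simp: x_def)
      then have "(x h - x 0) * (e * c) \<preceq> (x h - x 0) * (x h + x 0 + 1)"
        by (intro le_mult_left sum_bounded_below)
      also have "(x h - x 0) * (x h + x 0 + 1) = ((x h)\<^sup>2 + x h) - ((x 0)\<^sup>2 + x 0)"
        by (simp add: algebra_simps power2_eq_square)
      also have "\<dots> = inverse (d + h) - inverse d"
        using root elim d0 by (simp add: x_def)
      also have "\<dots> = - (h * (inverse (d + h) * inverse d))" using elim d0 by (simp add: field_simps)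
      finally show ?case by simp
    qed
  qed
  then have "null near0 (\<lambda>h. (x h - x 0) * (e * c) * inverse (e * c))"
    by (rule null_mult_bdd[OF _ bdd_const])
  moreover have "(x h - x 0) * (e * c) * inverse (e * c) = x h - x 0" for h
    using e_nz c_nz by (simp only: mult.assoc) (simp add: field_simps)
  ultimately have x: "null near0 (\<lambda>h. x h - x 0)" by (simp only:)
  have "null near0 (\<lambda>h. d * (x h - x 0) + h * x h)"
    by (intro null_add null_mult_bdd' null_mult_bdd null_near0 bdd_const x null_diff_imp_bdd[OF x])
  then show ?thesis by (simp add: coord_def x_def d_def algebra_simps)
qed

lemma far_near:
  assumes "\<And>v. \<not> v \<preceq> M \<Longrightarrow> far a n v" "M \<noteq> 0" "\<not> u \<preceq> e * M"
  shows "\<forall>\<^sub>F h in near0. far a n (u + h)"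
  unfolding eventually_near0
proof (intro exI[of _ M] conjI allI impI)
  fix h assume h: "h \<preceq> M"
  show "far a n (u + h)"
  proof (rule assms(1), rule)
    assume "u + h \<preceq> M"
    then show False using le_add[of "u + h" M "- h"] h assms(3) by simp
  qed
qed (rule assms(2))

lemma ex_far_bound: "\<exists>M. M \<noteq> 0 \<and> (\<forall>v. \<not> v \<preceq> M \<longrightarrow> far a n v)"
proof -
  obtain M where M: "\<forall>u. \<not> u \<preceq> M \<longrightarrow> far a n u"
    using ex_far[OF k_nz, of n a] unfolding far_def by blast
  obtain M' where "M' \<noteq> 0" "M \<preceq> M'" using ex_upper by blast
  then show ?thesis using M le_trans by blast
qed

text \<open>Each \<open>a j\<close> is chosen far from its predecessors. The curve with
  \<open>j\<close> coordinates then has an unramified rational point over \<open>u = a j\<close>, as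
  the descent in \<open>ext_zero\<close> demands.\<close>

lemma ex_spread: "\<exists>a. \<forall>j<n. far a j (a j)"
proof (induction n)
  case (Suc n)
  then obtain a where a: "\<forall>j<n. far a j (a j)" by blast
  obtain M where M: "\<forall>u. \<not> u \<preceq> M \<longrightarrow> far a n u" using ex_far_bound by blast
  obtain u where "\<not> u \<preceq> M" using ex_not_le by blast
  then have "far a n u" using M by blast
  then have "\<forall>j<Suc n. far (a(n := u)) j ((a(n := u)) j)"
    using a by (auto simp: far_def less_Suc_eq)
  then show ?case by blast
qed simp

end

lemma (in V_ball) ex_root_function:
  assumes "henselian_ball B" "c \<noteq> 0"
  shows "\<exists>\<xi> k c'. c' \<preceq> c \<and> root_function B e \<xi> k c'"
proof -
  obtain \<eta> where \<eta>: "\<eta> \<noteq> 0" "\<not> 1 \<preceq> (e * e) * \<eta>" using not_le_one_mult[of 1 "e * e"] by auto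
  obtain c' where c': "c' \<noteq> 0" "c' \<preceq> c" "c' \<preceq> \<eta>" using ex_lower[OF assms(2) \<eta>(1)] by blast
  obtain k where k: "k \<noteq> 0" "\<And>w. w \<preceq> k \<Longrightarrow> \<exists>x. x\<^sup>2 + x = w \<and> x \<preceq> c'"
    using small_root[OF assms(1) c'(1)] by blast
  define \<xi> where "\<xi> w = (SOME x. x\<^sup>2 + x = w \<and> x \<preceq> c')" for w
  have "(\<xi> w)\<^sup>2 + \<xi> w = w \<and> \<xi> w \<preceq> c'" if "w \<preceq> k" for w
    unfolding \<xi>_def by (rule someI_ex[OF k(2)[OF that]])
  moreover have "\<not> 1 \<preceq> e * (e * c')"
    using \<eta>(2) le_trans[OF _ le_mult_left[OF c'(3), of "e * e"]] by (auto simp: mult.assoc)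
  ultimately show ?thesis
    using k(1) c' by (intro exI[of _ \<xi>] exI[of _ k] exI[of _ c'] conjI, simp) (unfold_locales, blast+)
qed

text \<open>The coordinates to be conjugated to reach the smaller roots. For large \<open>u\<close>
  this set names the point at infinity that is close to \<open>z\<close>.\<close>

definition std_flip :: "'k::field set \<Rightarrow> (nat \<Rightarrow> 'k) \<Rightarrow> nat \<Rightarrow> 'k \<Rightarrow> (nat \<Rightarrow> 'k) \<Rightarrow> nat set" where
  "std_flip B a n u z = {i. i < n \<and> \<not> vle B (z i) (- (u - a i) - z i)}"

lemma (in V_ball) std_flip_le:
  assumes "on_curve a n u z" "i < n" "u \<noteq> a i"
  shows "flip a (std_flip B a n u z) u z i \<preceq> e"
proof (rule standard_root)
  show "(flip a (std_flip B a n u z) u z i)\<^sup>2 = (u - a i) * (1 - flip a (std_flip B a n u z) u z i)"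
    using on_curve_flip[OF assms(1)] assms(2) unfolding on_curve_def by blast
  show "flip a (std_flip B a n u z) u z i \<preceq> - (u - a i) - flip a (std_flip B a n u z) u z i"
    using assms(2) le_total by (auto simp: flip_def std_flip_def)
qed (rule assms)



text \<open>The \<open>a i\<close> are fixed before \<open>J\<close>, as shattering requires. Only
  \<open>B0\<close> is henselian; \<open>B2\<close> enters through the two independence conditions,
  which supply elements that are small for one ball and large for the other.\<close>

theorem approximation:
  fixes B0 B2 :: "'k::field set"
  assumes A: "V_ball B0 e0" and C: "V_ball B2 e2" and H: "henselian_ball B0"
    and ind: "\<And>c d. c \<noteq> 0 \<Longrightarrow> \<exists>t. vle B0 t c \<and> \<not> vle B2 t d"
    and ind': "\<And>c d. c \<noteq> 0 \<Longrightarrow> \<exists>t. vle B2 t c \<and> \<not> vle B0 t d"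
    and c0: "c0 \<noteq> 0" and c2: "c2 \<noteq> 0"
  shows "\<exists>a :: nat \<Rightarrow> 'k. \<forall>J\<subseteq>{..<n}. \<exists>u. \<forall>i<n. u \<noteq> a i \<and> (\<exists>x. (x\<^sup>2 + x) * (u - a i) = 1 \<and>
    vle B0 x c0 \<and> (if i \<in> J then vle B2 x c2 else vle B2 (x + 1) c2))"
proof -
  interpret C: V_ball B2 e2 by (rule C)
  obtain \<xi> k c where c: "vle B0 c c0" and rf: "root_function B0 e0 \<xi> k c"
    using V_ball.ex_root_function[OF A H c0] by blast
  interpret A: root_function B0 e0 \<xi> k c by (rule rf)
  obtain a where a: "\<And>j. j < n \<Longrightarrow> A.far a j (a j)" using A.ex_spread by blast
  have unram: "\<exists>z. on_curve a j (a j) z \<and> (\<forall>i<j. 2 * z i + (a j - a i) \<noteq> 0)" if "j < n" for j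
    using A.coord_curve[OF a[OF that]] by blast
  obtain M where M: "M \<noteq> 0" "\<And>v. \<not> vle B0 v M \<Longrightarrow> A.far a n v" using A.ex_far_bound by blast
  define \<Omega> where "\<Omega> = {u. \<not> vle B0 u (e0 * M)}"
  have inf: "infinite \<Omega>" unfolding \<Omega>_def by (rule A.infinite_not_le)
  have near: "\<forall>\<^sub>F h in A.near0. A.far a n (u + h)" if "u \<in> \<Omega>" for u
    using A.far_near[OF M(2) M(1)] that by (auto simp: \<Omega>_def)
  have far: "A.far a n u" if "u \<in> \<Omega>" for u
  proof -
    have "A.far a n (u + 0)" using near[OF that] A.zero_le unfolding A.eventually_near0 by blast
    then show ?thesis by simp
  qed
  let ?G = "C.std a n"
  have G: "?G \<noteq> bot"
    unfolding trivial_limit_def C.eventually_std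
  proof (intro notI, elim exE)
    fix c
    assume *: "\<forall>u y. on_curve a n u y \<longrightarrow> (\<forall>i<n. vle B2 (y i) e2) \<longrightarrow> \<not> vle B2 u c \<longrightarrow> False"
    obtain m where m: "vle B0 (e0 * M) m" "vle B0 1 m" using A.ex_upper by blast
    obtain l where l: "vle B2 c l" "vle B2 1 l" using C.ex_upper by blast
    \<comment> \<open>\<open>s\<close> is large for \<open>B2\<close> only and \<open>t\<close> for
      \<open>B0\<close> only, so \<open>s + t\<close> is large for both: \<open>B0\<close> provides
      a rational point over it, and for \<open>B2\<close> this point is near infinity.\<close>
    obtain s where s: "vle B0 s 1" "\<not> vle B2 s (e2 * l)" using ind[of 1] by auto
    obtain t where t: "vle B2 t 1" "\<not> vle B0 t (e0 * m)" using ind'[of 1] by auto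
    have 1: "\<not> vle B2 (s + t) l"
      using C.le_add[of "s + t" l "- t"] s(2) C.le_trans[OF t(1) l(2)] by auto
    have 2: "\<not> vle B0 (s + t) m"
      using A.le_add[of "s + t" m "- s"] t(2) A.le_trans[OF s(1) m(2)] by auto
    then have "s + t \<in> \<Omega>" unfolding \<Omega>_def using m(1) A.le_trans by blast
    note f = far[OF this]
    let ?z = "A.coord a (s + t)"
    note z = A.coord_curve(1)[OF f]
    have "s + t \<noteq> a i" if "i < n" for i using f that by (auto simp: A.far_def)
    then have "\<forall>i<n. vle B2 (flip a (std_flip B2 a n (s + t) ?z) (s + t) ?z i) e2"
      using C.std_flip_le[OF z] by blast
    then show False using * on_curve_flip[OF z] 1 C.le_trans[OF _ l(1)] by blast
  qed
  have "\<exists>u. \<forall>i<n. u \<noteq> a i \<and> (\<exists>x. (x\<^sup>2 + x) * (u - a i) = 1 \<and>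
    vle B0 x c0 \<and> (if i \<in> J then vle B2 x c2 else vle B2 (x + 1) c2))" if J: "J \<subseteq> {..<n}" for J
  proof -
    \<comment> \<open>At the chosen point at infinity all \<open>x\<close> are near 0, and flipping
      a coordinate moves its \<open>x\<close> near -1, so the pole belongs at the flip by the
      complement of \<open>J\<close>.\<close>
    define Q where "Q = {..<n} - J"
    have pts: "\<exists>z. on_curve a n u z \<and> (\<forall>i<n. 2 * z i + (u - a i) \<noteq> 0)" if "u \<in> \<Omega>" for u
      using A.coord_curve[OF far[OF that]] by blast
    obtain f where f: "f \<in> ext (range poly) n" and f_nz: "\<exists>u z. on_curve a n u z \<and> f u z \<noteq> 0"
      and f_bdd: "\<And>S. S \<subseteq> {..<n} \<Longrightarrow> S \<noteq> Q \<Longrightarrow>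
        C.bdd ?G (\<lambda>p. fst p * f (fst p) (flip a S (fst p) (snd p)))"
      using C.ex_ext_pole_at[OF inf pts, of Q] unfolding Q_def by blast
    have f_null: "C.null ?G (\<lambda>p. f (fst p) (flip a S (fst p) (snd p)))"
      if "S \<subseteq> {..<n}" "S \<noteq> Q" for S
    proof -
      have "C.null ?G (\<lambda>p. inverse (fst p))" using C.std_large C.large_iff_null_inverse by blast
      from C.null_mult_bdd[OF this f_bdd[OF that]]
      have "C.null ?G (\<lambda>p. inverse (fst p) * (fst p * f (fst p) (flip a S (fst p) (snd p))))" .
      then show ?thesis
      proof (rule C.null_cong[rotated])
        show "\<forall>\<^sub>F p in ?G. inverse (fst p) * (fst p * f (fst p) (flip a S (fst p) (snd p))) =
            f (fst p) (flip a S (fst p) (snd p))"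
          using C.std_nz[of 0] by eventually_elim simp
      qed
    qed
    \<comment> \<open>If \<open>f\<close> were invariant, its behaviour at \<open>Q\<close> would be
      that at \<open>sym_diff S Q\<close>, where it vanishes. Without any pole \<open>f\<close> is
      constant, hence 0, a contradiction.\<close>
    have not_inv: "\<exists>u z. on_curve a n u z \<and> f u (flip a S u z) - f u z \<noteq> 0"
      if S: "S \<subseteq> {..<n}" "S \<noteq> {}" for S
    proof (rule ccontr)
      assume "\<not> ?thesis"
      then have inv: "f u (flip a S u z) = f u z" if "on_curve a n u z" for u z using that by auto
      have ne: "sym_diff S T \<noteq> T" for T using S(2) by blast
      have bdd: "C.bdd ?G (\<lambda>p. f (fst p) (flip a T (fst p) (snd p)))" for T
      proof -
        define T' where "T' = T \<inter> {..<n}"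
        have T': "f u (flip a T u z) = f u (flip a T' u z)" for u z
          by (rule ext_cong_flip[OF f]) (auto simp: T'_def)
        have T'_n: "T' \<subseteq> {..<n}" by (auto simp: T'_def)
        show ?thesis
        proof (cases "T' = Q")
          case False
          then show ?thesis unfolding T' using f_null[OF T'_n] C.null_imp_bdd by blast
        next
          case True
          have "C.bdd ?G (\<lambda>p. f (fst p) (flip a (sym_diff S T') (fst p) (snd p)))"
            using f_null[of "sym_diff S T'"] ne[of T'] S(1) T'_n True C.null_imp_bdd by blast
          then show ?thesis
          proof (rule C.bdd_cong[rotated])
            show "\<forall>\<^sub>F p in ?G. f (fst p) (flip a (sym_diff S T') (fst p) (snd p)) =
                f (fst p) (flip a T (fst p) (snd p))"
              using C.std_on_curve
            proof eventually_elim
              case (elim p)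
              show ?case unfolding T' flip_flip[symmetric] by (rule inv[OF on_curve_flip[OF elim]])
            qed
          qed
        qed
      qed
      obtain l where l: "\<And>u z. on_curve a n u z \<Longrightarrow> f u z = l"
        using C.ext_bdd_imp_const[OF G f order_refl bdd] by blast
      have "C.null ?G (\<lambda>p. f (fst p) (flip a (sym_diff S Q) (fst p) (snd p)))"
        using f_null[of "sym_diff S Q"] ne[of Q] S(1) by (auto simp: Q_def)
      moreover have "\<forall>\<^sub>F p in ?G. f (fst p) (flip a (sym_diff S Q) (fst p) (snd p)) = l"
        using C.std_on_curve by eventually_elim (rule l[OF on_curve_flip])
      ultimately have "C.null ?G (\<lambda>p. l)" by (rule C.null_cong[rotated])
      then have "l = 0" using C.null_const_iff[OF G] by blast
      then show False using f_nz l by auto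
    qed
    define zeros where "zeros q = {u. \<exists>z. on_curve a n u z \<and> q u z = 0}"
      for q :: "'k \<Rightarrow> (nat \<Rightarrow> 'k) \<Rightarrow> 'k"
    have fin: "finite (zeros q)" if "q \<in> ext (range poly) n" "\<exists>u z. on_curve a n u z \<and> q u z \<noteq> 0" for q
      using ext_zero[OF unram that(1)] that(2) unfolding zeros_def by blast
    have fin_flip: "finite (zeros (\<lambda>u z. f u (flip a S u z) - f u z))" if "S \<subseteq> {..<n}" "S \<noteq> {}" for S
    proof (rule fin)
      have "(\<lambda>u z. f u (flip a S u z) + - f u z) \<in> ext (range poly) n"
        by (intro ext_add_ring[OF fun_ring_polys linear_polys] ext_uminus_ring[OF fun_ring_polys linear_polys]
          ext_flip[where v = "\<lambda>u. u", OF fun_ring_polys linear_polys] f)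
      then show "(\<lambda>u z. f u (flip a S u z) - f u z) \<in> ext (range poly) n" by simp
    qed (rule not_inv[OF that])
    \<comment> \<open>With \<open>u = 0\<close> excluded, \<open>u * f\<close> separates the
      conjugates of the base point whenever \<open>f\<close> does.\<close>
    define bad where "bad = insert 0 (zeros f \<union>
      (\<Union>S\<in>Pow {..<n} - {{}}. zeros (\<lambda>u z. f u (flip a S u z) - f u z)))"
    have "finite bad" unfolding bad_def using fin[OF f f_nz] fin_flip by auto
    then have "infinite (\<Omega> - bad)" using inf by (rule Diff_infinite_finite)
    then obtain u0 where u0: "u0 \<in> \<Omega>" "u0 \<notin> bad" by (metis Diff_iff ex_in_conv finite.emptyI)
    define z where "z h = A.coord a (u0 + h)" for h
    have near0: "\<forall>\<^sub>F h in A.near0. A.far a n (u0 + h)" by (rule near[OF u0(1)])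
    have curve: "\<forall>\<^sub>F h in A.near0. on_curve a n (u0 + h) (z h)"
      using near0 by eventually_elim (simp add: z_def A.coord_curve)
    have z0: "on_curve a n u0 (z 0)" "\<And>i. i < n \<Longrightarrow> 2 * z 0 i + (u0 - a i) \<noteq> 0"
      using A.coord_curve[OF far[OF u0(1)]] by (auto simp: z_def)
    have f0: "f u0 (z 0) \<noteq> 0" "u0 \<noteq> 0"
      using u0(2) z0(1) by (auto simp: bad_def zeros_def)
    have f_flip: "f u0 (flip a S u0 (z 0)) \<noteq> f u0 (z 0)" if "S \<subseteq> {..<n}" "S \<noteq> {}" for S
      using u0(2) z0(1) that by (auto simp: bad_def zeros_def)
    have coord: "A.expands A.near0 (\<lambda>h. h) r (\<lambda>h. z h i)" if "i < n" for i r
    proof (rule A.expands_near_coord)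
      show "\<forall>\<^sub>F h in A.near0. (z h i)\<^sup>2 = (u0 - a i + h) * (1 - z h i)"
        using curve by eventually_elim (use that in \<open>auto simp: on_curve_def algebra_simps\<close>)
      show "(z 0 i)\<^sup>2 = (u0 - a i) * (1 - z 0 i)" using z0(1) that by (auto simp: on_curve_def)
      show "A.null A.near0 (\<lambda>h. z h i - z 0 i)"
        using A.coord_continuous[OF near0 that] by (simp add: z_def)
      show "2 * z 0 i + (u0 - a i) \<noteq> 0" by (rule z0(2)[OF that])
    qed
    have "A.expands A.near0 (\<lambda>h. h) 2 (\<lambda>h. f (u0 + h) (flip a {} (u0 + h) (z h)))"
      by (rule A.expands_near_ext[OF f coord])
    then obtain P where P: "A.big_o A.near0 (\<lambda>h. f (u0 + h) (z h) - poly P h) (\<lambda>h. h ^ 2)"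
      unfolding A.expands_def by auto
    have P0: "coeff P 0 = f u0 (z 0)"
    proof -
      obtain m d where "\<And>h. vle B0 h d \<Longrightarrow> vle B0 (f (u0 + h) (z h) - poly P h) (m * h ^ 2)"
        using P unfolding vbig_o_def A.eventually_near0 by blast
      from this[of 0] show ?thesis by (simp add: poly_0_coeff_0)
    qed
    text \<open>As \<open>(u f)' = f + u f'\<close>, one of \<open>f\<close> and \<open>u f\<close> has a nonzero derivative at \<open>u0\<close>.\<close>
    have "\<exists>g\<in>ext (range poly) n. (\<forall>S\<subseteq>{..<n}. S \<noteq> Q \<longrightarrow> C.bdd ?G (\<lambda>p. g (fst p) (flip a S (fst p) (snd p)))) \<and>
        (\<forall>S\<subseteq>{..<n}. S \<noteq> {} \<longrightarrow> g u0 (flip a S u0 (z 0)) \<noteq> g u0 (z 0)) \<and>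
        (\<exists>P. A.big_o A.near0 (\<lambda>h. g (u0 + h) (z h) - poly P h) (\<lambda>h. h ^ 2) \<and> coeff P 1 \<noteq> 0)"
    proof (cases "coeff P 1 = 0")
      case False
      then show ?thesis using f f_null C.null_imp_bdd f_flip P by (intro bexI[of _ f]) blast+
    next
      case True
      let ?g = "\<lambda>u z. u * f u z"
      have "(\<lambda>u. u) \<in> range (poly :: 'k poly \<Rightarrow> _)" by (rule range_eqI[of _ _ "[:0, 1:]"]) auto
      then have "?g \<in> ext (range poly) n"
        by (rule ext_scale_ring[OF fun_ring_polys linear_polys _ f])
      moreover have "A.big_o A.near0 (\<lambda>h. ?g (u0 + h) (z h) - poly ([:u0, 1:] * P) h) (\<lambda>h. h ^ 2)"
      proof -
        have "A.bdd A.near0 (\<lambda>h. u0 + h)"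
          using A.bdd_add[OF A.bdd_const A.null_imp_bdd[OF A.null_near0]] by blast
        from A.big_o_mult_bdd[OF this P] show ?thesis by (simp add: algebra_simps)
      qed
      moreover have "coeff ([:u0, 1:] * P) 1 \<noteq> 0"
        using True f0(1) P0 by (simp add: coeff_pCons split: nat.split)
      moreover have "\<forall>S\<subseteq>{..<n}. S \<noteq> {} \<longrightarrow> ?g u0 (flip a S u0 (z 0)) \<noteq> ?g u0 (z 0)"
        using f_flip f0(2) by simp
      ultimately show ?thesis using f_bdd by (intro bexI[of _ ?g] conjI exI[of _ "[:u0, 1:] * P"]) auto
    qed
    then obtain g P' where g: "g \<in> ext (range poly) n"
      and g_bdd: "\<And>S. S \<subseteq> {..<n} \<Longrightarrow> S \<noteq> Q \<Longrightarrow> C.bdd ?G (\<lambda>p. g (fst p) (flip a S (fst p) (snd p)))"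
      and g_flip: "\<And>S. S \<subseteq> {..<n} \<Longrightarrow> S \<noteq> {} \<Longrightarrow> g u0 (flip a S u0 (z 0)) \<noteq> g u0 (z 0)"
      and P': "A.big_o A.near0 (\<lambda>h. g (u0 + h) (z h) - poly P' h) (\<lambda>h. h ^ 2)" "coeff P' 1 \<noteq> 0"
      by blast
    let ?c = "g u0 (z 0)"
    \<comment> \<open>\<open>T\<close> tends to \<open>?c\<close> for \<open>B0\<close> and to
      infinity for \<open>B2\<close> simultaneously; \<open>ind\<close> makes this filter
      proper.\<close>
    define F where "F = (INF (d, d')\<in>(- {0}) \<times> UNIV. principal {T. vle B0 (T - ?c) d \<and> \<not> vle B2 T d'})"
    have ev_F: "eventually R F \<longleftrightarrow> (\<exists>d d'. d \<noteq> 0 \<and> (\<forall>T. vle B0 (T - ?c) d \<longrightarrow> \<not> vle B2 T d' \<longrightarrow> R T))" for R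
      unfolding F_def
    proof (subst eventually_INF_base)
      show "(- {0}) \<times> UNIV \<noteq> ({} :: ('k \<times> 'k) set)" by (metis ComplI SigmaI UNIV_I empty_iff singletonD zero_neq_one)
      fix x y :: "'k \<times> 'k" assume "x \<in> (- {0}) \<times> UNIV" "y \<in> (- {0}) \<times> UNIV"
      then obtain d1 d1' d2 d2' where xy: "x = (d1, d1')" "y = (d2, d2')" "d1 \<noteq> 0" "d2 \<noteq> 0" by auto
      obtain d where d: "d \<noteq> 0" "vle B0 d d1" "vle B0 d d2" using A.ex_lower[OF xy(3,4)] by blast
      obtain d' where d': "vle B2 d1' d'" "vle B2 d2' d'" using C.ex_upper by blast
      show "\<exists>x'\<in>(- {0}) \<times> UNIV. (case x' of (d, d') \<Rightarrow> principal {T. vle B0 (T - ?c) d \<and> \<not> vle B2 T d'})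
          \<le> inf (case x of (d, d') \<Rightarrow> principal {T. vle B0 (T - ?c) d \<and> \<not> vle B2 T d'})
            (case y of (d, d') \<Rightarrow> principal {T. vle B0 (T - ?c) d \<and> \<not> vle B2 T d'})"
        using d d' A.le_trans C.le_trans unfolding xy by (intro bexI[of _ "(d, d')"]) auto
    qed (auto simp: eventually_principal)
    have F: "F \<noteq> bot"
      unfolding trivial_limit_def ev_F
    proof (intro notI, elim exE conjE)
      fix d d' assume d: "d \<noteq> 0" and *: "\<forall>T. vle B0 (T - ?c) d \<longrightarrow> \<not> vle B2 T d' \<longrightarrow> False"
      obtain m where m: "vle B2 d' m" "vle B2 ?c m" using C.ex_upper by blast
      obtain t where t: "vle B0 t d" "\<not> vle B2 t (e2 * m)" using ind[OF d] by blast
      have "\<not> vle B2 (?c + t) m" using C.le_add[of "?c + t" m "- ?c"] t(2) m(2) by auto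
      then show False using * t(1) C.le_trans[OF _ m(1)] by (metis add_diff_cancel_left')
    qed
    have T0: "A.null F (\<lambda>T. T - ?c)" unfolding vnull_def ev_F by blast
    have T2: "C.large F (\<lambda>T. T)" unfolding vlarge_def ev_F by (metis zero_neq_one)
    obtain h where h: "A.null F h" "\<forall>\<^sub>F T in F. g (u0 + h T) (z (h T)) = T"
      using A.solve_near[OF H curve coord g P' g_flip T0] by blast
    define u where "u T = u0 + h T" for T
    define x where "x T = z (h T)" for T
    have gT: "\<forall>\<^sub>F T in F. g (u T) (x T) = T" using h(2) by (simp add: u_def x_def)
    have farT: "\<forall>\<^sub>F T in F. A.far a n (u T)"
      unfolding u_def by (rule eventually_compose_filterlim[OF near0 A.filterlim_near0[OF h(1)]])
    then have curveT: "\<forall>\<^sub>F T in F. on_curve a n (u T) (x T)"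
      by eventually_elim (simp add: u_def x_def z_def A.coord_curve)
    have no_bdd: "F' = bot" if "F' \<le> F" "C.bdd F' (\<lambda>T. g (u T) (x T))" for F'
    proof (rule ccontr)
      assume "F' \<noteq> bot"
      moreover have "C.bdd F' (\<lambda>T. T)" using C.bdd_cong[OF filter_leD[OF that(1) gT] that(2)] .
      ultimately show False using C.large_not_bdd[OF _ C.large_mono[OF that(1) T2]] by blast
    qed
    \<comment> \<open>Where \<open>u\<close> is bounded, so are the integral coordinates and with
      them \<open>g\<close>, which equals the large \<open>T\<close>.\<close>
    have u_large: "C.large F u"
      unfolding vlarge_def
    proof
      fix d
      let ?F = "inf F (principal {T. vle B2 (u T) d})"
      have u: "C.bdd ?F u" unfolding vbdd_def by (rule exI[of _ d]) (simp add: eventually_inf_principal)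
      have "C.bdd ?F (\<lambda>T. x T i)" if "i < n" for i
      proof -
        have "C.bdd ?F (\<lambda>T. e2 * (u T - a i))" by (intro C.bdd_mult C.bdd_diff C.bdd_const u)
        then obtain m where m: "\<forall>\<^sub>F T in ?F. vle B2 (e2 * (u T - a i)) m" unfolding vbdd_def by blast
        obtain m' where m': "vle B2 1 m'" "vle B2 m m'" using C.ex_upper by blast
        have "\<forall>\<^sub>F T in ?F. vle B2 (x T i) m'"
          using m filter_leD[OF inf_le1 curveT]
        proof eventually_elim
          case (elim T)
          then have "(x T i)\<^sup>2 = (u T - a i) * (1 - x T i)" using that by (auto simp: on_curve_def)
          then show ?case using C.root_bound elim(1) m' C.le_trans by metis
        qed
        then show ?thesis unfolding vbdd_def by blast
      qed
      then have "?F = bot" by (intro no_bdd C.bdd_ext[OF g u]) auto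
      then have "eventually (\<lambda>_. False) ?F" by simp
      then show "\<forall>\<^sub>F T in F. \<not> vle B2 (u T) d" unfolding eventually_inf_principal by simp
    qed
    define \<rho> where "\<rho> T = std_flip B2 a n (u T) (x T)" for T
    define y where "y T = flip a (\<rho> T) (u T) (x T)" for T
    have y_le: "\<forall>\<^sub>F T in F. \<forall>i<n. vle B2 (y T i) e2"
      using curveT farT
    proof eventually_elim
      case (elim T)
      then show ?case using C.std_flip_le[OF elim(1)] unfolding y_def \<rho>_def A.far_def by blast
    qed
    have lim: "filterlim (\<lambda>T. (u T, y T)) ?G F"
      unfolding filterlim_iff
    proof (intro allI impI)
      fix R assume "eventually R ?G"
      then obtain d where d: "\<And>u y. on_curve a n u y \<Longrightarrow> (\<forall>i<n. vle B2 (y i) e2) \<Longrightarrow> \<not> vle B2 u d \<Longrightarrow> R (u, y)"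
        unfolding C.eventually_std by blast
      have "\<forall>\<^sub>F T in F. \<not> vle B2 (u T) d" using u_large unfolding vlarge_def by blast
      with curveT y_le show "\<forall>\<^sub>F T in F. R (u T, y T)"
        by eventually_elim (intro d; simp add: y_def on_curve_flip)
    qed
    \<comment> \<open>Near the point at infinity named by \<open>S\<close> the function
      \<open>g\<close> is bounded, although its value is the large \<open>T\<close>.\<close>
    have "\<forall>\<^sub>F T in F. \<rho> T \<noteq> S" if S: "S \<subseteq> {..<n}" "S \<noteq> Q" for S
    proof -
      let ?F = "inf F (principal {T. \<rho> T = S})"
      have "C.bdd F (\<lambda>T. g (u T) (flip a S (u T) (y T)))"
        using C.bdd_filterlim[OF g_bdd[OF S] lim] by simp
      then have "C.bdd ?F (\<lambda>T. g (u T) (flip a S (u T) (y T)))" by (rule C.bdd_mono[OF inf_le1])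
      moreover have "\<forall>\<^sub>F T in ?F. g (u T) (flip a S (u T) (y T)) = g (u T) (x T)"
        unfolding eventually_inf_principal by (auto simp: y_def flip_flip intro!: always_eventually)
      ultimately have "C.bdd ?F (\<lambda>T. g (u T) (x T))" by (rule C.bdd_cong[rotated])
      then have "?F = bot" by (intro no_bdd) auto
      then have "eventually (\<lambda>_. False) ?F" by simp
      then show ?thesis unfolding eventually_inf_principal by simp
    qed
    then have "\<forall>\<^sub>F T in F. \<forall>S\<in>Pow {..<n} - {Q}. \<rho> T \<noteq> S" by (intro eventually_ball_finite) auto
    then have \<rho>: "\<forall>\<^sub>F T in F. \<rho> T = Q"
    proof eventually_elim
      case (elim T)
      have "\<rho> T \<in> Pow {..<n}" by (auto simp: \<rho>_def std_flip_def)
      then show ?case using elim by blast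
    qed
    \<comment> \<open>Division by \<open>e2\<close> offsets the bound
      \<open>y T i \<preceq> e2\<close> (for \<open>B2\<close>), so that
      \<open>y T i / (u T - a i)\<close> is within \<open>c2\<close>. This quotient is the root
      itself or minus the root plus 1, depending on \<open>i \<in> J\<close>.\<close>
    have "\<forall>\<^sub>F T in F. \<forall>i\<in>{..<n}. vle B2 (inverse (u T - a i)) (c2 / e2)"
    proof (intro eventually_ball_finite ballI)
      fix i
      have "C.large F (\<lambda>T. u T + - a i)" by (rule C.large_add_bdd[OF u_large C.bdd_const])
      then have "C.null F (\<lambda>T. inverse (u T - a i))" unfolding C.large_iff_null_inverse by simp
      then show "\<forall>\<^sub>F T in F. vle B2 (inverse (u T - a i)) (c2 / e2)"
        unfolding vnull_def using c2 C.e_nz by simp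
    qed simp
    with \<rho> y_le farT have "\<forall>\<^sub>F T in F. \<forall>i<n. u T \<noteq> a i \<and> (\<exists>x. (x\<^sup>2 + x) * (u T - a i) = 1 \<and>
        vle B0 x c0 \<and> (if i \<in> J then vle B2 x c2 else vle B2 (x + 1) c2))"
    proof eventually_elim
      case (elim T)
      show ?case
      proof (intro allI impI conjI)
        fix i assume i: "i < n"
        define d where "d = u T - a i"
        have d: "d \<noteq> 0" "vle B0 (inverse d) k" using elim(3) i by (auto simp: A.far_def d_def)
        show "u T \<noteq> a i" using d(1) by (auto simp: d_def)
        let ?x = "\<xi> (inverse d)"
        have xi: "x T i = d * ?x" by (simp add: x_def z_def A.coord_def d_def u_def)
        have "vle B2 (y T i * inverse d) (e2 * (c2 / e2))"
          using elim(2,4) i by (intro C.le_mult) (auto simp: d_def)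
        then have yd: "vle B2 (y T i * inverse d) c2" using C.e_nz by simp
        show "\<exists>x. (x\<^sup>2 + x) * (u T - a i) = 1 \<and> vle B0 x c0 \<and>
            (if i \<in> J then vle B2 x c2 else vle B2 (x + 1) c2)"
        proof (intro exI[of _ ?x] conjI)
          show "(?x\<^sup>2 + ?x) * (u T - a i) = 1" using A.root[OF d(2)] d(1) by (simp add: d_def)
          show "vle B0 ?x c0" using A.root_le[OF d(2)] c A.le_trans by blast
          show "if i \<in> J then vle B2 ?x c2 else vle B2 (?x + 1) c2"
          proof (cases "i \<in> J")
            case True
            then have "y T i = d * ?x" using elim(1) by (simp add: y_def flip_def Q_def xi)
            then have "y T i * inverse d = ?x" using d(1) by (simp add: field_simps)
            then show ?thesis using yd True by simp
          next
            case False
            then have "y T i = - d * (?x + 1)"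
              using elim(1) i by (simp add: y_def flip_def Q_def xi d_def algebra_simps)
            then have "y T i * inverse d = - (?x + 1)" using d(1) by (simp add: field_simps)
            then have "vle B2 (- (?x + 1)) c2" using yd by simp
            then show ?thesis using False C.le_uminus_iff by (simp only: if_False)
          qed
        qed
      qed
    qed
    then show ?thesis using F eventually_happens' by blast
  qed
  then show ?thesis by blast
qed


section \<open>V-topologies and their balls\<close>

definition ball_topology :: "'k::field set \<Rightarrow> 'k topology \<Rightarrow> bool" where
  "ball_topology B \<tau> \<longleftrightarrow>
     (\<forall>U. openin \<tau> U \<longleftrightarrow> (\<forall>x\<in>U. \<exists>c. c \<noteq> 0 \<and> (\<forall>y. vle B (y - x) c \<longrightarrow> y \<in> U)))"

lemma ball_topology_valuation:
  assumes val: "krull_valuation G r v" and nontriv: "\<exists>x. x \<noteq> 0 \<and> v x \<noteq> \<one>\<^bsub>G\<^esub>"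
  shows "\<exists>B. V_ball B (1 :: 'k::field) \<and> ball_topology B (valuation_topology G r v)"
proof -
  have G: "comm_group G" and lin: "linear_order_on (carrier G) r"
    and mono: "\<And>a b c. (a, b) \<in> r \<Longrightarrow> c \<in> carrier G \<Longrightarrow> (a \<otimes>\<^bsub>G\<^esub> c, b \<otimes>\<^bsub>G\<^esub> c) \<in> r"
    and im: "v ` (- {0}) = carrier G"
    and mult: "\<And>x y. x \<noteq> 0 \<Longrightarrow> y \<noteq> 0 \<Longrightarrow> v (x * y) = v x \<otimes>\<^bsub>G\<^esub> v y"
    and ultra: "\<And>x y. x \<noteq> 0 \<Longrightarrow> y \<noteq> 0 \<Longrightarrow> x + y \<noteq> 0 \<Longrightarrow>
      (v x, v (x + y)) \<in> r \<or> (v y, v (x + y)) \<in> r"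
    using val unfolding krull_valuation_def ordered_abelian_group_def by blast+
  interpret comm_group G by (rule G)
  have trans: "trans r" and antisym: "antisym r" and total: "total_on (carrier G) r"
    and refl: "refl_on (carrier G) r"
    using lin unfolding linear_order_on_def partial_order_on_def preorder_on_def by blast+
  note rtrans = transD[OF trans] and rantisym = antisymD[OF antisym]
  have rtotal: "(a, b) \<in> r \<or> (b, a) \<in> r" if "a \<in> carrier G" "b \<in> carrier G" for a b
    using total refl that unfolding total_on_def refl_on_def by metis
  have vc: "v x \<in> carrier G" if "x \<noteq> 0" for x using im that by auto
  have v1: "v 1 = \<one>\<^bsub>G\<^esub>"
    using mult[of 1 1] vc[of 1] by (metis l_cancel_one' mult_1 one_neq_zero)
  have vinv: "v x \<otimes>\<^bsub>G\<^esub> v (inverse x) = \<one>\<^bsub>G\<^esub>" if "x \<noteq> 0" for x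
    using mult[of x "inverse x"] that v1 by simp
  \<comment> \<open>An element with trivial square in an ordered group is trivial: multiplying a
    comparison with the unit by the element itself reverses it.\<close>
  have m1: "v (- 1) = \<one>\<^bsub>G\<^esub>"
  proof -
    have sq: "v (- 1) \<otimes>\<^bsub>G\<^esub> v (- 1) = \<one>\<^bsub>G\<^esub>" using mult[of "- 1" "- 1"] v1 by simp
    have "(\<one>\<^bsub>G\<^esub>, v (- 1)) \<in> r \<or> (v (- 1), \<one>\<^bsub>G\<^esub>) \<in> r" using rtotal vc[of "- 1"] by simp
    then show ?thesis
      using mono[of "\<one>\<^bsub>G\<^esub>" "v (- 1)" "v (- 1)"] mono[of "v (- 1)" "\<one>\<^bsub>G\<^esub>" "v (- 1)"] sq rantisym vc[of "- 1"]
      by auto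
  qed
  have neg: "v (- x) = v x" if "x \<noteq> 0" for x
    using mult[of "- 1" x] m1 that vc[OF that] by simp
  define B where "B = {x. x = 0 \<or> (\<one>\<^bsub>G\<^esub>, v x) \<in> r}"
  have le: "vle B x c \<longleftrightarrow> x = 0 \<or> (v c, v x) \<in> r" if c: "c \<noteq> 0" for x c
  proof (cases "x = 0")
    case False
    have cx: "c * (x / c) = x" using c by simp
    have "vle B x c \<longleftrightarrow> (\<one>\<^bsub>G\<^esub>, v (x / c)) \<in> r"
      using c False unfolding vle_def B_def by (auto intro!: bexI[of _ "x / c"])
    also have "\<dots> \<longleftrightarrow> (v c, v x) \<in> r"
    proof
      assume "(\<one>\<^bsub>G\<^esub>, v (x / c)) \<in> r"
      from mono[OF this vc[OF c]] show "(v c, v x) \<in> r"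
        using mult[of c "x / c"] c False vc by (simp add: m_comm)
    next
      assume "(v c, v x) \<in> r"
      from mono[OF this vc[of "inverse c"]] c have "(\<one>\<^bsub>G\<^esub>, v x \<otimes>\<^bsub>G\<^esub> v (inverse c)) \<in> r"
        using vinv[OF c] by simp
      then show "(\<one>\<^bsub>G\<^esub>, v (x / c)) \<in> r" using mult[of x "inverse c"] c False by (simp add: field_simps)
    qed
    finally show ?thesis using False by simp
  qed (auto simp: vle_def B_def)
  \<comment> \<open>An element of positive value. Its inverse lies outside \<open>B\<close>, and a
    factor \<open>p\<close> converts the weak inequality of \<open>vle\<close> into the strict one
    of \<open>valuation_ball\<close>.\<close>
  obtain p where p: "p \<noteq> 0" "(\<one>\<^bsub>G\<^esub>, v p) \<in> r" "v p \<noteq> \<one>\<^bsub>G\<^esub>"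
  proof -
    obtain x where x: "x \<noteq> 0" "v x \<noteq> \<one>\<^bsub>G\<^esub>" using nontriv by blast
    show ?thesis
    proof (cases "(\<one>\<^bsub>G\<^esub>, v x) \<in> r")
      case False
      then have "(v x, \<one>\<^bsub>G\<^esub>) \<in> r" using rtotal vc x(1) by blast
      from mono[OF this vc[of "inverse x"]] have 1: "(\<one>\<^bsub>G\<^esub>, v (inverse x)) \<in> r"
        using vinv[OF x(1)] x vc[of "inverse x"] by simp
      have "v (inverse x) \<noteq> \<one>\<^bsub>G\<^esub>" using vinv[OF x(1)] x vc[OF x(1)] by auto
      then show ?thesis using that[of "inverse x"] 1 x(1) by simp
    qed (use that x in blast)
  qed
  have strict: "(v (inverse p), \<one>\<^bsub>G\<^esub>) \<in> r" "v (inverse p) \<noteq> \<one>\<^bsub>G\<^esub>"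
    using mono[OF p(2) vc[of "inverse p"]] vinv[OF p(1)] p vc[of "inverse p"] vc[OF p(1)] by auto
  have "V_ball B 1"
  proof
    show "1 \<in> B" using refl v1 one_closed by (auto simp: B_def refl_on_def)
    show "x * y \<in> B" if "x \<in> B" "y \<in> B" for x y
    proof (cases "x = 0 \<or> y = 0")
      case False
      then have x: "x \<noteq> 0" "(\<one>\<^bsub>G\<^esub>, v x) \<in> r" "y \<noteq> 0" "(\<one>\<^bsub>G\<^esub>, v y) \<in> r" using that by (auto simp: B_def)
      have "(v y, v x \<otimes>\<^bsub>G\<^esub> v y) \<in> r" using mono[OF x(2) vc[OF x(3)]] vc[OF x(3)] by simp
      then show ?thesis using rtrans[OF x(4)] mult x by (simp add: B_def)
    qed (auto simp: B_def)
    show "- x \<in> B" if "x \<in> B" for x using that neg by (cases "x = 0") (auto simp: B_def)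
    show "inverse x \<in> B" if "x \<notin> B" for x
    proof -
      have x: "x \<noteq> 0" "(\<one>\<^bsub>G\<^esub>, v x) \<notin> r" using that by (auto simp: B_def)
      then have "(v x, \<one>\<^bsub>G\<^esub>) \<in> r" using rtotal vc by blast
      from mono[OF this vc[of "inverse x"]] x(1) show ?thesis
        using vinv[OF x(1)] vc[of "inverse x"] by (simp add: B_def)
    qed
    show "(x + y) / 1 \<in> B" if "x \<in> B" "y \<in> B" for x y
    proof (cases "x = 0 \<or> y = 0 \<or> x + y = 0")
      case False
      then have "(\<one>\<^bsub>G\<^esub>, v x) \<in> r" "(\<one>\<^bsub>G\<^esub>, v y) \<in> r" using that by (auto simp: B_def)
      then have "(\<one>\<^bsub>G\<^esub>, v (x + y)) \<in> r" using ultra[of x y] False rtrans by blast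
      then show ?thesis by (simp add: B_def)
    next
      case True
      then consider "x = 0" | "y = 0" | "x + y = 0" by blast
      then show ?thesis using that by cases (simp_all add: B_def)
    qed
    have "inverse p \<notin> B" using strict rantisym p(1) by (auto simp: B_def)
    then show "\<exists>x. x \<notin> B" by blast
  qed simp
  moreover have "ball_topology B (valuation_topology G r v)"
    unfolding ball_topology_def openin_valuation_topology[OF val]
  proof (intro allI ball_cong refl iffI)
    fix U x
    assume "\<exists>\<gamma>\<in>carrier G. valuation_ball r v x \<gamma> \<subseteq> U"
    then obtain d where d: "d \<noteq> 0" "valuation_ball r v x (v d) \<subseteq> U" unfolding im[symmetric] by blast
    have dp: "(v d, v (d * p)) \<in> r" "v (d * p) \<noteq> v d"
    proof -
      have eq: "v (d * p) = v p \<otimes>\<^bsub>G\<^esub> v d" using mult d(1) p(1) vc by (simp add: m_comm)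
      show "(v d, v (d * p)) \<in> r" unfolding eq using mono[OF p(2) vc[OF d(1)]] vc[OF d(1)] by simp
      show "v (d * p) \<noteq> v d" unfolding eq using p(3) vc d(1) p(1) by simp
    qed
    have "y \<in> U" if y: "vle B (y - x) (d * p)" for y
    proof (cases "y = x")
      case True
      then have "y \<in> valuation_ball r v x (v d)" by (simp add: valuation_ball_def)
      then show ?thesis using d(2) by blast
    next
      case False
      then have "(v (d * p), v (y - x)) \<in> r" using y le[of "d * p" "y - x"] d(1) p(1) by simp
      then have "(v d, v (y - x)) \<in> r" "v (y - x) \<noteq> v d" using dp rtrans rantisym by metis+
      then have "y \<in> valuation_ball r v x (v d)" by (simp add: valuation_ball_def)
      then show ?thesis using d(2) by blast
    qed
    then show "\<exists>c. c \<noteq> 0 \<and> (\<forall>y. vle B (y - x) c \<longrightarrow> y \<in> U)" using d(1) p(1) by (intro exI[of _ "d * p"]) auto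
  next
    fix U x
    assume "\<exists>c. c \<noteq> 0 \<and> (\<forall>y. vle B (y - x) c \<longrightarrow> y \<in> U)"
    then obtain c where c: "c \<noteq> 0" "\<And>y. vle B (y - x) c \<Longrightarrow> y \<in> U" by blast
    have "valuation_ball r v x (v c) \<subseteq> U"
      using c(2) le[OF c(1)] by (auto simp: valuation_ball_def)
    then show "\<exists>\<gamma>\<in>carrier G. valuation_ball r v x \<gamma> \<subseteq> U" using vc[OF c(1)] by blast
  qed simp_all
  ultimately show ?thesis by blast
qed

lemma ball_topology_absolute_value:
  fixes f :: "'k::field \<Rightarrow> real"
  assumes "absolute_value f" and nontriv: "\<exists>x. x \<noteq> 0 \<and> f x \<noteq> 1"
  shows "\<exists>B e. V_ball B e \<and> ball_topology B (absolute_value_topology f)"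
proof -
  have nn: "\<And>x. 0 \<le> f x" and zero: "\<And>x. f x = 0 \<longleftrightarrow> x = 0"
    and mult: "\<And>x y. f (x * y) = f x * f y" and tri: "\<And>x y. f (x + y) \<le> f x + f y"
    using assms(1) unfolding absolute_value_def by blast+
  have f1: "f 1 = 1" using mult[of 1 1] zero[of 1] by simp
  have fm: "f (- x) = f x" for x
  proof -
    have "f (- 1) * f (- 1) = 1" using mult[of "- 1" "- 1"] f1 by simp
    then have "f (- 1) = 1" using nn[of "- 1"] by (simp add: square_eq_1_iff)
    then show ?thesis using mult[of "- 1" x] by simp
  qed
  have finv: "f (inverse x) = inverse (f x)" for x
  proof (cases "x = 0")
    case False
    then have "f x * f (inverse x) = 1" using mult[of x "inverse x"] f1 by simp
    then show ?thesis by (metis inverse_unique)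
  qed (use zero[of 0] in simp)
  have fpow: "f (x ^ n) = f x ^ n" for x n by (induction n) (simp_all add: f1 mult)
  obtain p where p: "f p > 1"
  proof -
    obtain x where x: "x \<noteq> 0" "f x \<noteq> 1" using nontriv by blast
    have "f x > 0" using nn[of x] zero[of x] x(1) by simp
    then show ?thesis
      using that[of x] that[of "inverse x"] x(2) finv[of x] one_less_inverse[of "f x"] by fastforce
  qed
  then have p0: "p \<noteq> 0" using zero[of p] by auto
  \<comment> \<open>Sums of two elements of the unit ball have absolute value at most 2, so a power
    of \<open>p\<close> beyond 2 can serve as \<open>e\<close>.\<close>
  obtain n where n: "2 < f p ^ n" using real_arch_pow[OF p] by blast
  define e where "e = p ^ n"
  have e: "e \<noteq> 0" "f e > 2" using p0 n by (simp_all add: e_def fpow)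
  define B where "B = {x. f x \<le> 1}"
  have le: "vle B x c \<longleftrightarrow> f x \<le> f c" if c: "c \<noteq> 0" for x c
  proof -
    have c': "f c > 0" using c nn[of c] zero[of c] by simp
    have "vle B x c \<longleftrightarrow> f (x / c) \<le> 1"
      using c unfolding vle_def B_def by (auto intro!: bexI[of _ "x / c"])
    also have "f (x / c) = f x / f c" using mult[of x "inverse c"] finv by (simp add: divide_inverse)
    finally show ?thesis using c' by simp
  qed
  have "V_ball B e"
  proof
    show "1 \<in> B" by (simp add: B_def f1)
    show "x * y \<in> B" if "x \<in> B" "y \<in> B" for x y
      using that nn by (simp add: B_def mult mult_le_one)
    show "- x \<in> B" if "x \<in> B" for x using that by (simp add: B_def fm)
    show "inverse x \<in> B" if "x \<notin> B" for x using that by (simp add: B_def finv inverse_le_1_iff)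
    show "(x + y) / e \<in> B" if "x \<in> B" "y \<in> B" for x y
    proof -
      have "f (x + y) \<le> f e" using that tri[of x y] e(2) by (simp add: B_def)
      moreover have "f ((x + y) / e) = f (x + y) / f e"
        using mult[of "x + y" "inverse e"] finv by (simp add: divide_inverse)
      ultimately show ?thesis using e(2) by (simp add: B_def)
    qed
    show "\<exists>x. x \<notin> B" using p by (intro exI[of _ p]) (simp add: B_def)
  qed (rule e)
  moreover have "ball_topology B (absolute_value_topology f)"
    unfolding ball_topology_def openin_absolute_value_topology
  proof (intro allI ball_cong refl iffI)
    fix U x
    assume "\<exists>\<epsilon>>0. {y. f (y - x) < \<epsilon>} \<subseteq> U"
    then obtain \<epsilon> where \<epsilon>: "\<epsilon> > 0" "{y. f (y - x) < \<epsilon>} \<subseteq> U" by blast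
    have "0 < inverse (f p)" "inverse (f p) < 1" using p by (auto simp: inverse_less_1_iff)
    then obtain m where m: "inverse (f p) ^ m < \<epsilon>" using real_arch_pow_inv[OF \<epsilon>(1)] by blast
    let ?c = "inverse p ^ m"
    have "?c \<noteq> 0" "f ?c < \<epsilon>" using p0 m by (simp_all add: fpow finv)
    then have "\<forall>y. vle B (y - x) ?c \<longrightarrow> y \<in> U" using le[of ?c] \<epsilon>(2) by fastforce
    then show "\<exists>c. c \<noteq> 0 \<and> (\<forall>y. vle B (y - x) c \<longrightarrow> y \<in> U)" using \<open>?c \<noteq> 0\<close> by blast
  next
    fix U x
    assume "\<exists>c. c \<noteq> 0 \<and> (\<forall>y. vle B (y - x) c \<longrightarrow> y \<in> U)"
    then obtain c where c: "c \<noteq> 0" "\<And>y. vle B (y - x) c \<Longrightarrow> y \<in> U" by blast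
    have "f c > 0" using c(1) nn[of c] zero[of c] by simp
    moreover have "{y. f (y - x) < f c} \<subseteq> U" using c(2) le[OF c(1)] by auto
    ultimately show "\<exists>\<epsilon>>0. {y. f (y - x) < \<epsilon>} \<subseteq> U" by blast
  qed
  ultimately show ?thesis by blast
qed

lemma V_topology_ball:
  assumes "V_topology \<tau>"
  shows "\<exists>B e. V_ball B e \<and> ball_topology B \<tau>"
  using assms ball_topology_valuation ball_topology_absolute_value unfolding V_topology_def by blast

text \<open>One boundedness suffices because of totality: if \<open>t\<close> is in
  \<open>B2\<close> but beyond \<open>k'\<close> for \<open>B0\<close>, then \<open>k' / t\<close>
  lies in \<open>B0\<close>, hence is bounded by \<open>k\<close> for \<open>B2\<close>, against the
  choice of \<open>k'\<close>. The contrapositive supplies the independence conditions for distinct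
  topologies.\<close>

lemma bounded_imp_topology_eq:
  assumes A: "V_ball B0 e0" and C: "V_ball B2 e2" and top: "ball_topology B0 \<tau>0" "ball_topology B2 \<tau>2"
    and bounded: "c \<noteq> 0" "\<And>t. vle B0 t c \<Longrightarrow> vle B2 t d"
  shows "\<tau>0 = \<tau>2"
proof -
  interpret A: V_ball B0 e0 by (rule A)
  interpret C: V_ball B2 e2 by (rule C)
  obtain k where k: "k \<noteq> 0" "vle B2 (d / c) k" using C.ex_upper by blast
  have 02: "vle B2 t k" if "vle B0 t 1" for t
  proof -
    have "vle B2 (c * t) d" using bounded(2)[of "c * t"] A.le_mult_left[OF that, of c] by simp
    then have "vle B2 t (d / c)" using C.le_divide_iff[OF bounded(1)] by blast
    then show ?thesis using C.le_trans k(2) by blast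
  qed
  obtain k' where k': "\<not> vle B2 k' k" using C.ex_not_le by blast
  then have k'_nz: "k' \<noteq> 0" by auto
  have 20: "vle B0 t k'" if t: "vle B2 t 1" for t
  proof (rule ccontr)
    assume "\<not> vle B0 t k'"
    then have t0: "t \<noteq> 0" and "vle B0 k' t" using A.le_total by auto
    then have "vle B0 (k' / t) 1" using A.divide_le_iff[OF t0] by simp
    then have "vle B2 k' (t * k)" using 02 C.divide_le_iff[OF t0] by blast
    also have "vle B2 (t * k) (1 * k)" using t by (rule C.le_mult) simp
    ultimately show False using k' C.le_trans by auto
  qed
  have transfer: "\<exists>c'. c' \<noteq> 0 \<and> (\<forall>y. vle B' (y - x) c' \<longrightarrow> y \<in> U)"
    if V: "V_ball B e" "V_ball B' e'" and l: "l \<noteq> 0" "\<And>t. vle B' t 1 \<Longrightarrow> vle B t l"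
      and U: "\<exists>c. c \<noteq> 0 \<and> (\<forall>y. vle B (y - x) c \<longrightarrow> y \<in> U)" for B B' :: "'a set" and e e' l x U
  proof -
    interpret V: V_ball B e by (rule V)
    interpret V': V_ball B' e' by (rule V)
    obtain c where c: "c \<noteq> 0" "\<And>y. vle B (y - x) c \<Longrightarrow> y \<in> U" using U by blast
    have "y \<in> U" if "vle B' (y - x) (c / l)" for y
    proof (rule c(2))
      have "c / l \<noteq> 0" using c(1) l(1) by simp
      then have "vle B' ((y - x) / (c / l)) 1" using that V'.divide_le_iff[of "c / l" "y - x" 1] by simp
      from l(2)[OF this] have "vle B (y - x) (c / l * l)" using V.divide_le_iff[OF \<open>c / l \<noteq> 0\<close>] by blast
      then show "vle B (y - x) c" using l(1) by simp
    qed
    then show ?thesis using c(1) l(1) by (intro exI[of _ "c / l"]) auto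
  qed
  show ?thesis
    unfolding topology_eq
  proof
    fix U
    have "(\<exists>c. c \<noteq> 0 \<and> (\<forall>y. vle B0 (y - x) c \<longrightarrow> y \<in> U)) \<longleftrightarrow>
        (\<exists>c. c \<noteq> 0 \<and> (\<forall>y. vle B2 (y - x) c \<longrightarrow> y \<in> U))" for x
      using transfer[OF A C k'_nz 20, of x U] transfer[OF C A k(1) 02, of x U] by blast
    then show "openin \<tau>0 U = openin \<tau>2 U"
      using top unfolding ball_topology_def by simp
  qed
qed

lemma t_henselian_imp_ball:
  assumes "t_henselian_topology \<tau>" "ball_topology B \<tau>"
  shows "henselian_ball B"
  unfolding henselian_ball_def
proof (intro allI impI)
  fix n :: nat assume "n \<ge> 1"
  then obtain U where U: "openin \<tau> U" "0 \<in> U"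
    "\<And>a. \<forall>i<n. a i \<in> U \<Longrightarrow> \<exists>x. poly (monom 1 (n + 1) + monom 1 n + (\<Sum>i<n. monom (a i) i)) x = 0"
    using assms(1) unfolding t_henselian_topology_def by meson
  obtain c where c: "c \<noteq> 0" "\<And>y. vle B y c \<Longrightarrow> y \<in> U"
    using U(1,2) assms(2) unfolding ball_topology_def by force
  have "\<exists>x. x ^ Suc n + x ^ n + (\<Sum>i<n. a i * x ^ i) = 0" if "\<forall>i<n. vle B (a i) c" for a
    using U(3)[of a] c(2) that by (auto simp: poly_monom poly_sum)
  then show "\<exists>c. c \<noteq> 0 \<and> (\<forall>a. (\<forall>i<n. vle B (a i) c) \<longrightarrow>
      (\<exists>x. x ^ Suc n + x ^ n + (\<Sum>i<n. a i * x ^ i) = 0))"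
    using c(1) by blast
qed



text \<open>Separability is expressed by a Bezout identity. It needs no extension field and directly
  gives a lower bound for the derivative where \<open>f\<close> is small.\<close>

definition sep_closed :: "'k::field itself \<Rightarrow> bool" where
  "sep_closed (_ :: 'k itself) \<longleftrightarrow>
     (\<forall>f :: 'k poly. degree f \<ge> 1 \<and> (\<exists>p q. p * f + q * pderiv f = 1) \<longrightarrow> (\<exists>x. poly f x = 0))"

text \<open>A divisor \<open>f\<close> of least degree with nonzero derivative works. If the gcd
  \<open>d\<close> of \<open>f\<close> and \<open>pderiv f\<close> were not constant,
  \<open>d\<close> and \<open>f / d\<close> would both have smaller degree, hence derivative 0, and
  so would \<open>f\<close>.\<close>

lemma ex_separable_factor:
  fixes P :: "'k::field poly"
  assumes "pderiv P \<noteq> 0"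
  shows "\<exists>f. f dvd P \<and> degree f \<ge> 1 \<and> (\<exists>p q. p * f + q * pderiv f = 1)"
proof -
  let ?S = "\<lambda>f. f dvd P \<and> pderiv f \<noteq> 0"
  obtain f where f: "?S f" "\<And>g. ?S g \<Longrightarrow> degree f \<le> degree g"
    using assms arg_min_nat_lemma[of ?S P degree] by auto
  have deg: "degree (pderiv f) < degree f"
  proof -
    have "degree f \<noteq> 0"
    proof
      assume "degree f = 0"
      then obtain c where "f = [:c:]" by (rule degree_eq_zeroE)
      then show False using f(1) by (simp add: pderiv_pCons)
    qed
    moreover have "degree (pderiv f) \<le> degree f - 1"
      by (rule degree_le) (auto simp: coeff_pderiv coeff_eq_0)
    ultimately show ?thesis by simp
  qed
  let ?I = "{p * f + q * pderiv f | p q. True}"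
  have f_I: "f \<in> ?I" by (intro CollectI exI[of _ 1] exI[of _ 0]) simp
  moreover have "f \<noteq> 0" using f(1) by auto
  ultimately obtain d where d: "d \<in> ?I" "d \<noteq> 0" "\<And>g. g \<in> ?I \<Longrightarrow> g \<noteq> 0 \<Longrightarrow> degree d \<le> degree g"
    using arg_min_nat_lemma[of "\<lambda>d. d \<in> ?I \<and> d \<noteq> 0" f degree] by auto
  have dvd: "d dvd g" if g: "g \<in> ?I" for g
  proof (rule ccontr)
    assume nd: "\<not> d dvd g"
    obtain p q p' q' where "d = p * f + q * pderiv f" "g = p' * f + q' * pderiv f" using d(1) g by blast
    then have "g mod d = (p' - g div d * p) * f + (q' - g div d * q) * pderiv f"
      by (simp add: minus_div_mult_eq_mod[symmetric] algebra_simps)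
    then have "g mod d \<in> ?I" by blast
    moreover have "g mod d \<noteq> 0" using nd by (simp add: mod_eq_0_iff_dvd)
    ultimately show False using d(3)[of "g mod d"] degree_mod_less'[OF d(2), of g] by simp
  qed
  have "pderiv f \<in> ?I" by (intro CollectI exI[of _ 0] exI[of _ 1]) simp
  then have "d dvd pderiv f" by (rule dvd)
  then have deg_d: "degree d < degree f" using deg f(1) dvd_imp_degree_le[of d "pderiv f"] by simp
  obtain g where g: "f = d * g" using dvd[OF f_I] by blast
  have "degree d = 0"
  proof (rule ccontr)
    assume "degree d \<noteq> 0"
    have "d \<noteq> 0" "g \<noteq> 0" using f(1) g by auto
    then have "degree f = degree d + degree g" unfolding g by (rule degree_mult_eq)
    moreover have "d dvd P" "g dvd P" using f(1) g by (auto intro: dvd_trans)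
    ultimately have "pderiv d = 0" "pderiv g = 0"
      using f(2)[of d] f(2)[of g] deg_d \<open>degree d \<noteq> 0\<close> by auto
    then show False using f(1) unfolding g by (simp add: pderiv_mult)
  qed
  then obtain k where k: "d = [:k:]" using degree_eq_zeroE by blast
  obtain p q where pq: "[:k:] = p * f + q * pderiv f" using d(1) unfolding k by blast
  have "smult (inverse k) p * f + smult (inverse k) q * pderiv f = smult (inverse k) (p * f + q * pderiv f)"
    by (simp add: smult_add_right)
  also have "\<dots> = 1" using d(2) unfolding pq[symmetric] k by simp
  finally have "\<exists>p q. p * f + q * pderiv f = 1" by blast
  moreover have "degree f \<ge> 1" using deg by simp
  ultimately show ?thesis using f(1) by blast
qed

text \<open>The two leading coefficients 1 contribute \<open>n + 1\<close> and \<open>n\<close> to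
  the derivative, and these cannot both be 0 in a field. So there is a separable factor whatever the
  other coefficients are.\<close>

lemma sep_closed_imp_henselian:
  fixes B :: "'k::field set"
  assumes "sep_closed TYPE('k)"
  shows "henselian_ball B"
  unfolding henselian_ball_def
proof (intro allI impI)
  fix n :: nat assume n: "n \<ge> 1"
  have "\<exists>x. x ^ Suc n + x ^ n + (\<Sum>i<n. a i * x ^ i) = 0" for a :: "nat \<Rightarrow> 'k"
  proof -
  define P where "P = monom 1 (Suc n) + monom 1 n + (\<Sum>i<n. monom (a i) i)"
  have co: "coeff P (Suc n) = 1" "coeff P n = 1"
    by (simp_all add: P_def coeff_sum)
  have "pderiv P \<noteq> 0"
  proof
    assume "pderiv P = 0"
    then have "coeff (pderiv P) n = 0" "coeff (pderiv P) (n - 1) = 0" by simp_all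
    then have "(of_nat (Suc n) :: 'k) = 0" "(of_nat n :: 'k) = 0"
      using co n by (simp_all add: coeff_pderiv)
    then show False by simp
  qed
  from ex_separable_factor[OF this] obtain f where f: "f dvd P" "degree f \<ge> 1"
    "\<exists>p q. p * f + q * pderiv f = 1" by blast
  then obtain x where "poly f x = 0" using assms unfolding sep_closed_def by blast
  then have "poly P x = 0" using f(1) by (metis dvdE mult_eq_0_iff poly_mult)
  then show ?thesis
    by (auto simp: P_def poly_monom poly_sum)
  qed
  then show "\<exists>c. c \<noteq> 0 \<and> (\<forall>a. (\<forall>i<n. vle B (a i) c) \<longrightarrow>
      (\<exists>x. x ^ Suc n + x ^ n + (\<Sum>i<n. a i * x ^ i) = 0))"
    by (intro exI[of _ 1]) simp
qed


section \<open>Definability\<close>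

lemma fv_rename_tm: "fv_tm (rename_tm r t) = r ` fv_tm t"
  by (induction t) auto

lemma fv_rename: "fv (rename r \<phi>) \<subseteq> r ` fv \<phi>"
proof (induction \<phi> arbitrary: r)
  case (Exists \<phi>)
  have "i \<in> r ` fv (Exists \<phi>)" if "Suc i \<in> fv (rename (case_nat 0 (\<lambda>i. Suc (r i))) \<phi>)" for i
  proof -
    from that Exists[of "case_nat 0 (\<lambda>i. Suc (r i))"]
    obtain j where j: "j \<in> fv \<phi>" "Suc i = case_nat 0 (\<lambda>i. Suc (r i)) j" by blast
    then show ?thesis by (cases j) auto
  qed
  then show ?case by auto
next
  case (Conj \<phi> \<psi>)
  then show ?case unfolding rename.simps fv.simps image_Un by (intro Un_mono)
qed (auto simp: fv_rename_tm)

definition tm_add :: "(ring_sym + 'f) tm \<Rightarrow> (ring_sym + 'f) tm \<Rightarrow> (ring_sym + 'f) tm" where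
  "tm_add s t = App (Inl Sym_Plus) [s, t]"

definition tm_mult :: "(ring_sym + 'f) tm \<Rightarrow> (ring_sym + 'f) tm \<Rightarrow> (ring_sym + 'f) tm" where
  "tm_mult s t = App (Inl Sym_Times) [s, t]"

definition tm_diff :: "(ring_sym + 'f) tm \<Rightarrow> (ring_sym + 'f) tm \<Rightarrow> (ring_sym + 'f) tm" where
  "tm_diff s t = App (Inl Sym_Plus) [s, App (Inl Sym_Minus) [t]]"

definition tm_zero :: "(ring_sym + 'f) tm" where "tm_zero = App (Inl Sym_Zero) []"

definition tm_one :: "(ring_sym + 'f) tm" where "tm_one = App (Inl Sym_One) []"

lemmas tm_defs = tm_add_def tm_mult_def tm_diff_def tm_zero_def tm_one_def

lemma fv_tms [simp]:
  "fv_tm (tm_add s t) = fv_tm s \<union> fv_tm t" "fv_tm (tm_mult s t) = fv_tm s \<union> fv_tm t"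
  "fv_tm (tm_diff s t) = fv_tm s \<union> fv_tm t" "fv_tm tm_zero = {}" "fv_tm tm_one = {}"
  by (auto simp: tm_defs)

lemma wf_tms:
  assumes "expands_ring_language L"
  shows "wf_tm L (tm_add s t) \<longleftrightarrow> wf_tm L s \<and> wf_tm L t" "wf_tm L (tm_mult s t) \<longleftrightarrow> wf_tm L s \<and> wf_tm L t"
    "wf_tm L (tm_diff s t) \<longleftrightarrow> wf_tm L s \<and> wf_tm L t" "wf_tm L tm_zero" "wf_tm L tm_one"
  using assms by (auto simp: tm_defs expands_ring_language_def)

lemma eval_tms:
  assumes "expands_field K"
  shows "eval_tm K e (tm_add s t) = eval_tm K e s + eval_tm K e t"
    "eval_tm K e (tm_mult s t) = eval_tm K e s * eval_tm K e t"
    "eval_tm K e (tm_diff s t) = eval_tm K e s - eval_tm K e t"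
    "eval_tm K e tm_zero = 0" "eval_tm K e tm_one = 1"
  using assms by (auto simp: tm_defs expands_field_def)

primrec tm_poly :: "nat list \<Rightarrow> (ring_sym + 'f) tm \<Rightarrow> (ring_sym + 'f) tm" where
  "tm_poly [] t = tm_zero"
| "tm_poly (i # is) t = tm_add (Var i) (tm_mult t (tm_poly is t))"

lemma eval_tm_poly:
  "expands_field K \<Longrightarrow> eval_tm K e (tm_poly is t) = poly (Poly (map e is)) (eval_tm K e t)"
  by (induction "is") (auto simp: eval_tms)

lemma wf_tm_poly: "expands_ring_language L \<Longrightarrow> wf_tm L t \<Longrightarrow> wf_tm L (tm_poly is t)"
  by (induction "is") (auto simp: wf_tms)

lemma fv_tm_poly: "fv_tm (tm_poly is t) \<subseteq> set is \<union> fv_tm t"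
  by (induction "is") auto

text \<open>Definability up to sandwiching: the definable sets only have to be cofinal with the
  balls. \<open>B\<close> itself need not be definable.\<close>

definition definable_ball ::
    "(ring_sym + 'f, 'r) language \<Rightarrow> (ring_sym + 'f, 'r, 'k::field) struc \<Rightarrow> 'k set \<Rightarrow> bool" where
  "definable_ball L K B \<longleftrightarrow> (\<exists>\<phi> q. wf_fm L \<phi> \<and> fv \<phi> \<subseteq> {..<1 + q} \<and>
     (\<forall>c. c \<noteq> 0 \<longrightarrow> (\<exists>b c'. length b = q \<and> c' \<noteq> 0 \<and>
        (\<forall>x. sat_tuple K \<phi> (x # b) \<longrightarrow> vle B x c) \<and> (\<forall>x. vle B x c' \<longrightarrow> sat_tuple K \<phi> (x # b)))))"

lemma definable_topology_imp_ball:
  fixes L :: "(ring_sym + 'f, 'r) language" and K :: "(ring_sym + 'f, 'r, 'k::field) struc"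
  assumes V: "V_ball B e" and top: "ball_topology B \<tau>" and def: "definable_topology L K \<tau>"
  shows "definable_ball L K B"
proof -
  interpret V_ball B e by (rule V)
  obtain \<phi> q D where \<phi>: "wf_fm L \<phi>" "fv \<phi> \<subseteq> {..<1 + q}" "\<forall>b\<in>D. length b = q"
    and nb: "neighbourhood_basis \<tau> 0 ((\<lambda>b. {x. sat_tuple K \<phi> (x # b)}) ` D)"
    using def unfolding definable_topology_def by blast
  have "\<exists>b c'. length b = q \<and> c' \<noteq> 0 \<and> (\<forall>x. sat_tuple K \<phi> (x # b) \<longrightarrow> vle B x c) \<and>
      (\<forall>x. vle B x c' \<longrightarrow> sat_tuple K \<phi> (x # b))" if c: "c \<noteq> 0" for c
  proof -
    \<comment> \<open>The interior of the ball; for an absolute value the ball itself need not be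
      open.\<close>
    define W where "W = {x. \<exists>d. d \<noteq> 0 \<and> (\<forall>y. vle B (y - x) d \<longrightarrow> vle B y c)}"
    have "openin \<tau> W"
      using top unfolding ball_topology_def
    proof (elim allE[of _ W] iffD2, intro ballI)
      fix x assume "x \<in> W"
      then obtain d where d: "d \<noteq> 0" "\<And>y. vle B (y - x) d \<Longrightarrow> vle B y c" unfolding W_def by blast
      have "y \<in> W" if y: "vle B (y - x) (d / e)" for y
        unfolding W_def
      proof (intro CollectI exI[of _ "d / e"] conjI allI impI)
        fix w assume "vle B (w - y) (d / e)"
        from le_add[OF this y] have "vle B (w - x) d" using e_nz by simp
        then show "vle B w c" by (rule d(2))
      qed (use d(1) e_nz in simp)
      then show "\<exists>c. c \<noteq> 0 \<and> (\<forall>y. vle B (y - x) c \<longrightarrow> y \<in> W)"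
        using d(1) e_nz by (intro exI[of _ "d / e"]) auto
    qed
    moreover have "0 \<in> W" unfolding W_def using c by auto
    ultimately have "\<exists>N\<in>(\<lambda>b. {x. sat_tuple K \<phi> (x # b)}) ` D. N \<subseteq> W"
      using nb unfolding neighbourhood_basis_def by blast
    then obtain b where b: "b \<in> D" "{x. sat_tuple K \<phi> (x # b)} \<subseteq> W" by blast
    have "W \<subseteq> {x. vle B x c}" unfolding W_def by auto
    moreover have "{x. sat_tuple K \<phi> (x # b)} \<in> (\<lambda>b. {x. sat_tuple K \<phi> (x # b)}) ` D"
      using b(1) by (rule imageI)
    then obtain U where U: "openin \<tau> U" "0 \<in> U" "U \<subseteq> {x. sat_tuple K \<phi> (x # b)}"
      using nb[unfolded neighbourhood_basis_def, THEN conjunct1, THEN bspec] by blast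
    then obtain c' where "c' \<noteq> 0" "\<forall>y. vle B (y - 0) c' \<longrightarrow> y \<in> U"
      using top unfolding ball_topology_def by blast
    ultimately show ?thesis using b U(3) \<phi>(3) by (intro exI[of _ b] exI[of _ c']) auto
  qed
  then show ?thesis unfolding definable_ball_def using \<phi>(1,2) by blast
qed

text \<open>The single variable \<open>a\<close> is shattered by the tuples
  \<open>(u, b0, b2)\<close>, where \<open>b0\<close> and \<open>b2\<close> are fixed and only
  \<open>u\<close> depends on the subset.\<close>

lemma not_NIP:
  fixes L :: "(ring_sym + 'f, 'r) language" and K :: "(ring_sym + 'f, 'r, 'k::field) struc"
  assumes L: "expands_ring_language L" and K: "expands_field K"
    and A: "V_ball B0 e0" and C: "V_ball B2 e2" and H: "henselian_ball B0"
    and D0: "definable_ball L K B0" and D2: "definable_ball L K B2"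
    and top: "ball_topology B0 \<tau>0" "ball_topology B2 \<tau>2" "\<tau>0 \<noteq> \<tau>2"
  shows "\<not> NIP TYPE('k) L (theory_of L K)"
proof
  assume NIP: "NIP TYPE('k) L (theory_of L K)"
  interpret A: V_ball B0 e0 by (rule A)
  interpret C: V_ball B2 e2 by (rule C)
  obtain \<phi>0 q0 where \<phi>0: "wf_fm L \<phi>0" "fv \<phi>0 \<subseteq> {..<1 + q0}"
    "\<And>c. c \<noteq> 0 \<Longrightarrow> \<exists>b c'. length b = q0 \<and> c' \<noteq> 0 \<and> (\<forall>x. sat_tuple K \<phi>0 (x # b) \<longrightarrow> vle B0 x c) \<and>
      (\<forall>x. vle B0 x c' \<longrightarrow> sat_tuple K \<phi>0 (x # b))"
    using D0 unfolding definable_ball_def by blast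
  obtain \<phi>2 q2 where \<phi>2: "wf_fm L \<phi>2" "fv \<phi>2 \<subseteq> {..<1 + q2}"
    "\<And>c. c \<noteq> 0 \<Longrightarrow> \<exists>b c'. length b = q2 \<and> c' \<noteq> 0 \<and> (\<forall>x. sat_tuple K \<phi>2 (x # b) \<longrightarrow> vle B2 x c) \<and>
      (\<forall>x. vle B2 x c' \<longrightarrow> sat_tuple K \<phi>2 (x # b))"
    using D2 unfolding definable_ball_def by blast
  \<comment> \<open>So small that \<open>x\<close> and \<open>-1 - x\<close> cannot both be within
    \<open>c0\<close>; \<open>c2\<close> plays the same role for \<open>B2\<close>.\<close>
  obtain c0 where c0: "c0 \<noteq> 0" "\<not> vle B0 1 (e0 * c0)" using A.not_le_one_mult[of 1 e0] by auto
  obtain c2 where c2: "c2 \<noteq> 0" "\<not> vle B2 1 (e2 * c2)" using C.not_le_one_mult[of 1 e2] by auto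
  obtain b0 d0 where b0: "length b0 = q0" "d0 \<noteq> 0" "\<And>x. sat_tuple K \<phi>0 (x # b0) \<Longrightarrow> vle B0 x c0"
    "\<And>x. vle B0 x d0 \<Longrightarrow> sat_tuple K \<phi>0 (x # b0)" using \<phi>0(3)[OF c0(1)] by blast
  obtain b2 d2 where b2: "length b2 = q2" "d2 \<noteq> 0" "\<And>x. sat_tuple K \<phi>2 (x # b2) \<Longrightarrow> vle B2 x c2"
    "\<And>x. vle B2 x d2 \<Longrightarrow> sat_tuple K \<phi>2 (x # b2)" using \<phi>2(3)[OF c2(1)] by blast
  \<comment> \<open>Roots within \<open>l0\<close> satisfy the formula \<open>\<phi>0\<close>, while
    every solution of \<open>\<phi>0\<close> is within \<open>c0\<close>; likewise for
    \<open>l2\<close>.\<close>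
  obtain l0 where l0: "l0 \<noteq> 0" "vle B0 l0 c0" "vle B0 l0 d0" using A.ex_lower c0(1) b0(2) by blast
  obtain l2 where l2: "l2 \<noteq> 0" "vle B2 l2 c2" "vle B2 l2 d2" using C.ex_lower c2(1) b2(2) by blast
  \<comment> \<open>Under the quantifier, variable 0 is the root \<open>x\<close>, 1 is
    \<open>a\<close>, 2 is \<open>u\<close>; then come the entries of \<open>b0\<close> and those of
    \<open>b2\<close>.\<close>
  define r0 :: "nat \<Rightarrow> nat" where "r0 i = (if i = 0 then 0 else i + 2)" for i
  define r2 :: "nat \<Rightarrow> nat" where "r2 i = (if i = 0 then 0 else i + 2 + q0)" for i
  define \<theta> :: "(ring_sym + 'f, 'r) fm" where
    "\<theta> = Eq (tm_mult (tm_add (tm_mult (Var 0) (Var 0)) (Var 0)) (tm_diff (Var 2) (Var 1))) tm_one"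
  define \<psi> where "\<psi> = Exists (Conj \<theta> (Conj (rename r0 \<phi>0) (rename r2 \<phi>2)))"
  have "wf_fm L \<psi>"
    using \<phi>0(1) \<phi>2(1) by (simp add: \<psi>_def \<theta>_def wf_rename wf_tms[OF L])
  moreover have "fv \<psi> \<subseteq> {..<1 + (1 + q0 + q2)}"
  proof -
    have "fv (rename r0 \<phi>0) \<subseteq> {..<3 + q0 + q2}" "fv (rename r2 \<phi>2) \<subseteq> {..<3 + q0 + q2}"
      using fv_rename[of r0 \<phi>0] fv_rename[of r2 \<phi>2] \<phi>0(2) \<phi>2(2) by (fastforce simp: r0_def r2_def)+
    moreover have "fv \<theta> \<subseteq> {..<3 + q0 + q2}" by (auto simp: \<theta>_def)
    ultimately show ?thesis unfolding \<psi>_def by auto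
  qed
  ultimately obtain k where k: "\<not> shatters K \<psi> 1 (1 + q0 + q2) k"
    using NIP unfolding NIP_def is_model_def theory_of_def by blast
  have sat: "sat_tuple K \<psi> (a # u # b0 @ b2) \<longleftrightarrow> (\<exists>x. (x\<^sup>2 + x) * (u - a) = 1 \<and>
      sat_tuple K \<phi>0 (x # b0) \<and> sat_tuple K \<phi>2 (x # b2))" for a u
  proof -
    let ?e = "\<lambda>x. case_nat x ((!) (a # u # b0 @ b2))"
    have "sat K (?e x) (rename r0 \<phi>0) \<longleftrightarrow> sat_tuple K \<phi>0 (x # b0)" for x
      unfolding sat_rename sat_tuple_def
    proof (rule sat_cong)
      fix i assume "i \<in> fv \<phi>0"
      then have "i \<le> q0" using \<phi>0(2) by auto
      then show "?e x (r0 i) = (x # b0) ! i"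
        by (cases i) (auto simp: r0_def nth_append b0(1))
    qed
    moreover have "sat K (?e x) (rename r2 \<phi>2) \<longleftrightarrow> sat_tuple K \<phi>2 (x # b2)" for x
      unfolding sat_rename sat_tuple_def
    proof (rule sat_cong)
      fix i assume "i \<in> fv \<phi>2"
      then show "?e x (r2 i) = (x # b2) ! i"
        by (cases i) (auto simp: r2_def nth_append b0(1))
    qed
    moreover have "sat K (?e x) \<theta> \<longleftrightarrow> (x\<^sup>2 + x) * (u - a) = 1" for x
      by (simp add: \<theta>_def eval_tms[OF K] power2_eq_square)
    ultimately show ?thesis by (simp add: sat_tuple_def \<psi>_def)
  qed
  have ind: "\<exists>t. vle B0 t c \<and> \<not> vle B2 t d" if "c \<noteq> 0" for c d
    using bounded_imp_topology_eq[OF A C top(1,2) that] top(3) by blast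
  have ind': "\<exists>t. vle B2 t c \<and> \<not> vle B0 t d" if "c \<noteq> 0" for c d
    using bounded_imp_topology_eq[OF C A top(2,1) that] top(3) by blast
  obtain a :: "nat \<Rightarrow> 'k" where a: "\<And>J. J \<subseteq> {..<k} \<Longrightarrow> \<exists>u. \<forall>i<k. u \<noteq> a i \<and> (\<exists>x. (x\<^sup>2 + x) * (u - a i) = 1 \<and>
    vle B0 x l0 \<and> (if i \<in> J then vle B2 x l2 else vle B2 (x + 1) l2))"
    using approximation[OF A C H ind ind' l0(1) l2(1)] by blast
  then obtain u where u: "\<And>J i. J \<subseteq> {..<k} \<Longrightarrow> i < k \<Longrightarrow> u J \<noteq> a i \<and> (\<exists>x. (x\<^sup>2 + x) * (u J - a i) = 1 \<and>
    vle B0 x l0 \<and> (if i \<in> J then vle B2 x l2 else vle B2 (x + 1) l2))"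
    by metis
  have "sat_tuple K \<psi> (a i # u J # b0 @ b2) \<longleftrightarrow> i \<in> J" if J: "J \<subseteq> {..<k}" and i: "i < k" for i J
  proof -
    obtain x where x: "(x\<^sup>2 + x) * (u J - a i) = 1" "vle B0 x l0"
      "if i \<in> J then vle B2 x l2 else vle B2 (x + 1) l2" using u[OF J i] by blast
    have d: "u J - a i \<noteq> 0" using u[OF J i] by simp
    have x0: "sat_tuple K \<phi>0 (x # b0)" using b0(4) A.le_trans[OF x(2) l0(3)] by blast
    show ?thesis
    proof
      assume "i \<in> J"
      then have "sat_tuple K \<phi>2 (x # b2)" using b2(4) C.le_trans[OF _ l2(3)] x(3) by simp
      then show "sat_tuple K \<psi> (a i # u J # b0 @ b2)" unfolding sat using x(1) x0 by blast
    next
      assume "sat_tuple K \<psi> (a i # u J # b0 @ b2)"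
      then obtain y where y: "(y\<^sup>2 + y) * (u J - a i) = 1" "vle B0 y c0" "vle B2 y c2"
        unfolding sat using b0(3) b2(3) by blast
      \<comment> \<open>The witness \<open>y\<close> is one of the two roots. The bound for
        \<open>B0\<close> excludes the second one, and for \<open>y = x\<close> the bounds for
        \<open>B2\<close> decide whether \<open>i \<in> J\<close>.\<close>
      have "(x - y) * (x + y + 1) = (x\<^sup>2 + x) - (y\<^sup>2 + y)"
        by (simp add: algebra_simps power2_eq_square)
      also have "x\<^sup>2 + x = y\<^sup>2 + y" using x(1) y(1) d by (metis mult_right_cancel)
      finally consider "x = y" | "x + y + 1 = 0" by auto
      then show "i \<in> J"
      proof cases
        case 1
        show ?thesis
        proof (rule ccontr)
          assume "i \<notin> J"
          then have "vle B2 (x + 1) c2" using x(3) C.le_trans[OF _ l2(2)] by simp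
          moreover have "vle B2 (- x) c2" using y(3) 1 C.le_uminus_iff by blast
          ultimately show False using C.le_add[of "x + 1" c2 "- x"] c2(2) by simp
        qed
      next
        case 2
        have "vle B0 (x + y) (e0 * c0)" using A.le_add[OF A.le_trans[OF x(2) l0(2)] y(2)] .
        moreover have "x + y = - 1" using 2 by (simp add: add_eq_0_iff2)
        ultimately show ?thesis using c0(2) A.le_uminus_iff by metis
      qed
    qed
  qed
  then have "shatters K \<psi> 1 (1 + q0 + q2) k"
    unfolding shatters_def
    by (intro exI[of _ "\<lambda>i. [a i]"] exI[of _ "\<lambda>J. u J # b0 @ b2"]) (simp add: b0(1) b2(1))
  then show False using k by blast
qed

section \<open>Defining a henselian topology by a separable polynomial without a root\<close>

lemma coeff_shift:
  fixes f :: "'k::field poly"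
  shows "\<exists>q. \<forall>y. coeff (pcompose f [:y, 1:]) j = poly q y"
proof (induction f arbitrary: j)
  case 0
  then show ?case by (auto intro: exI[of _ 0])
next
  case (pCons a f)
  obtain q where q: "\<And>y. coeff (pcompose f [:y, 1:]) j = poly q y" using pCons.IH by blast
  obtain q' where q': "\<And>y. coeff (pcompose f [:y, 1:]) (j - 1) = poly q' y" using pCons.IH by blast
  show ?case
    by (cases j; rule exI[of _ "(if j = 0 then [:a:] else q') + pCons 0 q"])
      (use q q' in \<open>auto simp: pcompose_pCons coeff_pCons ac_simps\<close>)
qed

lemma coeff_shift_1: "coeff (pcompose f [:y, 1:]) 1 = poly (pderiv f) y"
proof -
  have "coeff (pcompose f [:y, 1:]) 1 = coeff (pderiv (pcompose f [:y, 1:])) 0"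
    by (simp add: coeff_pderiv)
  also have "\<dots> = poly (pderiv f) y"
    by (simp add: pderiv_pcompose pderiv_pCons poly_pcompose flip: poly_0_coeff_0)
  finally show ?thesis .
qed

context V_ball
begin

text \<open>If \<open>f\<close> took arbitrarily small values, their arguments would be bounded, and
  the Bezout identity would keep \<open>pderiv f\<close> away from 0 there. Hensel's lemma for
  \<open>f(y + X)\<close> would then produce a root.\<close>

lemma separable_bounded_below:
  assumes H: "henselian_ball B" and f: "degree f \<ge> 1" "p * f + q * pderiv f = 1"
    and no_root: "\<And>x. poly f x \<noteq> 0"
  shows "\<exists>d. d \<noteq> 0 \<and> (\<forall>y. \<not> poly f y \<preceq> d)"
proof (rule ccontr)
  assume "\<not> ?thesis"
  then have ex: "\<And>d. d \<noteq> 0 \<Longrightarrow> \<exists>y. poly f y \<preceq> d" by blast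
  define F where "F = filtercomap (poly f) near0"
  have ev: "eventually P F \<longleftrightarrow> (\<exists>c. c \<noteq> 0 \<and> (\<forall>y. poly f y \<preceq> c \<longrightarrow> P y))" for P
    unfolding F_def eventually_filtercomap eventually_near0
  proof
    assume "\<exists>c. c \<noteq> 0 \<and> (\<forall>y. poly f y \<preceq> c \<longrightarrow> P y)"
    then obtain c where "c \<noteq> 0" "\<forall>y. poly f y \<preceq> c \<longrightarrow> P y" by blast
    then show "\<exists>Q. (\<exists>c. c \<noteq> 0 \<and> (\<forall>h. h \<preceq> c \<longrightarrow> Q h)) \<and> (\<forall>x. Q (poly f x) \<longrightarrow> P x)"
      by (intro exI[of _ "\<lambda>h. h \<preceq> c"]) blast
  qed blast
  have F: "F \<noteq> bot" unfolding trivial_limit_def ev using ex by blast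
  have null: "null F (poly f)" unfolding vnull_def ev by blast
  \<comment> \<open>Without coordinates, \<open>std\<close> merely says that \<open>u\<close> tends
    to infinity, where a nonconstant polynomial cannot stay bounded.\<close>
  let ?E = "inf (std (\<lambda>_. 0) 0) (principal {p. poly f (fst p) \<preceq> 1})"
  have "?E = bot"
  proof (rule ccontr)
    assume "?E \<noteq> bot"
    moreover have "large ?E fst" by (rule large_mono[OF inf_le1 std_large])
    moreover have "bdd ?E (\<lambda>i. poly f (fst i))"
      unfolding vbdd_def by (rule exI[of _ 1]) (simp add: eventually_inf_principal)
    ultimately have "degree f = 0" by (rule poly_bdd_imp_const)
    then show False using f(1) by simp
  qed
  then have "eventually (\<lambda>_. False) ?E" by simp
  then obtain M where M: "\<And>y. poly f y \<preceq> 1 \<Longrightarrow> y \<preceq> M"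
    unfolding eventually_inf_principal eventually_std by (auto simp: on_curve_def)
  have b: "bdd F (\<lambda>y. y)" unfolding vbdd_def ev using M by (intro exI[of _ M] exI[of _ 1]) simp
  have "null F (\<lambda>y. - (poly p y * poly f y))" by (intro null_uminus null_mult_bdd' bdd_poly b null)
  moreover have "- (poly p y * poly f y) = poly q y * poly (pderiv f) y - 1" for y
  proof -
    have "poly (p * f + q * pderiv f) y = 1" using f(2) by simp
    then show ?thesis by (simp add: algebra_simps)
  qed
  ultimately have "null F (\<lambda>y. poly q y * poly (pderiv f) y - 1)" by simp
  from bdd_inverse[OF this] have inv: "\<forall>\<^sub>F y in F. poly q y * poly (pderiv f) y \<noteq> 0"
    "bdd F (\<lambda>y. inverse (poly q y * poly (pderiv f) y))" by simp_all
  let ?P = "\<lambda>y. pcompose f [:y, 1:]"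
  have "\<exists>h. null F h \<and> (\<forall>\<^sub>F y in F. poly (?P y) (h y) = 0)"
  proof (rule hensel[OF H])
    show "degree (?P y) \<le> Suc (degree f)" for y by (simp add: degree_pcompose)
    show "null F (\<lambda>y. coeff (?P y) 0)"
      using null by (simp add: poly_pcompose flip: poly_0_coeff_0)
    show "bdd F (\<lambda>y. coeff (?P y) j)" for j
      using coeff_shift[of f j] bdd_poly[OF b] by auto
    show "\<forall>\<^sub>F y in F. coeff (?P y) 1 \<noteq> 0"
      unfolding coeff_shift_1 using inv(1) by eventually_elim auto
    have "bdd F (\<lambda>y. poly q y * inverse (poly q y * poly (pderiv f) y))"
      by (intro bdd_mult bdd_poly b inv)
    then show "bdd F (\<lambda>y. inverse (coeff (?P y) 1))"
    proof (rule bdd_cong[rotated])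
      show "\<forall>\<^sub>F y in F. poly q y * inverse (poly q y * poly (pderiv f) y) = inverse (coeff (?P y) 1)"
        unfolding coeff_shift_1 using inv(1) by eventually_elim simp
    qed
  qed
  then obtain h where "\<forall>\<^sub>F y in F. poly (?P y) (h y) = 0" by blast
  then have "\<forall>\<^sub>F y in F. False" by eventually_elim (use no_root in \<open>simp add: poly_pcompose\<close>)
  then show False using F by simp
qed

text \<open>Hensel's lemma applied to \<open>f(y0 + X) - 1 / (v + s)\<close>, which has the simple
  root 0 at \<open>s = 0\<close>.\<close>

lemma separable_open:
  assumes H: "henselian_ball B" and y0: "poly f y0 \<noteq> 0" "poly (pderiv f) y0 \<noteq> 0"
  shows "\<exists>c. c \<noteq> 0 \<and> (\<forall>s. s \<preceq> c \<longrightarrow> (\<exists>y. inverse (poly f y) = inverse (poly f y0) + s))"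
proof -
  define v where "v = inverse (poly f y0)"
  define w where "w s = inverse (v + s)" for s
  let ?P = "\<lambda>s. pcompose f [:y0, 1:] - [:w s:]"
  have v: "v \<noteq> 0" using y0 by (simp add: v_def)
  have "null near0 (\<lambda>s. (v + s) - v)" using null_near0 by simp
  note inv = bdd_inverse[OF this v]
  have "null near0 (\<lambda>s. s * (inverse (v + s) * inverse v))"
    by (intro null_mult_bdd null_near0 bdd_mult inv bdd_const)
  then have n0: "null near0 (\<lambda>s. coeff (?P s) 0)"
  proof (rule null_cong[rotated])
    show "\<forall>\<^sub>F s in near0. s * (inverse (v + s) * inverse v) = coeff (?P s) 0"
      using inv(1)
    proof eventually_elim
      case (elim s)
      have "coeff (?P s) 0 = inverse v - w s"
        using y0 by (simp add: v_def poly_pcompose flip: poly_0_coeff_0)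
      also have "\<dots> = s * (inverse (v + s) * inverse v)"
        using elim v by (simp add: w_def field_simps)
      finally show ?case ..
    qed
  qed
  have "\<exists>h. null near0 h \<and> (\<forall>\<^sub>F s in near0. poly (?P s) (h s) = 0)"
  proof (rule hensel[OF H])
    show "degree (?P s) \<le> Suc (degree f)" for s
      by (intro order_trans[OF degree_diff_le_max]) (simp add: degree_pcompose)
    show "null near0 (\<lambda>s. coeff (?P s) 0)" by (rule n0)
    have c: "coeff (?P s) (Suc j) = coeff (pcompose f [:y0, 1:]) (Suc j)" for j s by simp
    show "bdd near0 (\<lambda>s. coeff (?P s) j)" for j
      using null_imp_bdd[OF n0] c by (cases j) (simp_all only: bdd_const)
    show "bdd near0 (\<lambda>s. inverse (coeff (?P s) 1))" unfolding One_nat_def c by (rule bdd_const)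
    show "\<forall>\<^sub>F s in near0. coeff (?P s) 1 \<noteq> 0"
      using y0(2) coeff_shift_1[of f y0] by (simp add: c)
  qed
  then obtain h where h: "\<forall>\<^sub>F s in near0. poly (?P s) (h s) = 0" by blast
  have "\<forall>\<^sub>F s in near0. \<exists>y. inverse (poly f y) = v + s"
    using h
  proof eventually_elim
    case (elim s)
    then have "inverse (poly f (y0 + h s)) = v + s" by (simp add: poly_pcompose w_def)
    then show ?case ..
  qed
  then show ?thesis unfolding eventually_near0 v_def by blast
qed

end

text \<open>The values of \<open>1 / f\<close> are bounded by \<open>separable_bounded_below\<close>
  and fill a neighbourhood of \<open>1 / f(y0)\<close> by \<open>separable_open\<close>. Their
  differences therefore lie between two balls around 0, and scaling makes them a base.\<close>

lemma henselian_definable: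
  fixes L :: "(ring_sym + 'f, 'r) language" and K :: "(ring_sym + 'f, 'r, 'k::field) struc"
  assumes L: "expands_ring_language L" and K: "expands_field K"
    and V: "V_ball B e" and H: "henselian_ball B" and ns: "\<not> sep_closed TYPE('k)"
  shows "definable_ball L K B"
proof -
  interpret V_ball B e by (rule V)
  obtain f :: "'k poly" and p q where f: "degree f \<ge> 1" "p * f + q * pderiv f = 1" "\<And>x. poly f x \<noteq> 0"
    using ns unfolding sep_closed_def by blast
  have "pderiv f \<noteq> 0"
  proof
    assume "pderiv f = 0"
    then have 1: "p * f = 1" using f(2) by simp
    then have "p \<noteq> 0" "f \<noteq> 0" by auto
    then have "degree p + degree f = 0" using 1 by (metis degree_mult_eq degree_1)
    then show False using f(1) by simp
  qed
  moreover have "infinite (UNIV :: 'k set)" by (rule infinite_super[OF subset_UNIV infinite_not_le])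
  ultimately have "{y. poly (pderiv f) y = 0} \<noteq> UNIV" using poly_roots_finite[of "pderiv f"] by metis
  then obtain y0 where y0: "poly (pderiv f) y0 \<noteq> 0" by blast
  obtain d where d: "d \<noteq> 0" "\<And>y. \<not> poly f y \<preceq> d"
    using separable_bounded_below[OF H f] by blast
  obtain c' where c': "c' \<noteq> 0" "\<And>s. s \<preceq> c' \<Longrightarrow> \<exists>y. inverse (poly f y) = inverse (poly f y0) + s"
    using separable_open[OF H f(3) y0] by blast
  have inv: "inverse (poly f y) \<preceq> inverse d" for y
  proof (rule le_inverse[OF d(1)])
    show "d \<preceq> poly f y" using d(2) le_total by blast
  qed
  define xs where "xs = coeffs f"
  define m where "m = length xs"
  let ?t = "\<lambda>i. tm_poly [4..<4 + m] (Var i) :: (ring_sym + 'f) tm"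
  \<comment> \<open>The equation with denominators cleared: variables 0 and 1 are \<open>y'\<close>
    and \<open>y\<close>, 2 is \<open>x\<close>, 3 is the scaling factor, and the coefficients of
    \<open>f\<close> start at 4.\<close>
  define \<psi> :: "(ring_sym + 'f, 'r) fm" where
    "\<psi> = Eq (tm_mult (Var 2) (tm_mult (?t 1) (?t 0))) (tm_mult (Var 3) (tm_diff (?t 0) (?t 1)))"
  define \<phi> where "\<phi> = Exists (Exists \<psi>)"
  have "wf_fm L \<phi>" by (simp add: \<phi>_def \<psi>_def wf_tms[OF L] wf_tm_poly[OF L])
  moreover have "fv \<phi> \<subseteq> {..<1 + (1 + m)}"
  proof -
    have "fv_tm (?t i) \<subseteq> insert i {4..<4 + m}" for i using fv_tm_poly[of "[4..<4 + m]" "Var i :: (ring_sym + 'f) tm"] by auto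
    then have "fv \<psi> \<subseteq> {..<4 + m}" unfolding \<psi>_def by fastforce
    then show ?thesis unfolding \<phi>_def by auto
  qed
  moreover have sat: "sat_tuple K \<phi> (x # k # xs) \<longleftrightarrow>
      (\<exists>y y'. x = k * (inverse (poly f y) - inverse (poly f y')))" for x k
  proof -
    have "sat K (case_nat y' (case_nat y ((!) (x # k # xs)))) \<psi> \<longleftrightarrow>
        x = k * (inverse (poly f y) - inverse (poly f y'))" for y y'
    proof -
      let ?e = "case_nat y' (case_nat y ((!) (x # k # xs)))"
      have "map ?e [4..<4 + m] = xs"
        by (rule nth_equalityI) (auto simp: m_def)
      then have "eval_tm K ?e (?t i) = poly f (?e i)" for i
        by (simp only: eval_tm_poly[OF K] eval_tm.simps) (simp only: xs_def Poly_coeffs)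
      then have "sat K ?e \<psi> \<longleftrightarrow> x * (poly f y * poly f y') = k * (poly f y' - poly f y)"
        by (simp add: \<psi>_def eval_tms[OF K] numeral_2_eq_2 numeral_3_eq_3)
      also have "\<dots> \<longleftrightarrow> x = k * (inverse (poly f y) - inverse (poly f y'))"
        using f(3) by (simp add: field_simps)
      finally show ?thesis .
    qed
    then show ?thesis unfolding sat_tuple_def \<phi>_def by simp
  qed
  moreover have "\<exists>b l. length b = 1 + m \<and> l \<noteq> 0 \<and> (\<forall>x. sat_tuple K \<phi> (x # b) \<longrightarrow> x \<preceq> c) \<and>
      (\<forall>x. x \<preceq> l \<longrightarrow> sat_tuple K \<phi> (x # b))" if c: "c \<noteq> 0" for c
  proof -
    \<comment> \<open>A difference of two reciprocals is \<open>\<preceq> e * inverse d\<close>, so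
      this factor scales it to at most \<open>c\<close>.\<close>
    let ?k = "c * d / e"
    have k: "?k \<noteq> 0" using c d(1) e_nz by simp
    have "x \<preceq> c" if "sat_tuple K \<phi> (x # ?k # xs)" for x
    proof -
      obtain y y' where x: "x = ?k * (inverse (poly f y) - inverse (poly f y'))"
        using \<open>sat_tuple K \<phi> (x # ?k # xs)\<close> unfolding sat by blast
      have "inverse (poly f y) + - inverse (poly f y') \<preceq> e * inverse d"
        using inv[of y] inv[of y'] by (intro le_add) (simp_all del: add_uminus_conv_diff)
      then have "x \<preceq> ?k * (e * inverse d)" unfolding x by (intro le_mult_left) simp
      then show ?thesis using d(1) e_nz by simp
    qed
    moreover have "sat_tuple K \<phi> (x # ?k # xs)" if x: "x \<preceq> ?k * c'" for x
    proof -
      have "x / ?k \<preceq> c'" using x divide_le_iff[OF k] by blast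
      then obtain y where "inverse (poly f y) = inverse (poly f y0) + x / ?k" using c'(2) by blast
      then have "x = ?k * (inverse (poly f y) - inverse (poly f y0))" using k by simp
      then show ?thesis unfolding sat by blast
    qed
    moreover have "?k * c' \<noteq> 0" using k c'(1) by simp
    ultimately show ?thesis
      by (intro exI[of _ "?k # xs"] exI[of _ "?k * c'"] conjI) (auto simp: m_def)
  qed
  ultimately show ?thesis unfolding definable_ball_def by blast
qed

theorem theorem5p3:
  fixes L :: "(ring_sym + 'f, 'r) language"
    and K :: "(ring_sym + 'f, 'r, 'k::field) struc"
  assumes "expands_ring_language L"
    and "expands_field K"
    and "NIP TYPE('k) L (theory_of L K)"
    and "t_henselian_field TYPE('k)"
  shows "\<exists>\<^sub>\<le>\<^sub>1 \<tau> :: 'k topology. V_topology \<tau> \<and> definable_topology L K \<tau>"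
proof (rule Uniq_I, elim conjE, rule ccontr)
  fix \<tau>1 \<tau>2 :: "'k topology"
  assume \<tau>: "V_topology \<tau>1" "definable_topology L K \<tau>1" "V_topology \<tau>2" "definable_topology L K \<tau>2"
    and ne: "\<tau>1 \<noteq> \<tau>2"
  obtain B1 e1 where B1: "V_ball B1 e1" "ball_topology B1 \<tau>1" using V_topology_ball[OF \<tau>(1)] by blast
  obtain B2 e2 where B2: "V_ball B2 e2" "ball_topology B2 \<tau>2" using V_topology_ball[OF \<tau>(3)] by blast
  note D1 = definable_topology_imp_ball[OF B1 \<tau>(2)] and D2 = definable_topology_imp_ball[OF B2 \<tau>(4)]
  note no = not_NIP[OF assms(1,2)]
  show False
  proof (cases "sep_closed TYPE('k)")
    case True
    then show False
      using no[OF B1(1) B2(1) sep_closed_imp_henselian D1 D2 B1(2) B2(2) ne] assms(3) by blast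
  next
    case False
    obtain \<tau>0 :: "'k topology" where \<tau>0: "t_henselian_topology \<tau>0"
      using assms(4) unfolding t_henselian_field_def by blast
    then obtain B0 e0 where B0: "V_ball B0 e0" "ball_topology B0 \<tau>0"
      using V_topology_ball unfolding t_henselian_topology_def by blast
    note H = t_henselian_imp_ball[OF \<tau>0 B0(2)]
    note D0 = henselian_definable[OF assms(1,2) B0(1) H False]
    \<comment> \<open>The henselian topology may be one of the two, but it differs from the other,
      and being definable it can be paired with that one.\<close>
    from ne consider "\<tau>0 \<noteq> \<tau>1" | "\<tau>0 \<noteq> \<tau>2" by blast
    then show False
      using no[OF B0(1) B1(1) H D0 D1 B0(2) B1(2)] no[OF B0(1) B2(1) H D0 D2 B0(2) B2(2)] assms(3)
      by cases blast+
  qed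
qed


end
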